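(* Let $1\le p<\infty$, let $f\in\mathscr H^p$, and let $\chi\in\mathscr C_p(f)$. Then the mean counting function $$\mathscr M(f,\zeta)=\lim_{\sigma_0\downarrow0}\lim_{T\to\infty}\frac{\pi}{T}\sum_{\substack{s\in\mathscr Z(f_\chi-\zeta)\\|\operatorname{Im}s|<T\\\operatorname{Re}s>\sigma_0}}(\operatorname{Re}s-\sigma_0)$$ exists and is finite for all $\zeta\in\mathbb C\setminus\{f(+\infty)\}$, and its value is independent of $\chi\in\mathscr C_p(f)$.
   Context: For real $\kappa$ let $\mathbb C_\kappa=\{s\in\mathbb C:\operatorname{Re}s>\kappa\}$. For a Dirichlet polynomial $P(s)=\sum_{n=1}^N a_nn^{-s}$ put $M_p(P,\sigma)=\left(\lim_{T\to\infty}\frac1{2T}\int_{-T}^T|P(\sigma+it)|^p\,\mathrm dt\right)^{1/p}$ and $\|P\|_{\mathscr H^p}=\lim_{\sigma\downarrow0}M_p(P,\sigma)$. The space $\mathscr H^p$ is the completion of the space of Dirichlet polynomials in this norm. Its elements are identified with Dirichlet series $f(s)=\sum_{n\ge1}a_nn^{-s}$ (the coefficient $a_n$ being the limit of the $n$-th coefficients of an approximating Cauchy sequence of Dirichlet polynomials); these series converge absolutely in $\mathbb C_{1/2}$. Write $f(+\infty)=a_1$ for the constant term. $\mathbb T$ is the unit circle and $\mathbb T^\infty=\mathbb T\times\mathbb T\times\cdots$ is identified with the set of completely multiplicative functions $\chi:\mathbb Z^+\to\mathbb T$ via $\chi\leftrightarrow(\chi(2),\chi(3),\chi(5),\dots)$.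 Put $f_\chi(s)=\sum_{n\ge1}a_n\chi(n)n^{-s}$. The $p$-Carlson set $\mathscr C_p(f)$ is the set of all $\chi\in\mathbb T^\infty$ such that $f_\chi$ has an analytic continuation to $\mathbb C_0$ (still denoted $f_\chi$) satisfying $\sup_{\sigma>0}\sup_{T\ge1}\frac1{2T}\int_{-T}^T|f_\chi(\sigma+it)|^p\,\mathrm dt<\infty$. $\mathscr Z(g)$ denotes the zero set (in $\mathbb C_0$) of an analytic function $g$ on $\mathbb C_0$; in sums over $\mathscr Z(g)$ each term is repeated according to the multiplicity of the zero. *)

theory Defs
  imports "HOL-Complex_Analysis.Complex_Analysis"
begin

definition half_plane :: "real \<Rightarrow> complex set" where
  "half_plane \<kappa> = {s. Re s > \<kappa>}"

text \<open>Dirichlet series and polynomials are represented by their coefficient functions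
  \<open>a :: nat \<Rightarrow> complex\<close>, normalised by \<open>a 0 = 0\<close> because indices start at 1.\<close>

definition dirichlet_polynomial :: "(nat \<Rightarrow> complex) \<Rightarrow> bool" where
  "dirichlet_polynomial a \<longleftrightarrow> a 0 = 0 \<and> finite {n. a n \<noteq> 0}"

definition eval_dirichlet_polynomial :: "(nat \<Rightarrow> complex) \<Rightarrow> complex \<Rightarrow> complex" where
  "eval_dirichlet_polynomial a s = (\<Sum>n | a n \<noteq> 0. a n * of_nat n powr (- s))"

text \<open>\<open>(1/2T) \<integral>\<^bsub>-T\<^esub>\<^bsup>T\<^esup> |F(\<sigma> + it)|\<^sup>p dt\<close>\<close>

definition vertical_mean :: "real \<Rightarrow> (complex \<Rightarrow> complex) \<Rightarrow> real \<Rightarrow> real \<Rightarrow> real" where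
  "vertical_mean p F \<sigma> T =
     1 / (2 * T) * integral {-T..T} (\<lambda>t. cmod (F (Complex \<sigma> t)) powr p)"

definition Mp :: "real \<Rightarrow> (nat \<Rightarrow> complex) \<Rightarrow> real \<Rightarrow> real" where
  "Mp p a \<sigma> =
     (Lim at_top (\<lambda>T. vertical_mean p (eval_dirichlet_polynomial a) \<sigma> T)) powr (1 / p)"

definition Hp_norm :: "real \<Rightarrow> (nat \<Rightarrow> complex) \<Rightarrow> real" where
  "Hp_norm p a = Lim (at_right 0) (\<lambda>\<sigma>. Mp p a \<sigma>)"

text \<open>An element of the completion is identified with the coefficient sequence which is the
  coefficientwise limit of a Cauchy sequence of Dirichlet polynomials representing it.\<close>

definition Hp_space :: "real \<Rightarrow> (nat \<Rightarrow> complex) set" where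
  "Hp_space p = {a. \<exists>P :: nat \<Rightarrow> nat \<Rightarrow> complex.
      (\<forall>k. dirichlet_polynomial (P k)) \<and>
      (\<forall>e>0. \<exists>K. \<forall>j\<ge>K. \<forall>k\<ge>K. Hp_norm p (\<lambda>n. P j n - P k n) < e) \<and>
      (\<forall>n. (\<lambda>k. P k n) \<longlonglongrightarrow> a n)}"

text \<open>Points of the infinite torus as completely multiplicative unimodular functions on the
  positive integers; the value at 0 is fixed so that the representation is unique.\<close>

definition torus_characters :: "(nat \<Rightarrow> complex) set" where
  "torus_characters = {\<omega>. \<omega> 0 = 0 \<and> (\<forall>n>0. cmod (\<omega> n) = 1) \<and>
      (\<forall>m n. \<omega> (m * n) = \<omega> m * \<omega> n)}"

text \<open>\<open>F\<close> is the analytic continuation to the right half-plane of the twisted series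
  \<open>\<Sum> a\<^sub>n \<omega>(n) n\<^bsup>-s\<^esup>\<close>, given on \<open>Re s > 1/2\<close>; it is unique on the right half-plane, and its
  values elsewhere are irrelevant. The term with index 0 vanishes.\<close>

definition twisted_continuation ::
  "(nat \<Rightarrow> complex) \<Rightarrow> (nat \<Rightarrow> complex) \<Rightarrow> (complex \<Rightarrow> complex) \<Rightarrow> bool" where
  "twisted_continuation a \<omega> F \<longleftrightarrow> F holomorphic_on half_plane 0 \<and>
     (\<forall>s\<in>half_plane (1/2). (\<lambda>n. a n * \<omega> n * of_nat n powr (- s)) sums F s)"

definition carlson_set :: "real \<Rightarrow> (nat \<Rightarrow> complex) \<Rightarrow> (nat \<Rightarrow> complex) set" where
  "carlson_set p a = {\<omega> \<in> torus_characters. \<exists>F. twisted_continuation a \<omega> F \<and>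
      (\<exists>C. \<forall>\<sigma>>0. \<forall>T\<ge>1. vertical_mean p F \<sigma> T \<le> C)}"

definition counting_zeros ::
  "(complex \<Rightarrow> complex) \<Rightarrow> complex \<Rightarrow> real \<Rightarrow> real \<Rightarrow> complex set" where
  "counting_zeros F \<zeta> \<sigma>\<^sub>0 T = {s \<in> half_plane 0. F s - \<zeta> = 0 \<and> \<bar>Im s\<bar> < T \<and> Re s > \<sigma>\<^sub>0}"

definition zero_average ::
  "(complex \<Rightarrow> complex) \<Rightarrow> complex \<Rightarrow> real \<Rightarrow> real \<Rightarrow> real" where
  "zero_average F \<zeta> \<sigma>\<^sub>0 T = pi / T *
     (\<Sum>s\<in>counting_zeros F \<zeta> \<sigma>\<^sub>0 T. of_int (zorder (\<lambda>w. F w - \<zeta>) s) * (Re s - \<sigma>\<^sub>0))"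

text \<open>The iterated limit exists and equals the real number \<open>m\<close>. Finiteness of the zero sets is
  part of the notion, since \<open>sum\<close> over an infinite set would be 0 by convention.\<close>

definition has_mean_counting :: "(complex \<Rightarrow> complex) \<Rightarrow> complex \<Rightarrow> real \<Rightarrow> bool" where
  "has_mean_counting F \<zeta> m \<longleftrightarrow>
     (\<forall>\<sigma>\<^sub>0>0. \<forall>T>0. finite (counting_zeros F \<zeta> \<sigma>\<^sub>0 T)) \<and>
     (\<exists>g. (\<forall>\<sigma>\<^sub>0>0. ((\<lambda>T. zero_average F \<zeta> \<sigma>\<^sub>0 T) \<longlongrightarrow> g \<sigma>\<^sub>0) at_top) \<and>
          (g \<longlongrightarrow> m) (at_right 0))"

end

theory Submission
  imports Defs "HOL-Real_Asymp.Real_Asymp"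
begin

text \<open>Write \<open>F\<close> for the continuation of the twisted series. The sum over zeros of height below \<open>T\<close> is an
average over vertical translates: if a zero \<open>s\<close> of a function \<open>g\<close> is given the weight
\<open>(Re s - \<sigma>\<^sub>0)\<^sup>+ tent (Im s)\<close>, where \<open>tent\<close> is a window of integral one, and \<open>\<Phi> g\<close> is the sum of the
weights of all zeros of \<open>g\<close>, then integrating \<open>\<Phi> (F (\<cdot> + \<i>t) - \<zeta>)\<close> over \<open>t\<close> counts every zero of \<open>F - \<zeta>\<close> with
weight \<open>Re s - \<sigma>\<^sub>0\<close>, up to the ends of the interval (\<open>zero_average_tendsto\<close>). So the task is to show that
the functional \<open>\<Phi>\<close> has a mean along the translates of \<open>F\<close>, and that this mean depends on neither \<open>F\<close> nor
the character.

For a Dirichlet polynomial, translation by \<open>t\<close> moves the character along the Kronecker flow of the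
infinite torus. Since \<open>\<Phi>\<close> is continuous by Hurwitz's theorem, unique ergodicity of the flow
(\<open>time_average_tendsto\<close>) gives the mean and its independence of the character. Unique ergodicity follows
from Stone-Weierstrass and the fact that \<open>(l/k)\<^sup>\<i>\<^sup>t\<close> has mean zero for \<open>k \<noteq> l\<close>.

A function in the Hardy space is a coefficientwise limit of polynomials \<open>P\<^sub>k\<close> with bounded means of
modulus (\<open>Hp_space_bounded_approximation\<close>; the bound on the boundary is transferred into the half-plane
by duality and the maximum principle). Far to the right \<open>F - P\<^sub>k\<close> is uniformly small. To come back to
the line \<open>Re s = \<sigma>\<^sub>0\<close> the half-plane is mapped to the unit disc by the Cayley transform: a function that
is small on a small disc and whose mean over a large circle is bounded is small in between
(\<open>two_constants_circle_mean\<close>), and circle means, unlike maxima, are controlled on average over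
translates by the means over vertical lines. So most translates of \<open>F\<close> and \<open>P\<^sub>k\<close> are close to each other
and lie in a normal family, on which \<open>\<Phi>\<close> is uniformly continuous
(\<open>weighted_zero_sum_uniformly_continuous\<close>). The remaining translates contribute little, because Jensen's
inequality bounds \<open>\<Phi>\<close> by the logarithm of a circle mean, which is uniformly integrable. This is
\<open>weighted_zero_sum_comparison\<close>, and integrating it gives \<open>disc_average_limit\<close>.

The assumption \<open>\<zeta> \<noteq> a 1\<close> enters because \<open>F\<close> and the \<open>P\<^sub>k\<close> tend to their constant terms at the right: it
provides an abscissa \<open>d\<close> beyond which \<open>F - \<zeta>\<close> is bounded away from zero, so that the zeros have bounded
real part and Jensen's inequality has a lower bound at the centre of the disc.

Finally the limit in \<open>T\<close> is decreasing in \<open>\<sigma>\<^sub>0\<close>. It stays bounded as \<open>\<sigma>\<^sub>0 \<down> 0\<close> since Jensen's inequality in the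
disc weighs a zero by its distance to the unit circle, which is comparable to its distance to the
imaginary axis, while the circle means are bounded uniformly (\<open>carlson_zero_density_bound\<close>).\<close>

section \<open>Equidistribution of the Kronecker flow on the torus\<close>

text \<open>The vertical translation \<open>s \<mapsto> s + \<i>t\<close> of a twisted Dirichlet series is the twist by
\<open>flow t \<omega>\<close>, so that averages over vertical translates become averages along an orbit of this flow.\<close>

definition flow :: "real \<Rightarrow> (nat \<Rightarrow> complex) \<Rightarrow> nat \<Rightarrow> complex" where
  "flow t \<omega> = (\<lambda>n. \<omega> n * of_nat n powr (- (\<i> * of_real t)))"

definition unit_character :: "nat \<Rightarrow> complex" where
  "unit_character n = (if n = 0 then 0 else 1)"

definition time_average :: "((nat \<Rightarrow> complex) \<Rightarrow> 'b::real_normed_vector) \<Rightarrow> (nat \<Rightarrow> complex) \<Rightarrow> real \<Rightarrow> 'b" where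
  "time_average h \<omega> T = (1 / (2 * T)) *\<^sub>R integral {-T..T} (\<lambda>t. h (flow t \<omega>))"

text \<open>This is the integral against Haar measure of the torus, obtained without constructing the measure:
for continuous functions the limit is the same from every starting point
(\<open>time_average_tendsto\<close>), which makes the choice of the unit character immaterial.\<close>

definition torus_mean :: "((nat \<Rightarrow> complex) \<Rightarrow> 'b::real_normed_vector) \<Rightarrow> 'b" where
  "torus_mean h = Lim at_top (time_average h unit_character)"

lemma norm_of_nat_powr_ii: "n > 0 \<Longrightarrow> cmod (of_nat n powr (- (\<i> * of_real t))) = 1"
  by (simp add: powr_def norm_exp)

lemma torus_norm: "\<omega> \<in> torus_characters \<Longrightarrow> n > 0 \<Longrightarrow> cmod (\<omega> n) = 1"
  by (simp add: torus_characters_def)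

lemma torus_norm_le: "\<omega> \<in> torus_characters \<Longrightarrow> cmod (\<omega> n) \<le> 1"
  by (cases "n = 0") (auto simp add: torus_characters_def)

lemma torus_mult: "\<omega> \<in> torus_characters \<Longrightarrow> \<omega> (m * n) = \<omega> m * \<omega> n"
  by (simp add: torus_characters_def)

lemma torus_zero: "\<omega> \<in> torus_characters \<Longrightarrow> \<omega> 0 = 0"
  by (simp add: torus_characters_def)

lemma torus_cnj: "\<omega> \<in> torus_characters \<Longrightarrow> n > 0 \<Longrightarrow> \<omega> n * cnj (\<omega> n) = 1"
  using complex_norm_square[of "\<omega> n"] torus_norm[of \<omega> n] by simp

lemma unit_character_in_torus: "unit_character \<in> torus_characters"
  by (auto simp: torus_characters_def unit_character_def)

lemma of_nat_powr_mult: "of_nat (m * n) powr (z::complex) = of_nat m powr z * of_nat n powr z"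
  by (cases "m = 0 \<or> n = 0") (auto simp: powr_def Ln_times_of_nat exp_add algebra_simps Ln_of_nat ln_mult)

lemma flow_in_torus: "\<omega> \<in> torus_characters \<Longrightarrow> flow t \<omega> \<in> torus_characters"
  unfolding torus_characters_def flow_def
  by (auto simp: norm_mult norm_of_nat_powr_ii of_nat_powr_mult simp del: of_nat_mult)

lemma flow_flow: "\<omega> \<in> torus_characters \<Longrightarrow> flow t (flow u \<omega>) = flow (t + u) \<omega>"
  by (auto simp: flow_def fun_eq_iff torus_zero powr_add[symmetric] algebra_simps)

lemma compact_torus: "compact torus_characters"
proof -
  have "compact (UNIV \<rightarrow>\<^sub>E cball (0::complex) 1 :: (nat \<Rightarrow> complex) set)"
    using compactin_PiE[of "\<lambda>_. euclidean" UNIV "\<lambda>_. cball (0::complex) 1"]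
    by (simp add: euclidean_product_topology)
  moreover have "closed torus_characters"
  proof -
    have c: "continuous_on UNIV (\<lambda>\<omega>::nat \<Rightarrow> complex. \<omega> n)" for n
      by (rule continuous_on_product_coordinates)
    have "torus_characters = {\<omega>. \<omega> 0 = 0} \<inter> (\<Inter>n\<in>{0<..}. {\<omega>. cmod (\<omega> n) = 1})
        \<inter> (\<Inter>m. \<Inter>n. {\<omega>. \<omega> (m * n) = \<omega> m * \<omega> n})"
      by (auto simp: torus_characters_def)
    moreover have "closed \<dots>"
      by (intro closed_Int closed_INT ballI closed_Collect_eq continuous_intros c)
    ultimately show ?thesis by simp
  qed
  ultimately have "compact ((UNIV \<rightarrow>\<^sub>E cball (0::complex) 1) \<inter> torus_characters)"
    by (rule compact_Int_closed)
  moreover have "(UNIV \<rightarrow>\<^sub>E cball (0::complex) 1) \<inter> torus_characters = torus_characters"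
    by (auto simp: torus_norm_le)
  ultimately show ?thesis by simp
qed

lemma continuous_on_flow: "\<omega> \<in> torus_characters \<Longrightarrow> continuous_on A (\<lambda>t. flow t \<omega>)"
proof (rule continuous_on_coordinatewise_then_product)
  fix n assume "\<omega> \<in> torus_characters"
  then show "continuous_on A (\<lambda>t. flow t \<omega> n)"
    by (cases "n = 0") (auto simp: flow_def torus_zero powr_def intro!: continuous_intros)
qed

lemma continuous_on_along_flow:
  assumes "continuous_on torus_characters h" "\<omega> \<in> torus_characters"
  shows "continuous_on A (\<lambda>t. h (flow t \<omega>))"
  by (rule continuous_on_compose2[OF assms(1) continuous_on_flow[OF assms(2)]])
     (auto intro: flow_in_torus assms)

lemma integrable_along_flow:
  fixes h :: "(nat \<Rightarrow> complex) \<Rightarrow> 'b::banach"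
  assumes "continuous_on torus_characters h" "\<omega> \<in> torus_characters"
  shows "(\<lambda>t. h (flow t \<omega>)) integrable_on {a..b}"
  by (intro integrable_continuous_interval continuous_on_along_flow assms)

text \<open>A limit that is shared by all members of a family. The approximants of order \<open>k\<close> have one limit
\<open>m k\<close> for the whole family, and comparing the \<open>m k\<close> through a single member shows that they form a
Cauchy sequence. The quality of the approximation may depend on \<open>i\<close>; this freedom is essential
below, where the bounds on the means differ from one function to another.\<close>

lemma common_limit_by_approximation:
  fixes u :: "'i \<Rightarrow> 'x \<Rightarrow> 'b::banach"
  assumes F: "F \<noteq> bot"
    and lim: "\<And>i k. i \<in> I \<Longrightarrow> (v k i \<longlongrightarrow> m k) F"
    and approx: "\<And>i e. i \<in> I \<Longrightarrow> e > 0 \<Longrightarrow>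
      \<forall>\<^sub>F k in sequentially. \<forall>\<^sub>F x in F. norm (u i x - v k i x) \<le> e"
  shows "\<exists>l. \<forall>i\<in>I. (u i \<longlongrightarrow> l) F"
proof (cases "I = {}")
  case False
  then obtain i0 where i0: "i0 \<in> I" by auto
  have "Cauchy m"
  proof (rule CauchyI)
    fix e :: real assume e: "e > 0"
    then obtain K where K: "\<And>k. k \<ge> K \<Longrightarrow> \<forall>\<^sub>F x in F. norm (u i0 x - v k i0 x) \<le> e / 4"
      using approx[OF i0, of "e/4"] by (auto simp: eventually_sequentially)
    have "norm (m j - m k) < e" if "j \<ge> K" "k \<ge> K" for j k
    proof -
      have "norm (m j - m k) \<le> e / 2"
      proof (rule tendsto_upperbound[OF _ _ F])
        show "((\<lambda>x. norm (v j i0 x - v k i0 x)) \<longlongrightarrow> norm (m j - m k)) F"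
          by (intro tendsto_intros lim i0)
        show "\<forall>\<^sub>F x in F. norm (v j i0 x - v k i0 x) \<le> e / 2"
          using K[OF that(1)] K[OF that(2)]
        proof eventually_elim
          case (elim x)
          then show ?case
            using norm_triangle_ineq4[of "u i0 x - v k i0 x" "u i0 x - v j i0 x"] by simp
        qed
      qed
      then show ?thesis using e by linarith
    qed
    then show "\<exists>N. \<forall>j\<ge>N. \<forall>k\<ge>N. norm (m j - m k) < e" by blast
  qed
  then obtain l where l: "m \<longlonglongrightarrow> l" using Cauchy_convergent convergent_def by blast
  have "(u i \<longlongrightarrow> l) F" if i: "i \<in> I" for i
  proof (rule tendstoI)
    fix e :: real assume e: "e > 0"
    have "\<forall>\<^sub>F k in sequentially. dist (m k) l < e / 3"
      using l e by (intro tendstoD) auto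
    moreover have "\<forall>\<^sub>F k in sequentially. \<forall>\<^sub>F x in F. norm (u i x - v k i x) \<le> e / 4"
      using approx[OF i, of "e/4"] e by simp
    ultimately have "\<forall>\<^sub>F k in sequentially. dist (m k) l < e / 3 \<and> (\<forall>\<^sub>F x in F. norm (u i x - v k i x) \<le> e / 4)"
      by eventually_elim auto
    then obtain k where k: "dist (m k) l < e / 3" and close: "\<forall>\<^sub>F x in F. norm (u i x - v k i x) \<le> e / 4"
      using eventually_sequentially by auto
    have "\<forall>\<^sub>F x in F. dist (v k i x) (m k) < e / 3"
      using lim[OF i] e by (intro tendstoD) auto
    then show "\<forall>\<^sub>F x in F. dist (u i x) l < e"
      using close
    proof eventually_elim
      case (elim x)
      have "dist (u i x) l \<le> dist (u i x) (v k i x) + dist (v k i x) (m k) + dist (m k) l"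
        using dist_triangle[of "u i x" l "v k i x"] dist_triangle[of "v k i x" l "m k"] by linarith
      then show ?case using elim k e by (simp add: dist_norm)
    qed
  qed
  then show ?thesis by blast
qed auto

lemma mean_of_exponential:
  "((\<lambda>T. (1 / (2 * T)) *\<^sub>R integral {-T..T} (\<lambda>t. exp (\<i> * of_real a * of_real t)))
      \<longlongrightarrow> (if a = 0 then 1 else 0)) at_top"
proof (cases "a = 0")
  case True
  have "\<forall>\<^sub>F T::real in at_top. (1 / (2 * T)) *\<^sub>R integral {-T..T} (\<lambda>t. exp (\<i> * of_real a * of_real t)) = 1"
    using eventually_gt_at_top[of 0]
    by eventually_elim (simp add: True scaleR_conv_of_real)
  then show ?thesis using True by (simp add: tendsto_eventually)
next
  case False
  have bound: "norm ((1 / (2 * T)) *\<^sub>R integral {-T..T} (\<lambda>t. exp (\<i> * of_real a * of_real t)))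
      \<le> (1 / \<bar>a\<bar>) * inverse T" if T: "T > 0" for T
  proof -
    have "((\<lambda>t. exp (\<i> * of_real a * of_real t)) has_integral
        (exp (\<i> * of_real a * of_real T) / (\<i> * of_real a) - exp (\<i> * of_real a * of_real (-T)) / (\<i> * of_real a))) {-T..T}"
    proof (rule fundamental_theorem_of_calculus)
      fix x
      have "((\<lambda>z. exp (\<i> * of_real a * z) / (\<i> * of_real a)) has_field_derivative
          exp (\<i> * of_real a * of_real x)) (at (of_real x))"
        using False by (auto intro!: derivative_eq_intros)
      then show "((\<lambda>x. exp (\<i> * of_real a * of_real x) / (\<i> * of_real a)) has_vector_derivative
          exp (\<i> * of_real a * of_real x)) (at x within {-T..T})"
        by (rule has_vector_derivative_real_field)
    qed (use T in simp)
    then have "norm (integral {-T..T} (\<lambda>t. exp (\<i> * of_real a * of_real t))) =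
        norm (exp (\<i> * of_real a * of_real T) / (\<i> * of_real a) - exp (\<i> * of_real a * of_real (-T)) / (\<i> * of_real a))"
      by (simp add: integral_unique)
    also have "\<dots> \<le> norm (exp (\<i> * of_real a * of_real T) / (\<i> * of_real a)) + norm (exp (\<i> * of_real a * of_real (-T)) / (\<i> * of_real a))"
      by (rule norm_triangle_ineq4)
    also have "\<dots> = 2 / \<bar>a\<bar>"
      by (simp add: norm_divide norm_mult norm_exp)
    finally show ?thesis
      using T by (simp add: field_simps)
  qed
  have "((\<lambda>T. (1 / (2 * T)) *\<^sub>R integral {-T..T} (\<lambda>t. exp (\<i> * of_real a * of_real t))) \<longlongrightarrow> 0) at_top"
  proof (rule Lim_null_comparison)
    show "\<forall>\<^sub>F T in at_top. norm ((1 / (2 * T)) *\<^sub>R integral {-T..T} (\<lambda>t. exp (\<i> * of_real a * of_real t)))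
      \<le> (1 / \<bar>a\<bar>) * inverse T"
      using eventually_gt_at_top[of 0] by eventually_elim (rule bound)
    show "((\<lambda>T. (1 / \<bar>a\<bar>) * inverse T) \<longlongrightarrow> 0) at_top"
      by (intro tendsto_mult_right_zero tendsto_inverse_0_at_top filterlim_ident)
  qed
  then show ?thesis using False by simp
qed

text \<open>The products \<open>\<omega> k * cnj (\<omega> l)\<close> are closed under multiplication on the torus because characters are
multiplicative, so their span is an algebra to which Stone-Weierstrass applies.\<close>

inductive trig_poly :: "((nat \<Rightarrow> complex) \<Rightarrow> complex) \<Rightarrow> bool" where
  monomial: "k > 0 \<Longrightarrow> l > 0 \<Longrightarrow> trig_poly (\<lambda>\<omega>. c * (\<omega> k * cnj (\<omega> l)))"
| add: "trig_poly f \<Longrightarrow> trig_poly g \<Longrightarrow> trig_poly (\<lambda>\<omega>. f \<omega> + g \<omega>)"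

lemma trig_poly_cnj: "trig_poly f \<Longrightarrow> trig_poly (\<lambda>\<omega>. cnj (f \<omega>))"
proof (induction rule: trig_poly.induct)
  case (monomial k l c)
  have "(\<lambda>\<omega>. cnj (c * (\<omega> k * cnj (\<omega> l)))) = (\<lambda>\<omega>. cnj c * (\<omega> l * cnj (\<omega> k)))"
    by (auto simp: fun_eq_iff)
  then show ?case using monomial trig_poly.monomial by metis
qed (simp add: trig_poly.add)

lemma trig_poly_scale: "trig_poly f \<Longrightarrow> trig_poly (\<lambda>\<omega>. a * f \<omega>)"
proof (induction rule: trig_poly.induct)
  case (monomial k l c)
  then show ?case using trig_poly.monomial[of k l "a * c"] by (simp add: mult.assoc)
qed (simp add: trig_poly.add distrib_left)

lemma trig_poly_mult:
  assumes "trig_poly f" "trig_poly g"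
  shows "\<exists>h. trig_poly h \<and> (\<forall>\<omega>\<in>torus_characters. h \<omega> = f \<omega> * g \<omega>)"
  using assms(1)
proof (induction rule: trig_poly.induct)
  case (monomial k l c)
  show ?case using assms(2)
  proof (induction rule: trig_poly.induct)
    case (monomial k' l' c')
    show ?case
    proof (intro exI conjI ballI)
      show "trig_poly (\<lambda>\<omega>. (c * c') * (\<omega> (k * k') * cnj (\<omega> (l * l'))))"
        using monomial \<open>k > 0\<close> \<open>l > 0\<close> by (intro trig_poly.monomial) auto
    qed (auto simp: torus_mult)
  next
    case (add f g)
    then obtain h1 h2 where "trig_poly h1" "trig_poly h2"
      "\<forall>\<omega>\<in>torus_characters. h1 \<omega> = (c * (\<omega> k * cnj (\<omega> l))) * f \<omega>"
      "\<forall>\<omega>\<in>torus_characters. h2 \<omega> = (c * (\<omega> k * cnj (\<omega> l))) * g \<omega>" by auto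
    then show ?case
      by (intro exI[of _ "\<lambda>\<omega>. h1 \<omega> + h2 \<omega>"]) (auto intro: trig_poly.add simp: distrib_left)
  qed
next
  case (add f1 f2)
  then obtain h1 h2 where "trig_poly h1" "trig_poly h2"
    "\<forall>\<omega>\<in>torus_characters. h1 \<omega> = f1 \<omega> * g \<omega>"
    "\<forall>\<omega>\<in>torus_characters. h2 \<omega> = f2 \<omega> * g \<omega>" by auto
  then show ?case
    by (intro exI[of _ "\<lambda>\<omega>. h1 \<omega> + h2 \<omega>"]) (auto intro: trig_poly.add simp: distrib_right)
qed

lemma continuous_trig_poly: "trig_poly f \<Longrightarrow> continuous_on A f"
  by (induction rule: trig_poly.induct) 
    (auto intro!: continuous_intros continuous_on_subset[OF continuous_on_product_coordinates])

lemma time_average_add: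
  fixes f g :: "(nat \<Rightarrow> complex) \<Rightarrow> 'b::banach"
  assumes "continuous_on torus_characters f" "continuous_on torus_characters g" "\<omega> \<in> torus_characters"
  shows "time_average (\<lambda>\<omega>. f \<omega> + g \<omega>) \<omega> T = time_average f \<omega> T + time_average g \<omega> T"
  unfolding time_average_def
  using integral_add[OF integrable_along_flow[OF assms(1,3)] integrable_along_flow[OF assms(2,3)], of "-T" T]
  by (simp add: scaleR_add_right)

lemma time_average_diff:
  fixes f g :: "(nat \<Rightarrow> complex) \<Rightarrow> 'b::banach"
  assumes "continuous_on torus_characters f" "continuous_on torus_characters g" "\<omega> \<in> torus_characters"
  shows "time_average (\<lambda>\<omega>. f \<omega> - g \<omega>) \<omega> T = time_average f \<omega> T - time_average g \<omega> T"
  unfolding time_average_def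
  using integral_diff[OF integrable_along_flow[OF assms(1,3)] integrable_along_flow[OF assms(2,3)], of "-T" T]
  by (simp add: scaleR_diff_right)

lemma time_average_linear:
  fixes f :: "(nat \<Rightarrow> complex) \<Rightarrow> 'b::banach" and L :: "'b \<Rightarrow> 'c::banach"
  assumes "continuous_on torus_characters f" "\<omega> \<in> torus_characters" "bounded_linear L"
  shows "time_average (\<lambda>\<omega>. L (f \<omega>)) \<omega> T = L (time_average f \<omega> T)"
  using integral_linear[OF integrable_along_flow[OF assms(1,2)] assms(3), of "-T" T]
  by (simp add: time_average_def o_def linear_cmul bounded_linear.linear[OF assms(3)])

lemma time_average_norm_le:
  fixes f :: "(nat \<Rightarrow> complex) \<Rightarrow> 'b::banach"
  assumes "continuous_on torus_characters f" "continuous_on torus_characters g" "\<omega> \<in> torus_characters" "T > 0"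
    and "\<And>\<omega>. \<omega> \<in> torus_characters \<Longrightarrow> norm (f \<omega>) \<le> g \<omega>"
  shows "norm (time_average f \<omega> T) \<le> time_average g \<omega> T"
proof -
  have "norm (integral {-T..T} (\<lambda>t. f (flow t \<omega>))) \<le> integral {-T..T} (\<lambda>t. g (flow t \<omega>))"
    by (intro integral_norm_bound_integral integrable_along_flow assms flow_in_torus)
  then show ?thesis using \<open>T > 0\<close> by (simp add: time_average_def divide_right_mono)
qed

lemma time_average_const:
  fixes c :: "'b::banach"
  shows "T > 0 \<Longrightarrow> time_average (\<lambda>_. c) \<omega> T = c"
  by (simp add: time_average_def)

text \<open>Along the flow the monomial is an exponential of frequency \<open>ln l - ln k\<close>. For \<open>k \<noteq> l\<close> it averages to
zero, and for \<open>k = l\<close> unimodularity removes the starting character. This is the reason why means do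
not depend on the starting point.\<close>

lemma monomial_mean:
  assumes kl: "k > 0" "l > 0" and \<omega>: "\<omega> \<in> torus_characters"
  shows "(time_average (\<lambda>\<omega>. c * (\<omega> k * cnj (\<omega> l))) \<omega> \<longlongrightarrow> (if k = l then c else 0)) at_top"
proof -
  let ?a = "ln (real l) - ln (real k)"
  have eq: "(\<lambda>t. c * (flow t \<omega> k * cnj (flow t \<omega> l)))
      = (\<lambda>t. (c * (\<omega> k * cnj (\<omega> l))) * exp (\<i> * of_real ?a * of_real t))"
    using kl
    by (auto simp: fun_eq_iff flow_def powr_def Ln_of_nat exp_cnj exp_add[symmetric] exp_diff algebra_simps exp_minus divide_simps)
  have "((\<lambda>T. (c * (\<omega> k * cnj (\<omega> l))) * ((1 / (2 * T)) *\<^sub>R integral {-T..T} (\<lambda>t. exp (\<i> * of_real ?a * of_real t))))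
      \<longlongrightarrow> (c * (\<omega> k * cnj (\<omega> l))) * (if ?a = 0 then 1 else 0)) at_top"
    by (intro tendsto_intros mean_of_exponential)
  moreover have "(c * (\<omega> k * cnj (\<omega> l))) * (if ?a = 0 then 1 else 0) = (if k = l then c else 0)"
    using kl torus_cnj[OF \<omega>] by auto
  ultimately show ?thesis
    unfolding time_average_def eq by (simp add: scaleR_conv_of_real mult_ac)
qed

lemma trig_poly_mean:
  assumes "trig_poly f"
  shows "\<exists>m. \<forall>\<omega>\<in>torus_characters. (time_average f \<omega> \<longlongrightarrow> m) at_top"
  using assms
proof (induction rule: trig_poly.induct)
  case (monomial k l c)
  then show ?case using monomial_mean by blast
next
  case (add f g)
  then obtain m1 m2 where "\<forall>\<omega>\<in>torus_characters. (time_average f \<omega> \<longlongrightarrow> m1) at_top"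
     "\<forall>\<omega>\<in>torus_characters. (time_average g \<omega> \<longlongrightarrow> m2) at_top" by blast
  moreover have "time_average (\<lambda>\<omega>. f \<omega> + g \<omega>) \<omega> = (\<lambda>T. time_average f \<omega> T + time_average g \<omega> T)"
    if "\<omega> \<in> torus_characters" for \<omega>
    using time_average_add[OF continuous_trig_poly[OF add(1)] continuous_trig_poly[OF add(2)] that] by auto
  ultimately show ?case by (intro exI[of _ "m1 + m2"]) (auto intro: tendsto_add)
qed

text \<open>By Stone-Weierstrass a continuous function is a uniform limit of real parts of trigonometric
polynomials, whose means exist and do not depend on the starting point.\<close>

lemma real_mean_exists:
  fixes h :: "(nat \<Rightarrow> complex) \<Rightarrow> real"
  assumes h: "continuous_on torus_characters h"
  shows "\<exists>m. \<forall>\<omega>\<in>torus_characters. (time_average h \<omega> \<longlongrightarrow> m) at_top"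
proof -
  define R where "R = {h. \<exists>f. trig_poly f \<and> (\<forall>\<omega>\<in>torus_characters. h \<omega> = Re (f \<omega>))}"
  interpret function_ring_on R torus_characters
  proof
    show "compact torus_characters" by (rule compact_torus)
    show "continuous_on torus_characters f" if f: "f \<in> R" for f
    proof -
      obtain g where g: "trig_poly g" "\<forall>\<omega>\<in>torus_characters. f \<omega> = Re (g \<omega>)" using f by (auto simp: R_def)
      have "continuous_on torus_characters (\<lambda>\<omega>. Re (g \<omega>))"
        using g by (intro continuous_intros continuous_trig_poly)
      then show ?thesis using g by (simp cong: continuous_on_cong)
    qed
    show "(\<lambda>x. f x + g x) \<in> R" if fg: "f \<in> R" "g \<in> R" for f g
    proof -
      obtain f' g' where "trig_poly f'" "\<forall>\<omega>\<in>torus_characters. f \<omega> = Re (f' \<omega>)"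
        and "trig_poly g'" "\<forall>\<omega>\<in>torus_characters. g \<omega> = Re (g' \<omega>)"
        using fg unfolding R_def by blast
      then show ?thesis
        by (auto simp: R_def intro!: trig_poly.add exI[of _ "\<lambda>\<omega>. f' \<omega> + g' \<omega>"])
    qed
    show "(\<lambda>x. f x * g x) \<in> R" if fg: "f \<in> R" "g \<in> R" for f g
    proof -
      obtain f' g' where f': "trig_poly f'" "\<forall>\<omega>\<in>torus_characters. f \<omega> = Re (f' \<omega>)"
        and g': "trig_poly g'" "\<forall>\<omega>\<in>torus_characters. g \<omega> = Re (g' \<omega>)"
        using fg by (auto simp: R_def)
      have g'': "trig_poly (\<lambda>\<omega>. 1/2 * (g' \<omega> + cnj (g' \<omega>)))"
        by (intro trig_poly_scale trig_poly.add trig_poly_cnj g')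
      obtain k where k: "trig_poly k" "\<forall>\<omega>\<in>torus_characters. k \<omega> = f' \<omega> * (1/2 * (g' \<omega> + cnj (g' \<omega>)))"
        using trig_poly_mult[OF f'(1) g''] by auto
      then show ?thesis using f' g'
        by (auto simp: R_def complex_add_cnj intro!: exI[of _ k])
    qed
    show "(\<lambda>_. c) \<in> R" for c
      using trig_poly.monomial[of 1 1 "of_real c"]
      by (auto simp: R_def torus_cnj intro!: exI[of _ "\<lambda>\<omega>. of_real c * (\<omega> 1 * cnj (\<omega> 1))"])
    show "\<exists>f\<in>R. f x \<noteq> f y" if xy: "x \<in> torus_characters" "y \<in> torus_characters" "x \<noteq> y" for x y
    proof -
      obtain n where n: "x n \<noteq> y n" using xy by auto
      then have n0: "n > 0" using torus_zero[OF xy(1)] torus_zero[OF xy(2)] by (cases n) auto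
      have *: "(\<lambda>\<omega>. Re (c * (\<omega> n * cnj (\<omega> 1)))) \<in> R" for c
        using trig_poly.monomial[of n 1 c] n0 by (auto simp: R_def)
      have one: "z 1 = 1" if "z \<in> torus_characters" for z
        using torus_mult[OF that, of 1 1] torus_norm[OF that, of 1] by auto
      have "Re (x n) \<noteq> Re (y n) \<or> Im (x n) \<noteq> Im (y n)" using n by (auto simp: complex_eq_iff)
      then show ?thesis
      proof
        assume "Re (x n) \<noteq> Re (y n)"
        then show ?thesis
          using one[OF xy(1)] one[OF xy(2)] by (intro bexI[OF _ *[of 1]]) simp
      next
        assume "Im (x n) \<noteq> Im (y n)"
        then show ?thesis
          using one[OF xy(1)] one[OF xy(2)] by (intro bexI[OF _ *[of "- \<i>"]]) simp
      qed
    qed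
  qed
  have "\<exists>g m. continuous_on torus_characters g \<and> (\<forall>x\<in>torus_characters. \<bar>h x - g x\<bar> < e)
      \<and> (\<forall>\<omega>\<in>torus_characters. (time_average g \<omega> \<longlongrightarrow> m) at_top)" if e: "e > 0" for e
  proof -
    obtain g where g: "g \<in> R" "\<forall>x\<in>torus_characters. \<bar>h x - g x\<bar> < e"
      using Stone_Weierstrass_basic[OF h e] by blast
    obtain f where f: "trig_poly f" "\<forall>\<omega>\<in>torus_characters. g \<omega> = Re (f \<omega>)" using g by (auto simp: R_def)
    obtain m where m: "\<forall>\<omega>\<in>torus_characters. (time_average f \<omega> \<longlongrightarrow> m) at_top"
      using trig_poly_mean[OF f(1)] by blast
    have "(time_average g \<omega> \<longlongrightarrow> Re m) at_top" if "\<omega> \<in> torus_characters" for \<omega>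
    proof -
      have "time_average g \<omega> T = Re (time_average f \<omega> T)" for T
        using time_average_linear[OF continuous_trig_poly[OF f(1)] that bounded_linear_Re] f flow_in_torus[OF that]
        by (simp add: time_average_def)
      moreover have "((\<lambda>T. Re (time_average f \<omega> T)) \<longlongrightarrow> Re m) at_top"
        using m that by (intro tendsto_intros) auto
      ultimately show ?thesis by presburger
    qed
    then show ?thesis using g continuous by blast
  qed
  then have "\<forall>k. \<exists>g m. continuous_on torus_characters g
      \<and> (\<forall>x\<in>torus_characters. \<bar>h x - g x\<bar> < inverse (real (Suc k)))
      \<and> (\<forall>\<omega>\<in>torus_characters. (time_average g \<omega> \<longlongrightarrow> m) at_top)" by simp
  then obtain g m where g: "\<And>k. continuous_on torus_characters (g k)"
      "\<And>k x. x \<in> torus_characters \<Longrightarrow> \<bar>h x - g k x\<bar> < inverse (real (Suc k))"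
      "\<And>k \<omega>. \<omega> \<in> torus_characters \<Longrightarrow> (time_average (g k) \<omega> \<longlongrightarrow> m k) at_top"
    by metis
  show ?thesis
  proof (rule common_limit_by_approximation[where v = "\<lambda>k. time_average (g k)" and m = m])
    fix \<omega> and e :: real assume \<omega>: "\<omega> \<in> torus_characters" and e: "e > 0"
    have "\<forall>\<^sub>F k in sequentially. inverse (real (Suc k)) < e"
      using e LIMSEQ_inverse_real_of_nat[THEN order_tendstoD(2), of e] by simp
    then show "\<forall>\<^sub>F k in sequentially. \<forall>\<^sub>F T in at_top. norm (time_average h \<omega> T - time_average (g k) \<omega> T) \<le> e"
    proof eventually_elim
      case (elim k)
      show ?case using eventually_gt_at_top[of 0]
      proof eventually_elim
        case T: (elim T)
        have "norm (time_average (\<lambda>\<omega>. h \<omega> - g k \<omega>) \<omega> T) \<le> time_average (\<lambda>_. inverse (real (Suc k))) \<omega> T"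
          by (intro time_average_norm_le continuous_intros h g(1) \<omega> T) (use g(2) in \<open>auto simp: less_imp_le\<close>)
        then show ?case
          using T elim time_average_diff[OF h g(1) \<omega>] by (simp add: time_average_const)
      qed
    qed
  qed (use g in auto)
qed

text \<open>Unique ergodicity of the flow, the form of Weyl's equidistribution theorem on which the whole proof
rests.\<close>

theorem time_average_tendsto:
  fixes h :: "(nat \<Rightarrow> complex) \<Rightarrow> 'b::euclidean_space"
  assumes h: "continuous_on torus_characters h" and \<omega>: "\<omega> \<in> torus_characters"
  shows "(time_average h \<omega> \<longlongrightarrow> torus_mean h) at_top"
proof -
  have "\<exists>m. \<forall>\<omega>\<in>torus_characters. (time_average (\<lambda>\<omega>. h \<omega> \<bullet> b) \<omega> \<longlongrightarrow> m) at_top" for b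
    by (intro real_mean_exists continuous_intros h)
  then obtain m where m: "\<And>b \<omega>. \<omega> \<in> torus_characters \<Longrightarrow> (time_average (\<lambda>\<omega>. h \<omega> \<bullet> b) \<omega> \<longlongrightarrow> m b) at_top"
    by metis
  define l where "l = (\<Sum>b\<in>Basis. m b *\<^sub>R b)"
  have lim: "(time_average h \<omega> \<longlongrightarrow> l) at_top" if "\<omega> \<in> torus_characters" for \<omega>
  proof -
    have "((\<lambda>T. time_average h \<omega> T \<bullet> b) \<longlongrightarrow> l \<bullet> b) at_top" if "b \<in> Basis" for b
      using m[OF \<open>\<omega> \<in> _\<close>, of b] that
      by (simp add: ext[OF time_average_linear[OF h \<open>\<omega> \<in> _\<close> bounded_linear_inner_left[of b]]])
        (simp add: l_def inner_sum_left inner_Basis if_distrib cong: if_cong)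
    then show ?thesis by (subst tendsto_componentwise_iff) auto
  qed
  then have "torus_mean h = l"
    unfolding torus_mean_def by (intro tendsto_Lim lim unit_character_in_torus) simp
  then show ?thesis using lim \<omega> by simp
qed

lemma torus_mean_eqI:
  fixes h :: "(nat \<Rightarrow> complex) \<Rightarrow> 'b::euclidean_space"
  assumes "(time_average h unit_character \<longlongrightarrow> m) at_top"
  shows "torus_mean h = m"
  using assms unfolding torus_mean_def by (intro tendsto_Lim) simp_all

lemma torus_mean_add:
  fixes f g :: "(nat \<Rightarrow> complex) \<Rightarrow> 'b::euclidean_space"
  assumes "continuous_on torus_characters f" "continuous_on torus_characters g"
  shows "torus_mean (\<lambda>\<omega>. f \<omega> + g \<omega>) = torus_mean f + torus_mean g"
  using tendsto_add[OF assms[THEN time_average_tendsto, OF unit_character_in_torus]]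
  by (intro torus_mean_eqI) (simp add: ext[OF time_average_add[OF assms unit_character_in_torus]])

lemma torus_mean_linear:
  fixes f :: "(nat \<Rightarrow> complex) \<Rightarrow> 'b::euclidean_space" and L :: "'b \<Rightarrow> 'c::euclidean_space"
  assumes "continuous_on torus_characters f" "bounded_linear L"
  shows "torus_mean (\<lambda>\<omega>. L (f \<omega>)) = L (torus_mean f)"
  using bounded_linear.tendsto[OF assms(2) time_average_tendsto[OF assms(1) unit_character_in_torus]]
  by (intro torus_mean_eqI) (simp add: ext[OF time_average_linear[OF assms(1) unit_character_in_torus assms(2)]])

lemma torus_mean_diff:
  fixes f g :: "(nat \<Rightarrow> complex) \<Rightarrow> 'b::euclidean_space"
  assumes "continuous_on torus_characters f" "continuous_on torus_characters g"
  shows "torus_mean (\<lambda>\<omega>. f \<omega> - g \<omega>) = torus_mean f - torus_mean g"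
  using tendsto_diff[OF assms[THEN time_average_tendsto, OF unit_character_in_torus]]
  by (intro torus_mean_eqI) (simp add: ext[OF time_average_diff[OF assms unit_character_in_torus]])

lemma torus_mean_const:
  fixes c :: "'b::euclidean_space"
  shows "torus_mean (\<lambda>_. c) = c"
  by (intro torus_mean_eqI tendsto_eventually eventually_mono[OF eventually_gt_at_top[of 0]] time_average_const)

lemma torus_mean_sum:
  fixes f :: "'i \<Rightarrow> (nat \<Rightarrow> complex) \<Rightarrow> 'b::euclidean_space"
  assumes "\<And>i. i \<in> I \<Longrightarrow> continuous_on torus_characters (f i)"
  shows "torus_mean (\<lambda>\<omega>. \<Sum>i\<in>I. f i \<omega>) = (\<Sum>i\<in>I. torus_mean (f i))"
  using assms
proof (induction I rule: infinite_finite_induct)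
  case (insert x A)
  then show ?case by (simp add: torus_mean_add continuous_on_sum)
qed (simp_all add: torus_mean_const)

lemma torus_mean_norm_le:
  fixes f :: "(nat \<Rightarrow> complex) \<Rightarrow> 'b::euclidean_space"
  assumes fg: "continuous_on torus_characters f" "continuous_on torus_characters g"
    and le: "\<And>\<omega>. \<omega> \<in> torus_characters \<Longrightarrow> norm (f \<omega>) \<le> g \<omega>"
  shows "norm (torus_mean f) \<le> torus_mean g"
proof (rule tendsto_le)
  show "((\<lambda>T. norm (time_average f unit_character T)) \<longlongrightarrow> norm (torus_mean f)) at_top"
    by (intro tendsto_intros time_average_tendsto fg unit_character_in_torus)
  show "(time_average g unit_character \<longlongrightarrow> torus_mean g) at_top"
    by (intro time_average_tendsto fg unit_character_in_torus)
  show "\<forall>\<^sub>F T in at_top. norm (time_average f unit_character T) \<le> time_average g unit_character T"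
    using eventually_gt_at_top[of 0]
    by eventually_elim (intro time_average_norm_le fg unit_character_in_torus le)
qed simp

lemma torus_mean_mono:
  fixes f g :: "(nat \<Rightarrow> complex) \<Rightarrow> real"
  assumes fg: "continuous_on torus_characters f" "continuous_on torus_characters g"
    and le: "\<And>\<omega>. \<omega> \<in> torus_characters \<Longrightarrow> f \<omega> \<le> g \<omega>"
  shows "torus_mean f \<le> torus_mean g"
proof -
  have "norm (0::real) \<le> torus_mean (\<lambda>\<omega>. g \<omega> - f \<omega>)"
    using torus_mean_norm_le[of "\<lambda>_. 0::real" "\<lambda>\<omega>. g \<omega> - f \<omega>"] fg le
    by (simp add: torus_mean_const continuous_on_diff)
  then show ?thesis using fg by (simp add: torus_mean_diff)
qed

text \<open>A shift in time only changes the starting point of the orbit.\<close>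

lemma torus_mean_flow:
  fixes h :: "(nat \<Rightarrow> complex) \<Rightarrow> 'b::euclidean_space"
  assumes h: "continuous_on torus_characters h"
  shows "torus_mean (\<lambda>\<omega>. h (flow t \<omega>)) = torus_mean h"
proof (rule torus_mean_eqI)
  have "time_average (\<lambda>\<omega>. h (flow t \<omega>)) unit_character = time_average h (flow t unit_character)"
    by (simp add: time_average_def fun_eq_iff flow_flow unit_character_in_torus add.commute)
  then show "(time_average (\<lambda>\<omega>. h (flow t \<omega>)) unit_character \<longlongrightarrow> torus_mean h) at_top"
    using time_average_tendsto[OF h flow_in_torus[OF unit_character_in_torus]] by metis
qed

lemma torus_mean_cong:
  assumes "\<And>\<omega>. \<omega> \<in> torus_characters \<Longrightarrow> f \<omega> = g \<omega>"
  shows "torus_mean f = torus_mean g"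
proof -
  have "time_average f unit_character = time_average g unit_character"
    by (simp add: time_average_def fun_eq_iff assms flow_in_torus unit_character_in_torus)
  then show ?thesis by (simp add: torus_mean_def)
qed

lemma continuous_on_coordinate [continuous_intros]: "continuous_on A (\<lambda>\<omega>::nat \<Rightarrow> complex. \<omega> n)"
  by (rule continuous_on_subset[OF continuous_on_product_coordinates]) simp

lemma torus_mean_monomial:
  assumes "k > 0" "l > 0"
  shows "torus_mean (\<lambda>\<omega>. c * (\<omega> k * cnj (\<omega> l))) = (if k = l then c else 0)"
  by (intro torus_mean_eqI monomial_mean assms unit_character_in_torus)

section \<open>Dirichlet polynomials and means over the torus\<close>

definition twisted_poly :: "(nat \<Rightarrow> complex) \<Rightarrow> (nat \<Rightarrow> complex) \<Rightarrow> complex \<Rightarrow> complex" where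
  "twisted_poly P \<omega> s = (\<Sum>n | P n \<noteq> 0. P n * \<omega> n * of_nat n powr (- s))"

lemma dirichlet_polynomial_finite: "dirichlet_polynomial P \<Longrightarrow> finite {n. P n \<noteq> 0}"
  by (simp add: dirichlet_polynomial_def)

lemma dirichlet_polynomial_pos: "dirichlet_polynomial P \<Longrightarrow> P n \<noteq> 0 \<Longrightarrow> n > 0"
  by (cases n) (auto simp: dirichlet_polynomial_def)

lemma twisted_poly_superset:
  assumes "finite A" "{n. P n \<noteq> 0} \<subseteq> A"
  shows "twisted_poly P \<omega> s = (\<Sum>n\<in>A. P n * \<omega> n * of_nat n powr (- s))"
  unfolding twisted_poly_def by (rule sum.mono_neutral_left) (use assms in auto)

lemma twisted_poly_diff:
  assumes "dirichlet_polynomial P" "dirichlet_polynomial Q"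
  shows "twisted_poly (\<lambda>n. P n - Q n) \<omega> s = twisted_poly P \<omega> s - twisted_poly Q \<omega> s"
proof -
  let ?A = "{n. P n \<noteq> 0} \<union> {n. Q n \<noteq> 0}"
  have "finite ?A" using assms by (simp add: dirichlet_polynomial_finite)
  then show ?thesis
    by (subst (1 2 3) twisted_poly_superset[of ?A]) (auto simp: sum_subtractf algebra_simps)
qed

lemma dirichlet_polynomial_diff:
  assumes "dirichlet_polynomial P" "dirichlet_polynomial Q"
  shows "dirichlet_polynomial (\<lambda>n. P n - Q n)"
proof -
  have "finite ({n. P n \<noteq> 0} \<union> {n. Q n \<noteq> 0})" using assms by (simp add: dirichlet_polynomial_def)
  then have "finite {n. P n - Q n \<noteq> 0}" by (rule rev_finite_subset) auto
  then show ?thesis using assms by (simp add: dirichlet_polynomial_def)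
qed

lemma continuous_on_twisted_poly [continuous_intros]:
  assumes "dirichlet_polynomial P" "continuous_on A f" "continuous_on A g"
  shows "continuous_on A (\<lambda>x. twisted_poly P (f x) (g x))"
  unfolding twisted_poly_def powr_def
proof (intro continuous_intros continuous_on_product_then_coordinatewise[OF assms(2)])
  fix n assume "n \<in> {n. P n \<noteq> 0}"
  then have "n > 0" using dirichlet_polynomial_pos[OF assms(1)] by auto
  then show "continuous_on A (\<lambda>x. if of_nat n = (0::complex) then 0 else exp (- g x * Ln (of_nat n)))"
    by (auto intro!: continuous_intros assms)
qed

lemma holomorphic_twisted_poly [holomorphic_intros]:
  assumes "dirichlet_polynomial P" "g holomorphic_on A"
  shows "(\<lambda>x. twisted_poly P \<omega> (g x)) holomorphic_on A"
  unfolding twisted_poly_def powr_def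
proof (intro holomorphic_intros)
  fix n assume "n \<in> {n. P n \<noteq> 0}"
  then have "n > 0" using dirichlet_polynomial_pos[OF assms(1)] by auto
  then show "(\<lambda>x. if of_nat n = (0::complex) then 0 else exp (- g x * Ln (of_nat n))) holomorphic_on A"
    by (auto intro!: holomorphic_intros assms)
qed

lemma twisted_poly_flow:
  assumes "\<omega> \<in> torus_characters"
  shows "twisted_poly P (flow t \<omega>) s = twisted_poly P \<omega> (s + \<i> * of_real t)"
  unfolding twisted_poly_def
proof (rule sum.cong)
  fix n
  show "P n * flow t \<omega> n * of_nat n powr - s = P n * \<omega> n * of_nat n powr - (s + \<i> * of_real t)"
    by (cases "n = 0") (simp_all add: flow_def powr_add[symmetric] add.commute)
qed simp

lemma norm_of_nat_powr_le: 
  assumes "n > 0" "Re s \<ge> 0" shows "cmod (of_nat n powr (- s)) \<le> 1"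
  using assms powr_mono[of "- Re s" 0 "real n"] by (simp add: norm_powr_real_powr)

lemma twisted_poly_norm_le:
  assumes "dirichlet_polynomial P" "\<omega> \<in> torus_characters" "Re s \<ge> 0"
  shows "cmod (twisted_poly P \<omega> s) \<le> (\<Sum>n | P n \<noteq> 0. cmod (P n))"
  unfolding twisted_poly_def
proof (rule sum_norm_le)
  fix n assume "n \<in> {n. P n \<noteq> 0}"
  then have n: "n > 0" using dirichlet_polynomial_pos[OF assms(1)] by auto
  show "cmod (P n * \<omega> n * of_nat n powr - s) \<le> cmod (P n)"
    using norm_of_nat_powr_le[OF n assms(3)] torus_norm[OF assms(2) n]
    by (simp add: norm_mult mult_left_le)
qed

text \<open>Phragmen-Lindelof: for \<open>d > 0\<close> the factor \<open>1 / (1 + d z)\<close> has modulus at most one on the half-plane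
and makes the bounded function small on large half circles, so that the maximum over a large half
disc is governed by the imaginary axis. Then \<open>d\<close> tends to zero.\<close>

lemma half_plane_maximum_principle:
  assumes hol: "H holomorphic_on UNIV"
    and bdd: "\<And>z. Re z \<ge> 0 \<Longrightarrow> cmod (H z) \<le> M" and edge: "\<And>z. Re z = 0 \<Longrightarrow> cmod (H z) \<le> N"
    and z0: "Re z0 \<ge> 0"
  shows "cmod (H z0) \<le> N"
proof (cases "Re z0 = 0")
  case False
  have N0: "N \<ge> 0" using edge[of 0] by (simp add: order_trans[OF norm_ge_zero])
  have M0: "M \<ge> 0" using bdd[of 0] by (simp add: order_trans[OF norm_ge_zero])
  have cH: "continuous_on X H" for X
    using holomorphic_on_imp_continuous_on[OF hol] continuous_on_subset by blast
  have bound: "cmod (H z0) \<le> (N + d) * (1 + d * cmod z0)" if d: "d > 0" for d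
  proof -
    define Y where "Y = max (cmod z0 + 1) ((M / (N + d) + 1) / d)"
    define S where "S = {z. Re z > 0} \<inter> ball 0 Y"
    have big: "d * Y \<ge> M / (N + d) + 1"
      using d by (simp add: Y_def field_simps max_def)
    have denom: "cmod (1 + of_real d * z) \<ge> 1" if "Re z \<ge> 0" for z
      using complex_Re_le_cmod[of "1 + of_real d * z"] that d by (simp add: mult_nonneg_nonneg order_trans[rotated])
    have S: "closure S \<subseteq> {z. Re z \<ge> 0} \<inter> cball 0 Y"
      by (rule closure_minimal) (auto simp: S_def intro!: closed_Int closed_halfspace_Re_ge)
    have oS: "open S" unfolding S_def by (intro open_Int open_halfspace_Re_gt) auto
    have nz: "1 + of_real d * z \<noteq> 0" if "Re z \<ge> 0" for z
      using denom[OF that] by auto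
    have "cmod (H z0 / (1 + of_real d * z0)) \<le> N + d"
    proof (rule maximum_modulus_frontier[where f = "\<lambda>z. H z / (1 + of_real d * z)"])
      show "(\<lambda>z. H z / (1 + of_real d * z)) holomorphic_on interior S"
        unfolding interior_open[OF oS]
        by (intro holomorphic_intros holomorphic_on_subset[OF hol] nz) (auto simp: S_def)
      show "continuous_on (closure S) (\<lambda>z. H z / (1 + of_real d * z))"
        using S nz by (intro continuous_intros cH) blast
      show "bounded S" unfolding S_def by (metis Int_lower2 bounded_ball bounded_subset)
      show "z0 \<in> S" using False z0 by (auto simp: S_def Y_def)
      fix z assume "z \<in> frontier S"
      then have "z \<in> closure S" "z \<notin> S" using oS by (auto simp: frontier_def interior_open)
      then have z: "Re z \<ge> 0" "cmod z \<le> Y" "Re z = 0 \<or> cmod z = Y" using S by (auto simp: S_def)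
      show "cmod (H z / (1 + of_real d * z)) \<le> N + d"
        using z(3)
      proof
        assume "Re z = 0"
        then have "cmod (H z) \<le> N * 1" using edge by auto
        also have "\<dots> \<le> (N + d) * cmod (1 + of_real d * z)"
          using denom[OF z(1)] N0 d by (intro mult_mono) auto
        finally show ?thesis using denom[OF z(1)] N0 d by (simp add: norm_divide divide_le_eq)
      next
        assume Y: "cmod z = Y"
        have "d * Y - 1 \<le> cmod (1 + of_real d * z)"
          using norm_diff_ineq[of "of_real d * z" 1] d Y by (simp add: norm_mult add.commute)
        then have "M / (N + d) \<le> cmod (1 + of_real d * z)" using big by linarith
        then have "M \<le> (N + d) * cmod (1 + of_real d * z)" using N0 d by (simp add: field_simps)
        then have "cmod (H z) \<le> (N + d) * cmod (1 + of_real d * z)" using bdd[OF z(1)] by linarith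
        then show ?thesis using denom[OF z(1)] N0 d by (simp add: norm_divide divide_le_eq)
      qed
    qed
    then have "cmod (H z0) \<le> (N + d) * cmod (1 + of_real d * z0)"
      using denom[OF z0] nz[OF z0] by (simp add: norm_divide divide_le_eq)
    also have "\<dots> \<le> (N + d) * (1 + d * cmod z0)"
      using norm_triangle_ineq[of 1 "of_real d * z0"] d N0 by (intro mult_left_mono) (auto simp: norm_mult)
    finally show ?thesis .
  qed
  have "((\<lambda>d. (N + d) * (1 + d * cmod z0)) \<longlongrightarrow> (N + 0) * (1 + 0 * cmod z0)) (at_right 0)"
    by (intro tendsto_intros)
  moreover have "\<forall>\<^sub>F d in at_right 0. cmod (H z0) \<le> (N + d) * (1 + d * cmod z0)"
    using eventually_at_right_less[of "0::real"] by eventually_elim (rule bound)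
  ultimately show ?thesis using tendsto_lowerbound[of _ _ "at_right (0::real)"] by force
qed (use edge in auto)

text \<open>Duality turns the mean of the modulus into the modulus of a single function. Pairing the polynomial
with a fixed \<open>\<phi>\<close> of modulus at most one gives an ordinary Dirichlet polynomial \<open>H\<close>, bounded on the
imaginary axis by the mean at \<open>0\<close>, since the mean is invariant under the flow; the maximum principle
carries the bound to \<open>s\<close>, and a nearly optimal \<open>\<phi>\<close> for \<open>s\<close> recovers the mean of the modulus there.\<close>

lemma torus_mean_twisted_poly_le:
  assumes P: "dirichlet_polynomial P" and s: "Re s \<ge> 0"
  shows "torus_mean (\<lambda>\<omega>. cmod (twisted_poly P \<omega> s)) \<le> torus_mean (\<lambda>\<omega>. cmod (twisted_poly P \<omega> 0))"
proof (rule field_le_epsilon)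
  fix e :: real assume e: "e > 0"
  let ?N = "torus_mean (\<lambda>\<omega>. cmod (twisted_poly P \<omega> 0))"
  \<comment> \<open>The conjugate sign of the polynomial at \<open>s\<close>, made continuous by \<open>e\<close>.\<close>
  define \<phi> where "\<phi> \<omega> = cnj (twisted_poly P \<omega> s) / of_real (cmod (twisted_poly P \<omega> s) + e)" for \<omega>
  have pos: "cmod (twisted_poly P \<omega> s) + e > 0" for \<omega> using e by (simp add: add_nonneg_pos)
  have \<phi>c: "continuous_on torus_characters \<phi>"
    unfolding \<phi>_def by (intro continuous_intros P ballI) (metis less_irrefl of_real_eq_0_iff pos)
  have \<phi>1: "cmod (\<phi> \<omega>) \<le> 1" for \<omega>
    using pos[of \<omega>] e by (simp add: \<phi>_def norm_divide divide_simps del: of_real_add)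
  define H where "H z = torus_mean (\<lambda>\<omega>. twisted_poly P \<omega> z * \<phi> \<omega>)" for z
  have cont: "continuous_on torus_characters (\<lambda>\<omega>. cmod (twisted_poly P \<omega> z))" for z
    by (intro continuous_intros P)
  have H_le: "cmod (H z) \<le> torus_mean (\<lambda>\<omega>. cmod (twisted_poly P \<omega> z))" for z
    unfolding H_def
    by (rule torus_mean_norm_le) (auto intro!: continuous_intros P \<phi>c mult_left_le \<phi>1 simp: norm_mult)
  have "cmod (H s) \<le> ?N"
  proof (rule half_plane_maximum_principle[where H = H, OF _ _ _ s])
    have "H = (\<lambda>z. \<Sum>n | P n \<noteq> 0. torus_mean (\<lambda>\<omega>. \<omega> n * \<phi> \<omega>) * (P n * of_nat n powr (- z)))"
    proof
      fix z
      have "H z = torus_mean (\<lambda>\<omega>. \<Sum>n | P n \<noteq> 0. (\<omega> n * \<phi> \<omega>) * (P n * of_nat n powr (- z)))"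
        by (simp add: H_def twisted_poly_def sum_distrib_left sum_distrib_right mult_ac)
      also have "\<dots> = (\<Sum>n | P n \<noteq> 0. torus_mean (\<lambda>\<omega>. (\<omega> n * \<phi> \<omega>) * (P n * of_nat n powr (- z))))"
        by (intro torus_mean_sum continuous_intros \<phi>c)
      also have "\<dots> = (\<Sum>n | P n \<noteq> 0. torus_mean (\<lambda>\<omega>. \<omega> n * \<phi> \<omega>) * (P n * of_nat n powr (- z)))"
        by (intro sum.cong refl torus_mean_linear continuous_intros \<phi>c bounded_linear_mult_left)
      finally show "H z = \<dots>" .
    qed
    moreover have "(\<lambda>z. \<Sum>n | P n \<noteq> 0. torus_mean (\<lambda>\<omega>. \<omega> n * \<phi> \<omega>) * (P n * of_nat n powr (- z))) holomorphic_on UNIV"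
    proof (intro holomorphic_on_sum holomorphic_on_mult holomorphic_on_const)
      fix n assume "n \<in> {n. P n \<noteq> 0}"
      then have "n > 0" using dirichlet_polynomial_pos[OF P, of n] by auto
      then show "(\<lambda>z. of_nat n powr (- z) :: complex) holomorphic_on UNIV"
        unfolding powr_def by (auto intro!: holomorphic_intros)
    qed
    ultimately show "H holomorphic_on UNIV" by simp
    show "cmod (H z) \<le> (\<Sum>n | P n \<noteq> 0. cmod (P n))" if "Re z \<ge> 0" for z
    proof -
      have "torus_mean (\<lambda>\<omega>. cmod (twisted_poly P \<omega> z)) \<le> torus_mean (\<lambda>_. (\<Sum>n | P n \<noteq> 0. cmod (P n)))"
        by (rule torus_mean_mono) (auto intro!: cont continuous_intros twisted_poly_norm_le P that)
      then show ?thesis using H_le[of z] by (simp add: torus_mean_const)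
    qed
    show "cmod (H z) \<le> ?N" if "Re z = 0" for z
    proof -
      have z: "z = 0 + \<i> * of_real (Im z)" using that by (simp add: complex_eq_iff)
      have "torus_mean (\<lambda>\<omega>. cmod (twisted_poly P \<omega> z)) = torus_mean (\<lambda>\<omega>. cmod (twisted_poly P (flow (Im z) \<omega>) 0))"
        by (rule torus_mean_cong) (metis z twisted_poly_flow)
      also have "\<dots> = ?N" by (rule torus_mean_flow[OF cont])
      finally show ?thesis using H_le[of z] by simp
    qed
  qed
  moreover have "torus_mean (\<lambda>\<omega>. cmod (twisted_poly P \<omega> s)) - e \<le> cmod (H s)"
  proof -
    let ?x = "\<lambda>\<omega>. (cmod (twisted_poly P \<omega> s))\<^sup>2 / (cmod (twisted_poly P \<omega> s) + e)"
    have c: "continuous_on torus_characters ?x"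
      using pos by (intro continuous_intros P) (auto simp: less_imp_neq[symmetric])
    have "H s = torus_mean (\<lambda>\<omega>. of_real (?x \<omega>))"
      unfolding H_def \<phi>_def by (rule torus_mean_cong) (simp add: complex_norm_square[symmetric])
    also have "\<dots> = of_real (torus_mean ?x)"
      by (rule torus_mean_linear[OF c bounded_linear_of_real])
    finally have "torus_mean ?x \<le> cmod (H s)" by simp
    moreover have "torus_mean (\<lambda>\<omega>. cmod (twisted_poly P \<omega> s) - e) \<le> torus_mean ?x"
    proof (rule torus_mean_mono)
      fix \<omega>
      show "cmod (twisted_poly P \<omega> s) - e \<le> ?x \<omega>"
        using pos[of \<omega>] e by (simp add: le_divide_eq power2_eq_square algebra_simps)
    qed (auto intro!: continuous_intros cont c)
    ultimately show ?thesis by (simp add: torus_mean_diff[OF cont continuous_on_const] torus_mean_const)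
  qed
  ultimately show "torus_mean (\<lambda>\<omega>. cmod (twisted_poly P \<omega> s)) \<le> ?N + e" by linarith
qed

text \<open>The coefficient is the mean of the polynomial against \<open>cnj (\<omega> n)\<close>.\<close>

lemma coeff_le_torus_mean:
  assumes P: "dirichlet_polynomial P"
  shows "cmod (P n) \<le> torus_mean (\<lambda>\<omega>. cmod (twisted_poly P \<omega> 0))"
proof (cases "n = 0")
  case True
  have "torus_mean (\<lambda>_. 0) \<le> torus_mean (\<lambda>\<omega>. cmod (twisted_poly P \<omega> 0))"
    by (rule torus_mean_mono) (auto intro!: continuous_intros P)
  then show ?thesis using True P by (simp add: torus_mean_const dirichlet_polynomial_def)
next
  case False
  have "torus_mean (\<lambda>\<omega>. twisted_poly P \<omega> 0 * cnj (\<omega> n)) = torus_mean (\<lambda>\<omega>. \<Sum>k | P k \<noteq> 0. P k * (\<omega> k * cnj (\<omega> n)))"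
  proof (rule torus_mean_cong)
    fix \<omega>
    show "twisted_poly P \<omega> 0 * cnj (\<omega> n) = (\<Sum>k | P k \<noteq> 0. P k * (\<omega> k * cnj (\<omega> n)))"
      unfolding twisted_poly_def sum_distrib_right
      by (rule sum.cong) (use dirichlet_polynomial_pos[OF P] in auto)
  qed
  also have "\<dots> = (\<Sum>k | P k \<noteq> 0. torus_mean (\<lambda>\<omega>. P k * (\<omega> k * cnj (\<omega> n))))"
    by (intro torus_mean_sum continuous_intros)
  also have "\<dots> = (\<Sum>k | P k \<noteq> 0. if k = n then P k else 0)"
    by (intro sum.cong refl torus_mean_monomial) (use False dirichlet_polynomial_pos[OF P] in auto)
  also have "\<dots> = P n" using dirichlet_polynomial_finite[OF P] by simp
  finally have "cmod (P n) = cmod (torus_mean (\<lambda>\<omega>. twisted_poly P \<omega> 0 * cnj (\<omega> n)))" by simp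
  also have "\<dots> \<le> torus_mean (\<lambda>\<omega>. cmod (twisted_poly P \<omega> 0))"
    by (rule torus_mean_norm_le) (auto intro!: continuous_intros P mult_left_le torus_norm_le simp: norm_mult)
  finally show ?thesis .
qed

lemma eval_dirichlet_polynomial_eq:
  assumes "dirichlet_polynomial P"
  shows "eval_dirichlet_polynomial P (Complex \<sigma> t) = twisted_poly P (flow t unit_character) (of_real \<sigma>)"
proof -
  have "eval_dirichlet_polynomial P (Complex \<sigma> t) = twisted_poly P unit_character (Complex \<sigma> t)"
    unfolding eval_dirichlet_polynomial_def twisted_poly_def
    by (rule sum.cong) (use dirichlet_polynomial_pos[OF assms] in \<open>auto simp: unit_character_def\<close>)
  then show ?thesis by (simp add: twisted_poly_flow unit_character_in_torus Complex_eq)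
qed

text \<open>For fixed \<open>\<sigma>\<close> the mean over a vertical line is the mean over the torus. As \<open>\<sigma>\<close> decreases to \<open>0\<close> the
integrands converge uniformly on the compact torus.\<close>

lemma Hp_norm_eq_torus_mean:
  assumes P: "dirichlet_polynomial P" and p: "p \<ge> 1"
  shows "Hp_norm p P = torus_mean (\<lambda>\<omega>. cmod (twisted_poly P \<omega> 0) powr p) powr (1 / p)"
proof -
  define h where "h \<sigma> \<omega> = cmod (twisted_poly P \<omega> (of_real \<sigma>)) powr p" for \<sigma> \<omega>
  have h_cont: "continuous_on A (\<lambda>x. h (f x) (g x))"
    if "continuous_on A f" "continuous_on A g" for f :: "'x::topological_space \<Rightarrow> real" and g A
    unfolding h_def using p by (intro continuous_on_powr' continuous_intros that P) auto
  have hc: "continuous_on torus_characters (h \<sigma>)" for \<sigma>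
    using h_cont[of torus_characters "\<lambda>_. \<sigma>" "\<lambda>x. x"] by (simp add: continuous_on_id)
  have "vertical_mean p (eval_dirichlet_polynomial P) \<sigma> = time_average (h \<sigma>) unit_character" for \<sigma>
    by (simp add: fun_eq_iff vertical_mean_def time_average_def h_def eval_dirichlet_polynomial_eq[OF P])
  then have Mp: "Mp p P \<sigma> = torus_mean (h \<sigma>) powr (1 / p)" for \<sigma>
    by (simp add: Mp_def torus_mean_def)
  have "((\<lambda>\<sigma>. torus_mean (h \<sigma>)) \<longlongrightarrow> torus_mean (h 0)) (at_right 0)"
  proof (rule tendstoI)
    fix e :: real assume e: "e > 0"
    have "continuous_on (UNIV \<times> torus_characters) (\<lambda>(\<sigma>, \<omega>). h \<sigma> \<omega>)"
      using h_cont[of "UNIV \<times> torus_characters" fst snd] by (simp add: case_prod_beta continuous_on_fst continuous_on_snd continuous_on_id)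
    then obtain X where X: "(0::real) \<in> X" "open X"
      "\<forall>\<sigma>\<in>X \<inter> UNIV. \<forall>\<omega>\<in>torus_characters. dist (case (\<sigma>, \<omega>) of (\<sigma>, \<omega>) \<Rightarrow> h \<sigma> \<omega>) (case (0, \<omega>) of (\<sigma>, \<omega>) \<Rightarrow> h \<sigma> \<omega>) \<le> e / 2"
      by (rule continuous_on_prod_compactE[OF _ compact_torus, of UNIV _ 0 "e/2"]) (use e in auto)
    have "\<forall>\<^sub>F \<sigma> in at_right 0. \<sigma> \<in> X"
      using X(1,2) eventually_at_topological by blast
    then show "\<forall>\<^sub>F \<sigma> in at_right 0. dist (torus_mean (h \<sigma>)) (torus_mean (h 0)) < e"
    proof eventually_elim
      case (elim \<sigma>)
      have "norm (torus_mean (\<lambda>\<omega>. h \<sigma> \<omega> - h 0 \<omega>)) \<le> torus_mean (\<lambda>_. e / 2)"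
        by (rule torus_mean_norm_le) (use X(3) elim in \<open>auto intro!: continuous_intros hc simp: dist_real_def\<close>)
      then show ?case using e by (simp add: torus_mean_diff[OF hc hc] torus_mean_const dist_norm)
    qed
  qed
  then have "((\<lambda>\<sigma>. Mp p P \<sigma>) \<longlongrightarrow> torus_mean (h 0) powr (1 / p)) (at_right 0)"
    unfolding Mp
  proof (rule tendsto_powr')
    have "torus_mean (\<lambda>_. 0) \<le> torus_mean (h \<sigma>)" for \<sigma>
      by (rule torus_mean_mono[OF _ hc]) (auto simp: h_def)
    then show "torus_mean (h 0) \<noteq> 0 \<or> 0 < 1 / p \<and> (\<forall>\<^sub>F \<sigma> in at_right 0. 0 \<le> torus_mean (h \<sigma>))"
      using p by (auto simp: torus_mean_const)
  qed auto
  then have "Hp_norm p P = torus_mean (h 0) powr (1 / p)"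
    unfolding Hp_norm_def by (intro tendsto_Lim) auto
  then show ?thesis by (simp add: h_def[abs_def])
qed

text \<open>The norm of exponent \<open>p\<close> controls the mean of exponent one. The pointwise inequality
\<open>x \<le> d + x\<^sup>p d\<^sup>1\<^sup>-\<^sup>p\<close> replaces Hoelder's inequality; the factor two is harmless, as only
boundedness is used.\<close>

lemma torus_mean_le_of_Hp_norm_less:
  assumes P: "dirichlet_polynomial P" and p: "p \<ge> 1" and d: "Hp_norm p P < d"
  shows "torus_mean (\<lambda>\<omega>. cmod (twisted_poly P \<omega> 0)) \<le> 2 * d"
proof -
  let ?m = "torus_mean (\<lambda>\<omega>. cmod (twisted_poly P \<omega> 0) powr p)"
  have cp: "continuous_on torus_characters (\<lambda>\<omega>. cmod (twisted_poly P \<omega> 0) powr p)"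
    using p by (intro continuous_on_powr' continuous_intros P) auto
  have d0: "d > 0"
    using d unfolding Hp_norm_eq_torus_mean[OF P p] by (smt (verit) powr_ge_zero)
  have m0: "?m \<ge> 0"
    using torus_mean_mono[OF continuous_on_const cp, of 0] by (simp add: torus_mean_const)
  have "?m = (?m powr (1/p)) powr p" using m0 p by (simp add: powr_powr)
  also have "\<dots> \<le> d powr p"
    using d p unfolding Hp_norm_eq_torus_mean[OF P p] by (intro powr_mono2) auto
  finally have m: "?m \<le> d powr p" .
  have le: "x \<le> d + x powr p * d powr (1 - p)" if "x \<ge> 0" for x
  proof (cases "x \<le> d")
    case True then show ?thesis by (simp add: add_increasing2)
  next
    case False
    then have "x = x powr p * x powr (1 - p)" using d0 by (simp add: powr_add[symmetric])
    also have "\<dots> \<le> x powr p * d powr (1 - p)"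
      using False d0 p by (intro mult_left_mono powr_mono2') auto
    finally show ?thesis using d0 by linarith
  qed
  have "torus_mean (\<lambda>\<omega>. cmod (twisted_poly P \<omega> 0))
      \<le> torus_mean (\<lambda>\<omega>. d + cmod (twisted_poly P \<omega> 0) powr p * d powr (1 - p))"
    by (rule torus_mean_mono) (auto intro!: continuous_intros P cp le)
  also have "\<dots> = d + ?m * d powr (1 - p)"
    using torus_mean_linear[OF cp bounded_linear_mult_left[of "d powr (1 - p)"]]
    by (simp add: torus_mean_add[OF continuous_on_const] continuous_on_mult_right cp torus_mean_const)
  also have "\<dots> \<le> d + d powr p * d powr (1 - p)"
    using m by (intro add_left_mono mult_right_mono) auto
  also have "\<dots> = 2 * d" using d0 by (simp add: powr_add[symmetric])
  finally show ?thesis .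
qed

text \<open>All that the proof uses about membership in the Hardy space: the series is a coefficientwise limit of
Dirichlet polynomials with bounded first means, uniformly on all vertical lines of the closed
half-plane.\<close>

lemma Hp_space_bounded_approximation:
  assumes p: "1 \<le> p" and a: "a \<in> Hp_space p"
  obtains P C where "\<And>k. dirichlet_polynomial (P k)" "\<And>n. (\<lambda>k. P k n) \<longlonglongrightarrow> a n"
    "\<And>k s. Re s \<ge> 0 \<Longrightarrow> torus_mean (\<lambda>\<omega>. cmod (twisted_poly (P k) \<omega> s)) \<le> C"
    "\<And>k n. cmod (P k n) \<le> C"
proof -
  obtain Q where Q: "\<And>k. dirichlet_polynomial (Q k)" "\<And>n. (\<lambda>k. Q k n) \<longlonglongrightarrow> a n"
    and cauchy: "\<forall>e>0. \<exists>K. \<forall>j\<ge>K. \<forall>k\<ge>K. Hp_norm p (\<lambda>n. Q j n - Q k n) < e"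
    using a by (auto simp: Hp_space_def)
  obtain K where K: "\<forall>j\<ge>K. \<forall>k\<ge>K. Hp_norm p (\<lambda>n. Q j n - Q k n) < 1"
    using cauchy by (meson zero_less_one)
  define C where "C = 2 * 1 + torus_mean (\<lambda>\<omega>. cmod (twisted_poly (Q K) \<omega> 0))"
  have C: "torus_mean (\<lambda>\<omega>. cmod (twisted_poly (Q (k + K)) \<omega> 0)) \<le> C" for k
  proof -
    have "torus_mean (\<lambda>\<omega>. cmod (twisted_poly (Q (k + K)) \<omega> 0))
        \<le> torus_mean (\<lambda>\<omega>. cmod (twisted_poly (\<lambda>n. Q (k + K) n - Q K n) \<omega> 0) + cmod (twisted_poly (Q K) \<omega> 0))"
      by (rule torus_mean_mono)
        (auto intro!: continuous_intros Q dirichlet_polynomial_diff simp: twisted_poly_diff Q norm_triangle_sub add.commute)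
    also have "\<dots> = torus_mean (\<lambda>\<omega>. cmod (twisted_poly (\<lambda>n. Q (k + K) n - Q K n) \<omega> 0)) + torus_mean (\<lambda>\<omega>. cmod (twisted_poly (Q K) \<omega> 0))"
      by (intro torus_mean_add continuous_intros Q dirichlet_polynomial_diff)
    also have "\<dots> \<le> C"
      unfolding C_def using K
      by (intro add_right_mono torus_mean_le_of_Hp_norm_less[OF _ p] dirichlet_polynomial_diff Q) auto
    finally show ?thesis .
  qed
  show ?thesis
  proof (rule that[of "\<lambda>k. Q (k + K)" C])
    show "(\<lambda>k. Q (k + K) n) \<longlonglongrightarrow> a n" for n using Q(2) by (rule LIMSEQ_ignore_initial_segment)
    show "torus_mean (\<lambda>\<omega>. cmod (twisted_poly (Q (k + K)) \<omega> s)) \<le> C" if "Re s \<ge> 0" for k s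
      using torus_mean_twisted_poly_le[OF Q(1) that] C by (rule order_trans)
    show "cmod (Q (k + K) n) \<le> C" for k n
      using coeff_le_torus_mean[OF Q(1)] C by (rule order_trans)
  qed (rule Q)
qed

section \<open>Circle means of holomorphic functions\<close>

definition circle_mean :: "real \<Rightarrow> (complex \<Rightarrow> complex) \<Rightarrow> real" where
  "circle_mean r g = 1 / (2 * pi) * integral {0..2*pi} (\<lambda>\<theta>. cmod (g (of_real r * cis \<theta>)))"

lemma circle_continuous:
  fixes g :: "complex \<Rightarrow> 'a::topological_space"
  assumes "continuous_on (cball 0 r) g" "r \<ge> 0"
  shows "continuous_on A (\<lambda>\<theta>. g (of_real r * cis \<theta>))"
  by (rule continuous_on_compose2[OF assms(1)]) (use assms(2) in \<open>auto intro!: continuous_intros simp: norm_mult\<close>)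

lemma circle_mean_nonneg:
  "continuous_on (cball 0 r) g \<Longrightarrow> r \<ge> 0 \<Longrightarrow> circle_mean r g \<ge> 0"
  unfolding circle_mean_def by (intro mult_nonneg_nonneg integral_nonneg integrable_continuous_interval continuous_intros circle_continuous) auto

lemma circle_mean_eq:
  assumes "r \<ge> 0" and "\<And>z. cmod z = r \<Longrightarrow> cmod (f z) = cmod (g z)"
  shows "circle_mean r f = circle_mean r g"
  using assms unfolding circle_mean_def by (simp add: norm_mult)

lemma circle_mean_diff_le:
  assumes "continuous_on (cball 0 r) f" "continuous_on (cball 0 r) g" "r \<ge> 0"
  shows "circle_mean r (\<lambda>z. f z - g z) \<le> circle_mean r f + circle_mean r g"
proof -
  have "integral {0..2*pi} (\<lambda>\<theta>. cmod (f (of_real r * cis \<theta>) - g (of_real r * cis \<theta>)))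
      \<le> integral {0..2*pi} (\<lambda>\<theta>. cmod (f (of_real r * cis \<theta>)) + cmod (g (of_real r * cis \<theta>)))"
    by (intro integral_le integrable_continuous_interval continuous_intros circle_continuous assms norm_triangle_ineq4)
  also have "\<dots> = integral {0..2*pi} (\<lambda>\<theta>. cmod (f (of_real r * cis \<theta>))) + integral {0..2*pi} (\<lambda>\<theta>. cmod (g (of_real r * cis \<theta>)))"
    by (intro integral_add integrable_continuous_interval continuous_intros circle_continuous assms)
  finally show ?thesis
    unfolding circle_mean_def by (simp add: divide_right_mono add_divide_distrib[symmetric])
qed

text \<open>The common source of the following Cauchy estimates, in which the maximum over the circle is replaced
by the mean: the mean is what survives averaging over vertical translates.\<close>

lemma contour_integral_norm_le_circle_mean:
  assumes I: "(f has_contour_integral I) (circlepath 0 r)" and r: "r > 0"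
    and g: "continuous_on (cball 0 r) g" and K: "\<And>z. cmod z = r \<Longrightarrow> cmod (f z) \<le> K * cmod (g z)"
  shows "cmod I \<le> 2 * pi * r * K * circle_mean r g"
proof -
  have 1: "((\<lambda>t. f (of_real r * cis t) * of_real r * \<i> * cis t) has_integral I) {0..2*pi}"
    using I has_contour_integral_part_circlepath_iff[of 0 "2*pi" f I 0 r] by (simp add: circlepath_def)
  have 2: "((\<lambda>t. r * K * cmod (g (of_real r * cis t))) has_integral
      r * K * integral {0..2*pi} (\<lambda>t. cmod (g (of_real r * cis t)))) {0..2*pi}"
    by (intro has_integral_mult_right integrable_integral integrable_continuous_interval continuous_intros circle_continuous g) (use r in auto)
  have 3: "cmod (f (of_real r * cis t) * of_real r * \<i> * cis t) \<le> r * K * cmod (g (of_real r * cis t))" for t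
    using K[of "of_real r * cis t"] r by (simp add: norm_mult mult_ac)
  have "cmod I \<le> r * K * integral {0..2*pi} (\<lambda>t. cmod (g (of_real r * cis t)))"
    using integral_norm_bound_integral[OF has_integral_integrable[OF 1] has_integral_integrable[OF 2] 3]
    by (simp only: integral_unique[OF 1] integral_unique[OF 2])
  then show ?thesis by (simp add: circle_mean_def)
qed

lemma mean_value_le_circle_mean:
  assumes g: "continuous_on (cball 0 r) g" "g holomorphic_on ball 0 r" and r: "r > 0"
  shows "cmod (g 0) \<le> circle_mean r g"
proof -
  have "((\<lambda>u. g u / (u - 0)) has_contour_integral (2 * of_real pi * \<i> * g 0)) (circlepath 0 r)"
    by (rule Cauchy_integral_circlepath) (use assms in auto)
  then have "cmod (2 * of_real pi * \<i> * g 0) \<le> 2 * pi * r * (1/r) * circle_mean r g"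
    by (rule contour_integral_norm_le_circle_mean) (use assms in \<open>auto simp: norm_divide\<close>)
  then show ?thesis using r by (simp add: norm_mult)
qed

lemma taylor_coeff_le_circle_mean:
  assumes g: "continuous_on (cball 0 r) g" "g holomorphic_on ball 0 r" and r: "r > 0"
  shows "cmod ((deriv ^^ k) g 0 / fact k) \<le> circle_mean r g / r ^ k"
proof -
  let ?I = "contour_integral (circlepath 0 r) (\<lambda>u. g u / (u - 0) ^ Suc k)"
  have 1: "((\<lambda>u. g u / (u - 0) ^ Suc k) has_contour_integral ?I) (circlepath 0 r)"
    using Cauchy_higher_derivative_integral_circlepath(1)[OF g, of 0 k] r has_contour_integral_integral by auto
  have 2: "(deriv ^^ k) g 0 = (fact k) / (2 * pi * \<i>) * ?I"
    using Cauchy_higher_derivative_integral_circlepath(2)[OF g, of 0 k] r by auto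
  have "cmod ?I \<le> 2 * pi * r * (1 / r ^ Suc k) * circle_mean r g"
    by (rule contour_integral_norm_le_circle_mean[OF 1]) (use g r in \<open>auto simp: norm_divide norm_power norm_mult\<close>)
  also have "\<dots> = 2 * pi * (circle_mean r g / r ^ k)" using r by (simp add: field_simps)
  finally show ?thesis using r by (simp add: 2 norm_mult norm_divide field_simps)
qed

lemma taylor_tail_le_circle_mean:
  assumes g: "continuous_on (cball 0 \<rho>) g" "g holomorphic_on ball 0 \<rho>"
    and r: "0 < r" "r < \<rho>" and w: "cmod w \<le> r"
  shows "cmod (g w - (\<Sum>j<J. (deriv ^^ j) g 0 / fact j * w ^ j)) \<le> circle_mean \<rho> g * ((r/\<rho>) ^ J / (1 - r/\<rho>))"
proof (rule norm_sums_le)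
  have "(\<lambda>n. (deriv ^^ n) g 0 / fact n * (w - 0) ^ n) sums g w"
    by (rule holomorphic_power_series[OF g(2)]) (use r w in auto)
  then have "(\<lambda>n. (deriv ^^ n) g 0 / fact n * w ^ n) sums g w" by simp
  then show "(\<lambda>n. (deriv ^^ (n + J)) g 0 / fact (n + J) * w ^ (n + J)) sums (g w - (\<Sum>j<J. (deriv ^^ j) g 0 / fact j * w ^ j))"
    by (rule sums_split_initial_segment)
  have "(\<lambda>n. (circle_mean \<rho> g * (r/\<rho>) ^ J) * (r/\<rho>) ^ n) sums ((circle_mean \<rho> g * (r/\<rho>) ^ J) * (1 / (1 - r/\<rho>)))"
    by (intro sums_mult geometric_sums) (use r in auto)
  then show "(\<lambda>n. circle_mean \<rho> g * (r/\<rho>) ^ (n + J)) sums (circle_mean \<rho> g * ((r/\<rho>) ^ J / (1 - r/\<rho>)))"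
    by (simp add: power_add mult_ac)
  fix n
  have "cmod ((deriv ^^ (n + J)) g 0 / fact (n + J) * w ^ (n + J)) \<le> circle_mean \<rho> g / \<rho> ^ (n + J) * r ^ (n + J)"
    unfolding norm_mult norm_power
    by (intro mult_mono taylor_coeff_le_circle_mean g power_mono divide_nonneg_nonneg circle_mean_nonneg) (use r w in auto)
  then show "cmod ((deriv ^^ (n + J)) g 0 / fact (n + J) * w ^ (n + J)) \<le> circle_mean \<rho> g * (r/\<rho>) ^ (n + J)"
    by (simp add: power_divide)
qed

lemma norm_le_circle_mean:
  assumes "continuous_on (cball 0 \<rho>) g" "g holomorphic_on ball 0 \<rho>" "0 < r" "r < \<rho>" "cmod w \<le> r"
  shows "cmod (g w) \<le> circle_mean \<rho> g / (1 - r/\<rho>)"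
  using taylor_tail_le_circle_mean[OF assms, of 0] by simp

text \<open>A function that is tiny on a small disc and has bounded circle mean is small on every disc in
between: the first Taylor coefficients are controlled by the small disc, the remaining ones by the
circle mean. This takes the place of the convexity of means in \<open>\<sigma>\<close>: Dirichlet polynomials approximate
the function uniformly far to the right, and the estimate carries the approximation to the left.\<close>

lemma two_constants_circle_mean:
  assumes g: "continuous_on (cball 0 \<rho>) g" "g holomorphic_on ball 0 \<rho>"
    and r: "0 < r0" "r0 \<le> r" "r < \<rho>" and w: "cmod w \<le> r"
    and small: "\<And>z. cmod z \<le> r0 \<Longrightarrow> cmod (g z) \<le> e"
  shows "cmod (g w) \<le> e * (\<Sum>j<J. (r/r0) ^ j) + circle_mean \<rho> g * ((r/\<rho>) ^ J / (1 - r/\<rho>))"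
proof -
  have e: "e \<ge> 0" using small[of 0] r by (simp add: order_trans[OF norm_ge_zero])
  have "cmod (\<Sum>j<J. (deriv ^^ j) g 0 / fact j * w ^ j) \<le> (\<Sum>j<J. e / r0 ^ j * r ^ j)"
  proof (rule sum_norm_le)
    fix j
    have "cmod ((deriv ^^ j) g 0) \<le> fact j * e / r0 ^ j"
    proof (rule Cauchy_inequality)
      show "g holomorphic_on ball 0 r0" using g(2) r by (auto elim!: holomorphic_on_subset)
      show "continuous_on (cball 0 r0) g" using g(1) r by (auto elim!: continuous_on_subset)
    qed (use r small in auto)
    then have "cmod ((deriv ^^ j) g 0 / fact j) \<le> e / r0 ^ j"
      using r by (simp add: norm_divide field_simps)
    then show "cmod ((deriv ^^ j) g 0 / fact j * w ^ j) \<le> e / r0 ^ j * r ^ j"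
      unfolding norm_mult norm_power by (intro mult_mono power_mono) (use r w e in auto)
  qed
  also have "\<dots> = e * (\<Sum>j<J. (r/r0) ^ j)" by (simp add: sum_distrib_left power_divide)
  finally show ?thesis
    using taylor_tail_le_circle_mean[OF g _ r(3) w, of J] r norm_triangle_sub[of "g w" "\<Sum>j<J. (deriv ^^ j) g 0 / fact j * w ^ j"]
    by auto
qed

lemma eventually_nonzero_at:
  assumes "g holomorphic_on S" "open S" "connected S" "z \<in> S" "c \<in> S" "g c \<noteq> 0"
  shows "\<forall>\<^sub>F w in at z. g w \<noteq> 0"
  using non_zero_neighbour_alt[OF assms] by (auto elim: eventually_mono)

lemma divide_out_zero:
  assumes g: "g holomorphic_on ball 0 1" and nz: "g 0 \<noteq> 0" and z: "z \<in> ball 0 1" "g z = 0"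
  obtains k where "k holomorphic_on ball 0 1" "zorder g z > 0"
    "\<And>w. w \<in> ball 0 1 \<Longrightarrow> g w = k w * (w - z) ^ nat (zorder g z)"
proof -
  let ?n = "nat (zorder g z)"
  obtain r where n: "zorder g z > 0" and r: "r > 0" "cball z r \<subseteq> ball 0 1" "zor_poly g z holomorphic_on cball z r"
    "\<forall>w\<in>cball z r. g w = zor_poly g z w * (w - z) ^ ?n \<and> zor_poly g z w \<noteq> 0"
    using zorder_exist_zero[OF g open_ball connected_ball z(1) bexI[of "\<lambda>w. g w \<noteq> 0", OF nz]] z(2) by auto
  define k where "k w = (if w = z then zor_poly g z z else g w / (w - z) ^ ?n)" for w
  have "k holomorphic_on (ball z r \<union> (ball 0 1 - {z}))"
  proof (rule holomorphic_on_Un)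
    show "k holomorphic_on ball z r"
      by (rule holomorphic_transform[of "zor_poly g z"])
        (use r in \<open>auto simp: k_def elim!: holomorphic_on_subset\<close>)
    show "k holomorphic_on (ball 0 1 - {z})"
      by (rule holomorphic_transform[of "\<lambda>w. g w / (w - z) ^ ?n"])
        (auto simp: k_def intro!: holomorphic_intros holomorphic_on_subset[OF g])
  qed (auto simp: open_delete)
  moreover have "ball z r \<union> (ball 0 1 - {z}) = ball 0 1"
    using r(1) z order_trans[OF ball_subset_cball r(2)] centre_in_ball[of z r] by blast
  ultimately have "k holomorphic_on ball 0 1" by simp
  moreover have "g w = k w * (w - z) ^ ?n" for w
    using n z by (auto simp: k_def)
  ultimately show ?thesis using that n by blast
qed

text \<open>Each zero is replaced by its mirror image in the circle, one at a time. This does not change the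
modulus on the circle and raises the modulus at the origin by the factor \<open>\<rho> / cmod z\<close> for each
order; finally the modulus at the origin is at most the circle mean.\<close>

lemma jensen_inequality:
  assumes "finite Z" "g holomorphic_on ball 0 1" "g 0 \<noteq> 0" "0 < \<rho>" "\<rho> < 1"
    and "\<And>z. z \<in> Z \<Longrightarrow> cmod z < \<rho> \<and> g z = 0"
  shows "(\<Sum>z\<in>Z. of_int (zorder g z) * ln (\<rho> / cmod z)) \<le> ln (circle_mean \<rho> g / cmod (g 0))"
  using assms
proof (induction Z arbitrary: g rule: finite_induct)
  case empty
  have "continuous_on (cball 0 \<rho>) g" "g holomorphic_on ball 0 \<rho>"
    using empty by (auto elim!: holomorphic_on_subset intro!: holomorphic_on_imp_continuous_on)
  then have "cmod (g 0) \<le> circle_mean \<rho> g" using empty by (intro mean_value_le_circle_mean) auto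
  then show ?case using empty by simp
next
  case (insert z Z)
  let ?n = "nat (zorder g z)"
  have g: "g holomorphic_on ball 0 1" "g 0 \<noteq> 0" and \<rho>: "0 < \<rho>" "\<rho> < 1"
    and zeros: "\<And>s. s \<in> insert z Z \<Longrightarrow> cmod s < \<rho> \<and> g s = 0"
    using insert.prems by auto
  have z: "cmod z < \<rho>" "g z = 0" using zeros by auto
  have z0: "z \<noteq> 0" using z g by auto
  obtain k where k: "k holomorphic_on ball 0 1" and n: "zorder g z > 0"
    and gk: "\<And>w. w \<in> ball 0 1 \<Longrightarrow> g w = k w * (w - z) ^ ?n"
    using divide_out_zero[of g z] g \<rho> z by auto
  \<comment> \<open>On the circle \<open>B w\<close> has the modulus of \<open>w - z\<close>; it has no zeros in the closed disc.\<close>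
  define B where "B w = ((of_real \<rho>)\<^sup>2 - cnj z * w) / of_real \<rho>" for w
  define h where "h w = k w * B w ^ ?n" for w
  have Bnz: "B w \<noteq> 0" if "cmod w \<le> \<rho>" for w
  proof
    assume "B w = 0"
    then have "(of_real \<rho>)\<^sup>2 = cnj z * w" using \<rho> by (simp add: B_def)
    then have "\<rho>\<^sup>2 = cmod z * cmod w" by (metis complex_mod_cnj norm_mult norm_of_real norm_power power2_abs)
    also have "\<dots> \<le> cmod z * \<rho>" using that by (intro mult_left_mono) auto
    also have "\<dots> < \<rho> * \<rho>" using z \<rho> by (intro mult_strict_right_mono) auto
    finally show False by (simp add: power2_eq_square)
  qed
  have hol_h: "h holomorphic_on ball 0 1"
    unfolding h_def B_def by (intro holomorphic_intros k) (use \<rho> in auto)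
  have norm_eq: "cmod (h w) = cmod (g w)" if w: "cmod w = \<rho>" for w
  proof -
    have "(of_real \<rho>)\<^sup>2 = w * cnj w" using complex_norm_square[of w] w by simp
    then have "(of_real \<rho>)\<^sup>2 - cnj z * w = w * cnj (w - z)" by (simp add: algebra_simps)
    then have "cmod (B w) = cmod (w - z)"
      using \<rho> w by (simp add: B_def norm_divide norm_mult complex_mod_cnj del: complex_cnj_diff)
    then show ?thesis using gk[of w] w \<rho> by (simp add: h_def norm_mult norm_power)
  qed
  have h0: "cmod (h 0) = cmod (g 0) * (\<rho> / cmod z) ^ ?n"
    using gk[of 0] z0 \<rho> by (simp add: h_def B_def norm_mult norm_power power_divide power2_eq_square)
  have h0nz: "h 0 \<noteq> 0" using h0 z0 g \<rho> by auto
  have ord: "h s = 0 \<and> zorder h s = zorder g s" if s: "s \<in> Z" for s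
  proof -
    have sz: "s \<noteq> z" "cmod s < \<rho>" "g s = 0" using s zeros insert.hyps by auto
    have s1: "s \<in> ball 0 1" using sz \<rho> by auto
    have k0: "k s = 0" using gk[OF s1] sz by auto
    have knz: "k 0 \<noteq> 0" using gk[of 0] g by auto
    have an: "k analytic_on {s}" "B analytic_on {s}"
      unfolding B_def using k s1 \<rho> by (auto simp: analytic_at intro!: holomorphic_intros exI[of _ "ball 0 1"])
    have evk: "\<forall>\<^sub>F w in at s. k w \<noteq> 0"
      by (rule eventually_nonzero_at[OF k, of _ 0]) (use s1 knz in auto)
    have evB: "\<forall>\<^sub>F w in at s. B w \<noteq> 0"
      using eventually_at_in_open'[of "ball 0 \<rho>" s] sz by (auto elim!: eventually_mono intro!: Bnz)
    have evz: "\<forall>\<^sub>F w in at s. w - z \<noteq> 0"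
      using eventually_at_in_open'[of "-{z}" s] sz by (auto elim!: eventually_mono)
    have "zorder h s = zorder k s + zorder (\<lambda>w. B w ^ ?n) s"
      unfolding h_def
      by (rule zorder_times_analytic) (use an evk evB in \<open>auto intro!: analytic_intros elim: eventually_elim2\<close>)
    also have "zorder (\<lambda>w. B w ^ ?n) s = 0"
      by (rule zorder_eq_0I) (use an Bnz[of s] sz in \<open>auto intro!: analytic_intros\<close>)
    finally have 1: "zorder h s = zorder k s" by simp
    have "zorder g s = zorder (\<lambda>w. k w * (w - z) ^ ?n) s"
      by (rule zorder_cong) (use eventually_nhds_in_open[of "ball 0 1" s] s1 gk in \<open>auto elim!: eventually_mono simp: eventually_at_filter\<close>)
    also have "\<dots> = zorder k s + zorder (\<lambda>w. (w - z) ^ ?n) s"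
      by (rule zorder_times_analytic) (use an evk evz in \<open>auto intro!: analytic_intros elim: eventually_elim2\<close>)
    also have "zorder (\<lambda>w. (w - z) ^ ?n) s = 0"
      by (rule zorder_eq_0I) (use sz in \<open>auto intro!: analytic_intros\<close>)
    finally show ?thesis using 1 k0 by (simp add: h_def)
  qed
  have IH: "(\<Sum>s\<in>Z. of_int (zorder h s) * ln (\<rho> / cmod s)) \<le> ln (circle_mean \<rho> h / cmod (h 0))"
    using \<rho> zeros ord by (intro insert.IH hol_h h0nz) auto
  have cm: "circle_mean \<rho> h = circle_mean \<rho> g"
    by (rule circle_mean_eq) (use \<rho> norm_eq in auto)
  have pos: "circle_mean \<rho> g > 0"
  proof -
    have "cmod (h 0) \<le> circle_mean \<rho> h"
      using hol_h \<rho> by (intro mean_value_le_circle_mean) (auto elim!: holomorphic_on_subset intro!: holomorphic_on_imp_continuous_on)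
    then show ?thesis using h0nz cm by (smt (verit) zero_less_norm_iff)
  qed
  have "ln (circle_mean \<rho> h / cmod (h 0)) = ln (circle_mean \<rho> g / cmod (g 0)) - ?n * ln (\<rho> / cmod z)"
    unfolding cm h0 using pos \<rho> g z0
    by (simp add: ln_div ln_mult ln_realpow)
  then show ?case
    using IH n insert.hyps ord by simp
qed

section \<open>Weighted sums over zeros as functionals of the function\<close>

definition weighted_zero_sum :: "(complex \<Rightarrow> real) \<Rightarrow> (complex \<Rightarrow> complex) \<Rightarrow> real" where
  "weighted_zero_sum W g = (\<Sum>z | W z \<noteq> 0 \<and> g z = 0. of_int (zorder g z) * W z)"

lemma finite_zeros_disc:
  assumes "g holomorphic_on ball 0 R" "g 0 \<noteq> 0" "r < R"
  shows "finite {z \<in> cball 0 r. g z = 0}"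
proof (cases "\<exists>z\<in>cball 0 r. g z = 0")
  case True
  then obtain z where z: "z \<in> cball 0 r" "g z = 0" by auto
  then have R: "z \<in> ball 0 R" "0 \<in> ball 0 R" using assms(3) norm_ge_zero[of z] by (auto simp del: norm_ge_zero)
  have "\<not> g constant_on ball 0 R"
    using z R assms(2) unfolding constant_on_def by metis
  then show ?thesis
    using holomorphic_compact_finite_zeros[OF assms(1) open_ball connected_ball compact_cball, of 0 r] assms(3)
    by (simp add: subset_eq)
next
  case False
  then have "{z \<in> cball 0 r. g z = 0} = {}" by blast
  then show ?thesis by (metis finite.emptyI)
qed

lemma zorder_pos_disc:
  assumes "g holomorphic_on ball 0 R" "g 0 \<noteq> 0" "z \<in> ball 0 R" "g z = 0"
  shows "zorder g z > 0"
proof -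
  have R: "R > 0" using assms(3) by (auto intro: le_less_trans[OF norm_ge_zero])
  show ?thesis
    using zorder_exist_zero[OF assms(1) open_ball connected_ball assms(3) bexI[of "\<lambda>w. g w \<noteq> 0", OF assms(2)]] assms(4) R
    by auto
qed

lemma rouche_disc:
  assumes hol: "f holomorphic_on ball 0 R" "h holomorphic_on ball 0 R" and nz: "f 0 \<noteq> 0" "h 0 \<noteq> 0"
    and \<rho>: "0 < \<rho>" "cmod z + \<rho> < R"
    and less: "\<And>x. dist z x = \<rho> \<Longrightarrow> cmod (h x - f x) < cmod (f x)"
  shows "(\<Sum>x | x \<in> ball z \<rho> \<and> h x = 0. zorder h x) = (\<Sum>x | x \<in> ball z \<rho> \<and> f x = 0. zorder f x)"
proof -
  define S :: "complex set" where "S = ball 0 ((cmod z + \<rho> + R) / 2)"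
  define \<gamma> where "\<gamma> = circlepath z \<rho>"
  have S: "S \<subseteq> ball 0 R" using \<rho> by (auto simp: S_def)
  have Sc: "S \<subseteq> cball 0 ((cmod z + \<rho> + R) / 2)" by (auto simp: S_def)
  have bS: "cball z \<rho> \<subseteq> S"
  proof
    fix x assume "x \<in> cball z \<rho>"
    then have "cmod x \<le> cmod z + \<rho>" using norm_triangle_ineq2[of x z] by (simp add: dist_norm norm_minus_commute)
    then show "x \<in> S" using \<rho> by (simp add: S_def)
  qed
  have fin: "finite {p \<in> S. g p = 0}" if "g holomorphic_on ball 0 R" "g 0 \<noteq> 0" for g
    by (rule finite_subset[OF _ finite_zeros_disc[OF that, of "(cmod z + \<rho> + R) / 2"]]) (use Sc \<rho> in auto)
  have img: "path_image \<gamma> = sphere z \<rho>" using \<rho> by (simp add: \<gamma>_def)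
  have w1: "winding_number \<gamma> p = 1" if "p \<in> ball z \<rho>" for p
    unfolding \<gamma>_def using that by (intro winding_number_circlepath) (simp add: dist_norm norm_minus_commute)
  have w0: "winding_number \<gamma> p = 0" if "p \<notin> cball z \<rho>" for p
    by (rule winding_number_zero_outside[of _ "cball z \<rho>"]) (use that img in \<open>auto simp: \<gamma>_def\<close>)
  have count: "(\<Sum>p\<in>{p\<in>S. g p = 0}. winding_number \<gamma> p * of_int (zorder g p)) = of_int (\<Sum>x | x \<in> ball z \<rho> \<and> g x = 0. zorder g x)"
    if g: "g holomorphic_on ball 0 R" "g 0 \<noteq> 0" "\<And>x. dist z x = \<rho> \<Longrightarrow> g x \<noteq> 0" for g
  proof -
    have "(\<Sum>p\<in>{p\<in>S. g p = 0}. winding_number \<gamma> p * of_int (zorder g p))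
        = (\<Sum>p | p \<in> ball z \<rho> \<and> g p = 0. winding_number \<gamma> p * of_int (zorder g p))"
    proof (rule sum.mono_neutral_right[OF fin[OF g(1,2)]])
      show "{p. p \<in> ball z \<rho> \<and> g p = 0} \<subseteq> {p \<in> S. g p = 0}" using bS by auto
      show "\<forall>p\<in>{p \<in> S. g p = 0} - {p. p \<in> ball z \<rho> \<and> g p = 0}. winding_number \<gamma> p * of_int (zorder g p) = 0"
      proof
        fix p assume p: "p \<in> {p \<in> S. g p = 0} - {p. p \<in> ball z \<rho> \<and> g p = 0}"
        then have "p \<notin> cball z \<rho>" using g(3)[of p] by (cases "dist z p = \<rho>") auto
        then show "winding_number \<gamma> p * of_int (zorder g p) = 0" using w0 by simp
      qed
    qed
    also have "\<dots> = (\<Sum>p | p \<in> ball z \<rho> \<and> g p = 0. of_int (zorder g p))"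
      by (rule sum.cong) (use w1 in auto)
    finally show ?thesis by simp
  qed
  have eq: "(\<lambda>p. f p + (h p - f p)) = h" by auto
  have "(\<Sum>p\<in>{p\<in>S. f p + (h p - f p) = 0}. winding_number \<gamma> p * of_int (zorder (\<lambda>p. f p + (h p - f p)) p))
      = (\<Sum>p\<in>{p\<in>S. f p = 0}. winding_number \<gamma> p * of_int (zorder f p))"
  proof (rule Rouche_theorem)
    show "open S" "connected S" by (auto simp: S_def)
    show "finite {p \<in> S. f p + (h p - f p) = 0}" using fin[OF hol(2) nz(2)] by simp
    show "finite {p \<in> S. f p = 0}" by (rule fin[OF hol(1) nz(1)])
    show "f holomorphic_on S" "(\<lambda>p. h p - f p) holomorphic_on S"
      using hol S by (auto intro!: holomorphic_intros elim: holomorphic_on_subset)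
    show "valid_path \<gamma>" "pathfinish \<gamma> = pathstart \<gamma>" by (auto simp: \<gamma>_def)
    show "path_image \<gamma> \<subseteq> S" using img bS by auto
    show "\<forall>x\<in>path_image \<gamma>. cmod (h x - f x) < cmod (f x)" using less img by auto
    show "\<forall>x. x \<notin> S \<longrightarrow> winding_number \<gamma> x = 0" using w0 bS by blast
  qed
  then have "(\<Sum>p\<in>{p\<in>S. h p = 0}. winding_number \<gamma> p * of_int (zorder h p))
      = (\<Sum>p\<in>{p\<in>S. f p = 0}. winding_number \<gamma> p * of_int (zorder f p))"
    unfolding eq by simp
  moreover have "f x \<noteq> 0" "h x \<noteq> 0" if "dist z x = \<rho>" for x
    using less[OF that] by auto
  ultimately have "of_int (\<Sum>x | x \<in> ball z \<rho> \<and> h x = 0. zorder h x) = (of_int (\<Sum>x | x \<in> ball z \<rho> \<and> f x = 0. zorder f x) :: complex)"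
    using count[OF hol(1) nz(1)] count[OF hol(2) nz(2)] by simp
  then show ?thesis by (simp only: of_int_eq_iff)
qed

text \<open>The last condition keeps the discs around points of modulus beyond \<open>r1\<close> away from the disc of radius
\<open>r1\<close>, which will carry the weight.\<close>

lemma isolating_radius:
  fixes Z' :: "complex set" and W :: "complex \<Rightarrow> real"
  assumes "finite Z'" "r1 < r'" "e > 0" "\<And>z. z \<in> Z' \<Longrightarrow> isCont W z"
  obtains \<rho> where "\<rho> > 0" "\<rho> < r' - r1"
    "\<And>z x. z \<in> Z' \<Longrightarrow> x \<in> Z' \<Longrightarrow> x \<noteq> z \<Longrightarrow> 2 * \<rho> < dist z x"
    "\<And>z x. z \<in> Z' \<Longrightarrow> dist z x < \<rho> \<Longrightarrow> \<bar>W x - W z\<bar> < e"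
    "\<And>z. z \<in> Z' \<Longrightarrow> cmod z \<le> r1 \<or> \<rho> < cmod z - r1"
proof -
  have small: "\<forall>\<^sub>F \<rho>::real in at_right 0. \<rho> < c" if "c > 0" for c
    using that by (auto simp: eventually_at_right_less eventually_at_right[of 0 1] intro!: exI[of _ c])
  have 1: "\<forall>\<^sub>F \<rho> in at_right 0. \<forall>z\<in>Z'. \<forall>x\<in>Z'. x \<noteq> z \<longrightarrow> 2 * \<rho> < dist z x"
  proof (intro eventually_ball_finite ballI assms(1))
    fix z x
    show "\<forall>\<^sub>F \<rho> in at_right 0. x \<noteq> z \<longrightarrow> 2 * \<rho> < dist z x"
      using small[of "dist z x / 2"] by (cases "x = z") (auto elim: eventually_mono)
  qed
  have 2: "\<forall>\<^sub>F \<rho> in at_right 0. \<forall>z\<in>Z'. \<forall>x. dist z x < \<rho> \<longrightarrow> \<bar>W x - W z\<bar> < e"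
  proof (intro eventually_ball_finite ballI assms(1))
    fix z assume "z \<in> Z'"
    then obtain d where d: "d > 0" "\<And>x. dist x z < d \<Longrightarrow> dist (W x) (W z) < e"
      using assms(3,4) unfolding continuous_at_eps_delta by blast
    show "\<forall>\<^sub>F \<rho> in at_right 0. \<forall>x. dist z x < \<rho> \<longrightarrow> \<bar>W x - W z\<bar> < e"
      using small[OF d(1)]
      by eventually_elim (use d(2) in \<open>force simp: dist_real_def dist_commute\<close>)
  qed
  have 3: "\<forall>\<^sub>F \<rho> in at_right 0. \<forall>z\<in>Z'. cmod z \<le> r1 \<or> \<rho> < cmod z - r1"
  proof (intro eventually_ball_finite ballI assms(1))
    fix z show "\<forall>\<^sub>F \<rho> in at_right 0. cmod z \<le> r1 \<or> \<rho> < cmod z - r1"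
      using small[of "cmod z - r1"] by (cases "cmod z \<le> r1") (auto elim: eventually_mono)
  qed
  have "\<forall>\<^sub>F \<rho> in at_right 0. \<rho> > 0 \<and> \<rho> < r' - r1 \<and> (\<forall>z\<in>Z'. \<forall>x\<in>Z'. x \<noteq> z \<longrightarrow> 2 * \<rho> < dist z x)
      \<and> (\<forall>z\<in>Z'. \<forall>x. dist z x < \<rho> \<longrightarrow> \<bar>W x - W z\<bar> < e) \<and> (\<forall>z\<in>Z'. cmod z \<le> r1 \<or> \<rho> < cmod z - r1)"
    by (intro eventually_conj 1 2 3 eventually_at_right_less small) (use assms(2) in simp)
  then obtain \<rho> where "\<rho> > 0 \<and> \<rho> < r' - r1 \<and> (\<forall>z\<in>Z'. \<forall>x\<in>Z'. x \<noteq> z \<longrightarrow> 2 * \<rho> < dist z x)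
      \<and> (\<forall>z\<in>Z'. \<forall>x. dist z x < \<rho> \<longrightarrow> \<bar>W x - W z\<bar> < e) \<and> (\<forall>z\<in>Z'. cmod z \<le> r1 \<or> \<rho> < cmod z - r1)"
    using eventually_happens'[OF trivial_limit_at_right_real] by blast
  then show ?thesis using that by blast
qed

text \<open>Hurwitz's theorem with weights. Near each zero of the limit function Rouche's theorem gives the right
number of zeros of the approximants, the weight hardly varies there, and elsewhere on the support of
the weight there are no zeros.\<close>

lemma weighted_zero_sum_tendsto:
  fixes W :: "complex \<Rightarrow> real"
  assumes r: "0 < r1" "r1 < r2"
    and hol: "\<And>n. G n holomorphic_on ball 0 r2" "g holomorphic_on ball 0 r2" and g0: "g 0 \<noteq> 0"
    and lim: "\<And>K. compact K \<Longrightarrow> K \<subseteq> ball 0 r2 \<Longrightarrow> uniform_limit K G g sequentially"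
    and W: "continuous_on (ball 0 r2) W" "\<And>z. W z \<noteq> 0 \<Longrightarrow> cmod z \<le> r1"
  shows "(\<lambda>n. weighted_zero_sum W (G n)) \<longlonglongrightarrow> weighted_zero_sum W g"
proof (rule tendstoI)
  fix e :: real assume e: "e > 0"
  define r' where "r' = (r1 + r2) / 2"
  have r': "r1 < r'" "r' < r2" using r by (auto simp: r'_def)
  define Z' where "Z' = {z \<in> cball 0 r'. g z = 0}"
  define Z where "Z = {z \<in> cball 0 r1. g z = 0}"
  have finZ': "finite Z'" unfolding Z'_def by (rule finite_zeros_disc[OF hol(2) g0 r'(2)])
  have finZ: "finite Z" unfolding Z_def by (rule finite_zeros_disc[OF hol(2) g0 r(2)])
  have ZZ': "Z \<subseteq> Z'" using r' by (auto simp: Z_def Z'_def)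
  define N where "N = (\<Sum>z\<in>Z. zorder g z)"
  have ordg: "zorder g z > 0" if "z \<in> Z" for z
    using that r by (intro zorder_pos_disc[OF hol(2) g0]) (auto simp: Z_def)
  then have N0: "N \<ge> 0" unfolding N_def by (intro sum_nonneg) (simp add: less_imp_le)
  define e' where "e' = e / (2 * (of_int N + 1))"
  have e': "e' > 0" using e N0 by (simp add: e'_def)
  have contW: "isCont W z" if "z \<in> Z'" for z
    using W(1) that r' by (auto simp: Z'_def continuous_on_eq_continuous_at)
  obtain \<rho> where \<rho>: "\<rho> > 0" "\<rho> < r' - r1"
    and sep: "\<And>z x. z \<in> Z' \<Longrightarrow> x \<in> Z' \<Longrightarrow> x \<noteq> z \<Longrightarrow> 2 * \<rho> < dist z x"
    and osc: "\<And>z x. z \<in> Z' \<Longrightarrow> dist z x < \<rho> \<Longrightarrow> \<bar>W x - W z\<bar> < e'"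
    and edge: "\<And>z. z \<in> Z' \<Longrightarrow> cmod z \<le> r1 \<or> \<rho> < cmod z - r1"
    using isolating_radius[OF finZ' r'(1) e' contW] by blast
  have near: "cmod x \<le> r'" if "z \<in> Z" "dist z x \<le> \<rho>" for x z
  proof -
    have "cmod x \<le> cmod z + dist z x" using norm_triangle_ineq2[of x z] by (simp add: dist_norm norm_minus_commute)
    then show ?thesis using that \<rho> by (auto simp: Z_def)
  qed
  \<comment> \<open>On this compact set, which contains the circles around the zeros in \<open>cball 0 r1\<close>, the limit function is bounded away from zero.\<close>
  define K where "K = cball 0 r' - (\<Union>z\<in>Z'. ball z \<rho>)"
  have K: "compact K" unfolding K_def by (intro compact_diff compact_cball open_UN ballI open_ball)
  have contg: "continuous_on K (\<lambda>z. cmod (g z))"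
    by (intro continuous_intros holomorphic_on_imp_continuous_on holomorphic_on_subset[OF hol(2)])
      (use r' in \<open>auto simp: K_def\<close>)
  have gK: "cmod (g z) > 0" if "z \<in> K" for z
    using that \<rho> by (auto simp: K_def Z'_def)
  obtain m where m: "m > 0" "\<And>z. z \<in> K \<Longrightarrow> m \<le> cmod (g z)"
  proof (cases "K = {}")
    case False
    then obtain z where "z \<in> K" "\<forall>y\<in>K. cmod (g z) \<le> cmod (g y)"
      using continuous_attains_inf[OF K False contg] by blast
    then show ?thesis using that[of "cmod (g z)"] gK by blast
  qed (use that[of 1] in auto)
  have sphere_K: "x \<in> K" if "z \<in> Z" "dist z x = \<rho>" for x z
  proof -
    have "x \<notin> ball y \<rho>" if y: "y \<in> Z'" for y
    proof (cases "y = z")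
      case False
      then have "2 * \<rho> < dist z y" using sep[of z y] y ZZ' \<open>z \<in> Z\<close> by auto
      also have "\<dots> \<le> dist z x + dist y x" by (rule dist_triangle2)
      finally show ?thesis using \<open>dist z x = \<rho>\<close> by auto
    qed (use \<open>dist z x = \<rho>\<close> in auto)
    then show ?thesis using near[of z x] that by (auto simp: K_def)
  qed
  have "uniform_limit (cball 0 r') G g sequentially"
    by (rule lim) (use r' in auto)
  then have "\<forall>\<^sub>F n in sequentially. \<forall>x\<in>cball 0 r'. dist (G n x) (g x) < min m (cmod (g 0))"
    using m g0 by (intro uniform_limitD) auto
  then show "\<forall>\<^sub>F n in sequentially. dist (weighted_zero_sum W (G n)) (weighted_zero_sum W g) < e"
  proof eventually_elim
    case (elim n)
    have G0: "G n 0 \<noteq> 0"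
      using elim[rule_format, of 0] r r' by (auto simp: dist_norm)
    define B where "B z = {x. x \<in> ball z \<rho> \<and> G n x = 0}" for z
    have finB: "finite (B z)" if "z \<in> Z" for z
      by (rule finite_subset[OF _ finite_zeros_disc[OF hol(1)[of n] G0 r'(2)]])
        (use near[OF that] in \<open>auto simp: B_def\<close>)
    have ord: "(\<Sum>x\<in>B z. zorder (G n) x) = zorder g z" if z: "z \<in> Z" for z
    proof -
      have "(\<Sum>x\<in>B z. zorder (G n) x) = (\<Sum>x | x \<in> ball z \<rho> \<and> g x = 0. zorder g x)"
        unfolding B_def
      proof (rule rouche_disc[OF hol(2) hol(1) g0 G0 \<rho>(1)])
        show "cmod z + \<rho> < r2" using z \<rho> r' by (auto simp: Z_def)
        fix x assume x: "dist z x = \<rho>"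
        have "cmod (G n x - g x) < m" using elim near[OF z, of x] x by (auto simp: dist_norm)
        then show "cmod (G n x - g x) < cmod (g x)" using m(2)[OF sphere_K[OF z x]] by linarith
      qed
      also have "{x. x \<in> ball z \<rho> \<and> g x = 0} = {z}"
      proof (intro equalityI subsetI)
        fix x assume x: "x \<in> {x. x \<in> ball z \<rho> \<and> g x = 0}"
        then have "x \<in> Z'" using near[OF z, of x] by (auto simp: Z'_def)
        then show "x \<in> {z}" using sep[of z x] z ZZ' x \<rho> by fastforce
      qed (use z \<rho> in \<open>auto simp: Z_def\<close>)
      finally show ?thesis by simp
    qed
    have ordG: "zorder (G n) x \<ge> 0" if "z \<in> Z" "x \<in> B z" for x z
      by (intro less_imp_le zorder_pos_disc[OF hol(1) G0]) (use near[of z x] that r' in \<open>auto simp: B_def\<close>)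
    have disj: "B z \<inter> B y = {}" if "z \<in> Z" "y \<in> Z" "z \<noteq> y" for z y
    proof -
      have "2 * \<rho> < dist z y" using that sep ZZ' by (metis subsetD)
      moreover have "dist z y < 2 * \<rho>" if "x \<in> B z" "x \<in> B y" for x
        using dist_triangle2[of z y x] that by (simp add: B_def)
      ultimately show ?thesis by fastforce
    qed
    have cover: "{z. W z \<noteq> 0 \<and> G n z = 0} \<subseteq> (\<Union>z\<in>Z. B z)"
    proof
      fix x assume "x \<in> {z. W z \<noteq> 0 \<and> G n z = 0}"
      then have x: "cmod x \<le> r1" "G n x = 0" using W(2) by auto
      have "x \<notin> K"
      proof
        assume xK: "x \<in> K"
        then have "m \<le> cmod (g x)" by (rule m(2))
        moreover have "dist (G n x) (g x) < m" using elim[rule_format, of x] x r' by simp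
        ultimately show False using x by (simp add: dist_norm)
      qed
      then obtain z where z: "z \<in> Z'" "dist z x < \<rho>" using x r' by (auto simp: K_def)
      have "cmod z \<le> cmod x + dist z x" using norm_triangle_ineq2[of z x] by (simp add: dist_norm)
      then have "cmod z \<le> r1" using edge[OF z(1)] z x by linarith
      then have "z \<in> Z" using z by (auto simp: Z_def Z'_def)
      then show "x \<in> (\<Union>z\<in>Z. B z)" using z x by (auto simp: B_def)
    qed
    have "weighted_zero_sum W (G n) = (\<Sum>x\<in>(\<Union>z\<in>Z. B z). of_int (zorder (G n) x) * W x)"
      unfolding weighted_zero_sum_def
      by (rule sum.mono_neutral_left[OF _ cover]) (use finZ finB in \<open>auto simp: B_def\<close>)
    also have "\<dots> = (\<Sum>z\<in>Z. \<Sum>x\<in>B z. of_int (zorder (G n) x) * W x)"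
      by (rule sum.UNION_disjoint) (use finZ finB disj in auto)
    finally have 1: "weighted_zero_sum W (G n) = \<dots>" .
    have "weighted_zero_sum W g = (\<Sum>z\<in>Z. of_int (zorder g z) * W z)"
      unfolding weighted_zero_sum_def
      by (rule sum.mono_neutral_left[OF finZ]) (use W(2) in \<open>auto simp: Z_def\<close>)
    also have "\<dots> = (\<Sum>z\<in>Z. \<Sum>x\<in>B z. of_int (zorder (G n) x) * W z)"
      by (rule sum.cong) (simp_all add: ord[symmetric] sum_distrib_right)
    finally have "weighted_zero_sum W (G n) - weighted_zero_sum W g
        = (\<Sum>z\<in>Z. \<Sum>x\<in>B z. of_int (zorder (G n) x) * (W x - W z))"
      unfolding 1 by (simp add: sum_subtractf[symmetric] right_diff_distrib)
    also have "\<bar>\<dots>\<bar> \<le> (\<Sum>z\<in>Z. \<Sum>x\<in>B z. of_int (zorder (G n) x) * e')"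
    proof (intro order_trans[OF sum_abs] sum_mono)
      fix z x assume z: "z \<in> Z" and x: "x \<in> B z"
      have "\<bar>W x - W z\<bar> \<le> e'" using osc[of z x] z ZZ' x by (auto simp: B_def less_imp_le)
      then show "\<bar>of_int (zorder (G n) x) * (W x - W z)\<bar> \<le> of_int (zorder (G n) x) * e'"
        using ordG[OF z x] by (simp add: abs_mult mult_left_mono)
    qed
    also have "\<dots> = of_int N * e'"
      unfolding N_def by (simp add: sum_distrib_right[symmetric] ord of_int_sum[symmetric] del: of_int_sum)
    also have "\<dots> < e" using e N0 by (simp add: e'_def field_simps) (smt (verit) mult_nonneg_nonneg of_int_0_le_iff)
    finally show ?case by (simp add: dist_real_def)
  qed
qed

text \<open>By Montel's theorem the functions bounded by \<open>M\<close> form a relatively compact family. The lower bound at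
the origin keeps the limits from vanishing identically, so that the sequential continuity from
Hurwitz's theorem becomes uniform on the family.\<close>

lemma weighted_zero_sum_uniformly_continuous:
  fixes W :: "complex \<Rightarrow> real"
  assumes r: "0 < r1" "r1 < r2" and c: "c > 0" and e: "e > 0"
    and W: "continuous_on (ball 0 r2) W" "\<And>z. W z \<noteq> 0 \<Longrightarrow> cmod z \<le> r1"
  obtains \<delta> where "\<delta> > 0"
    "\<And>g h. g holomorphic_on ball 0 r2 \<Longrightarrow> h holomorphic_on ball 0 r2 \<Longrightarrow>
      (\<And>z. z \<in> ball 0 r2 \<Longrightarrow> cmod (g z) \<le> M) \<Longrightarrow> (\<And>z. z \<in> ball 0 r2 \<Longrightarrow> cmod (h z) \<le> M) \<Longrightarrow>
      c \<le> cmod (g 0) \<Longrightarrow> c \<le> cmod (h 0) \<Longrightarrow> (\<And>z. z \<in> ball 0 r2 \<Longrightarrow> cmod (g z - h z) \<le> \<delta>) \<Longrightarrow>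
      \<bar>weighted_zero_sum W g - weighted_zero_sum W h\<bar> \<le> e"
proof (rule ccontr)
  note obtained = that
  assume "\<not> thesis"
  define ok where "ok \<delta> g h \<longleftrightarrow> g holomorphic_on ball 0 r2 \<and> h holomorphic_on ball 0 r2 \<and>
      (\<forall>z\<in>ball 0 r2. cmod (g z) \<le> M) \<and> (\<forall>z\<in>ball 0 r2. cmod (h z) \<le> M) \<and>
      c \<le> cmod (g 0) \<and> c \<le> cmod (h 0) \<and> (\<forall>z\<in>ball 0 r2. cmod (g z - h z) \<le> \<delta>)" for \<delta> g h
  have "\<exists>g h. ok \<delta> g h \<and> \<bar>weighted_zero_sum W g - weighted_zero_sum W h\<bar> > e" if "\<delta> > 0" for \<delta>
  proof (rule ccontr)
    assume "\<nexists>g h. ok \<delta> g h \<and> \<bar>weighted_zero_sum W g - weighted_zero_sum W h\<bar> > e"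
    then have "\<And>g h. ok \<delta> g h \<Longrightarrow> \<bar>weighted_zero_sum W g - weighted_zero_sum W h\<bar> \<le> e"
      by (meson not_le)
    then show False using \<open>\<not> thesis\<close> obtained[OF that] unfolding ok_def by blast
  qed
  then have "\<forall>n. \<exists>g h. ok (inverse (real (Suc n))) g h \<and> \<bar>weighted_zero_sum W g - weighted_zero_sum W h\<bar> > e"
    by simp
  then obtain g h where gh: "\<And>n. ok (inverse (real (Suc n))) (g n) (h n)"
    and far: "\<And>n. \<bar>weighted_zero_sum W (g n) - weighted_zero_sum W (h n)\<bar> > e"
    by metis
  define \<H> where "\<H> = {f. f holomorphic_on ball 0 r2 \<and> (\<forall>z\<in>ball 0 r2. cmod (f z) \<le> M)}"
  have H_hol: "\<And>f. f \<in> \<H> \<Longrightarrow> f holomorphic_on ball 0 r2" by (auto simp: \<H>_def)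
  have H_bdd: "\<And>K. compact K \<Longrightarrow> K \<subseteq> ball 0 r2 \<Longrightarrow> \<exists>B. \<forall>f\<in>\<H>. \<forall>z\<in>K. cmod (f z) \<le> B"
    unfolding \<H>_def by (intro exI[of _ M]) blast
  have H_rng: "range g \<subseteq> \<H>" using gh by (auto simp: \<H>_def ok_def)
  obtain G s where G: "G holomorphic_on ball 0 r2" "strict_mono (s::nat \<Rightarrow> nat)"
      and pw: "\<And>x. x \<in> ball 0 r2 \<Longrightarrow> (\<lambda>n. g (s n) x) \<longlonglongrightarrow> G x"
      and ul: "\<And>K. compact K \<Longrightarrow> K \<subseteq> ball 0 r2 \<Longrightarrow> uniform_limit K (g \<circ> s) G sequentially"
    using Montel[OF open_ball H_hol H_bdd H_rng] by blast
  have "c \<le> cmod (G 0)"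
    by (rule tendsto_lowerbound[OF tendsto_norm[OF pw[of 0]]]) (use r gh in \<open>auto simp: ok_def\<close>)
  then have G0: "G 0 \<noteq> 0" using c by auto
  have ulh: "uniform_limit K (h \<circ> s) G sequentially" if K: "compact K" "K \<subseteq> ball 0 r2" for K
  proof (rule uniform_limitI)
    fix d :: real assume d: "d > 0"
    have "\<forall>\<^sub>F n in sequentially. \<forall>x\<in>K. dist ((g \<circ> s) n x) (G x) < d / 2"
      using uniform_limitD[OF ul[OF K], of "d/2"] d by simp
    moreover have "\<forall>\<^sub>F n in sequentially. inverse (real (Suc n)) < d / 2"
      using d LIMSEQ_inverse_real_of_nat[THEN order_tendstoD(2), of "d/2"] by simp
    ultimately show "\<forall>\<^sub>F n in sequentially. \<forall>x\<in>K. dist ((h \<circ> s) n x) (G x) < d"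
    proof eventually_elim
      case (elim n)
      show ?case
      proof
        fix x assume x: "x \<in> K"
        have "dist (g (s n) x) (h (s n) x) \<le> inverse (real (Suc (s n)))"
          using gh[of "s n"] x K by (auto simp: ok_def dist_norm)
        also have "\<dots> \<le> inverse (real (Suc n))"
          using strict_mono_imp_increasing[OF G(2), of n] by (intro le_imp_inverse_le) auto
        finally show "dist ((h \<circ> s) n x) (G x) < d"
          using elim x dist_triangle3[of "h (s n) x" "G x" "g (s n) x"] by fastforce
      qed
    qed
  qed
  have hol: "(g \<circ> s) n holomorphic_on ball 0 r2" "(h \<circ> s) n holomorphic_on ball 0 r2" for n
    using gh by (auto simp: ok_def)
  have lims: "(\<lambda>n. weighted_zero_sum W ((g \<circ> s) n)) \<longlonglongrightarrow> weighted_zero_sum W G"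
    by (rule weighted_zero_sum_tendsto[OF r hol(1) G(1) G0 ul W])
  have limsh: "(\<lambda>n. weighted_zero_sum W ((h \<circ> s) n)) \<longlonglongrightarrow> weighted_zero_sum W G"
    by (rule weighted_zero_sum_tendsto[OF r hol(2) G(1) G0 ulh W])
  have "(\<lambda>n. \<bar>weighted_zero_sum W ((g \<circ> s) n) - weighted_zero_sum W ((h \<circ> s) n)\<bar>) \<longlonglongrightarrow> \<bar>weighted_zero_sum W G - weighted_zero_sum W G\<bar>"
    by (intro tendsto_intros lims limsh)
  then have "e \<le> \<bar>weighted_zero_sum W G - weighted_zero_sum W G\<bar>"
    by (rule tendsto_lowerbound) (use far in \<open>auto intro!: always_eventually less_imp_le\<close>)
  then show False using e by simp
qed

lemma weighted_zero_sum_le: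
  fixes W :: "complex \<Rightarrow> real"
  assumes g: "g holomorphic_on ball 0 1" "g 0 \<noteq> 0" and r: "r1 < \<rho>" "0 < \<rho>" "\<rho> < 1"
    and W: "\<And>z. W z \<noteq> 0 \<Longrightarrow> cmod z \<le> r1" "\<And>z. W z \<ge> 0"
      "\<And>z. W z \<noteq> 0 \<Longrightarrow> z \<noteq> 0 \<Longrightarrow> W z \<le> K * ln (\<rho> / cmod z)" and K: "K \<ge> 0"
  shows "0 \<le> weighted_zero_sum W g" "weighted_zero_sum W g \<le> K * ln (circle_mean \<rho> g / cmod (g 0))"
proof -
  let ?Z = "{z. W z \<noteq> 0 \<and> g z = 0}"
  have fin: "finite ?Z"
    by (rule finite_subset[OF _ finite_zeros_disc[OF g, of r1]]) (use r W in auto)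
  have ord: "zorder g z > 0" if "z \<in> ?Z" for z
    using that W(1)[of z] r by (intro zorder_pos_disc[OF g]) auto
  show "0 \<le> weighted_zero_sum W g"
    unfolding weighted_zero_sum_def by (intro sum_nonneg mult_nonneg_nonneg W(2)) (use ord in \<open>auto simp: less_imp_le\<close>)
  have "weighted_zero_sum W g \<le> (\<Sum>z\<in>?Z. K * (of_int (zorder g z) * ln (\<rho> / cmod z)))"
    unfolding weighted_zero_sum_def
  proof (rule sum_mono)
    fix z assume z: "z \<in> ?Z"
    then have "z \<noteq> 0" using g by auto
    then have "of_int (zorder g z) * W z \<le> of_int (zorder g z) * (K * ln (\<rho> / cmod z))"
      using z ord[OF z] by (intro mult_left_mono W) auto
    then show "of_int (zorder g z) * W z \<le> K * (of_int (zorder g z) * ln (\<rho> / cmod z))" by (simp add: mult_ac)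
  qed
  also have "\<dots> \<le> K * ln (circle_mean \<rho> g / cmod (g 0))"
    unfolding sum_distrib_left[symmetric]
    by (intro mult_left_mono jensen_inequality[OF fin g] K r) (use W(1) r in force)
  finally show "weighted_zero_sum W g \<le> K * ln (circle_mean \<rho> g / cmod (g 0))" .
qed

text \<open>The parameter will be the time along a translate, and the character of a twisted polynomial.\<close>

lemma continuous_on_weighted_zero_sum:
  fixes W :: "complex \<Rightarrow> real" and g :: "'x::topological_space \<Rightarrow> complex \<Rightarrow> complex"
  assumes r: "0 < r1" "r1 < r2"
    and W: "continuous_on (ball 0 r2) W" "\<And>z. W z \<noteq> 0 \<Longrightarrow> cmod z \<le> r1"
    and cont: "continuous_on (X \<times> cball 0 r2) (\<lambda>(x, z). g x z)"
    and hol: "\<And>x. x \<in> X \<Longrightarrow> g x holomorphic_on ball 0 r2" and nz: "\<And>x. x \<in> X \<Longrightarrow> g x 0 \<noteq> 0"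
  shows "continuous_on X (\<lambda>x. weighted_zero_sum W (g x))"
  unfolding continuous_on_def
proof (intro ballI tendstoI)
  fix x0 and e :: real assume x0: "x0 \<in> X" and e: "e > 0"
  have "continuous_on (cball 0 r2) (\<lambda>z. g x0 z)"
    by (rule continuous_on_compose2[OF cont, of _ "\<lambda>z. (x0, z)", simplified])
       (use x0 in \<open>auto intro!: continuous_intros\<close>)
  then have "bounded (g x0 ` cball 0 r2)"
    by (intro compact_imp_bounded compact_continuous_image) auto
  then obtain M where M: "\<And>z. z \<in> cball 0 r2 \<Longrightarrow> cmod (g x0 z) \<le> M"
    unfolding bounded_iff by (metis image_eqI)
  define c where "c = cmod (g x0 0) / 2"
  have c: "c > 0" using nz[OF x0] by (simp add: c_def)
  obtain \<delta> where \<delta>: "\<delta> > 0" and close: "\<And>g h. g holomorphic_on ball 0 r2 \<Longrightarrow> h holomorphic_on ball 0 r2 \<Longrightarrow>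
      (\<And>z. z \<in> ball 0 r2 \<Longrightarrow> cmod (g z) \<le> M + 1) \<Longrightarrow> (\<And>z. z \<in> ball 0 r2 \<Longrightarrow> cmod (h z) \<le> M + 1) \<Longrightarrow>
      c \<le> cmod (g 0) \<Longrightarrow> c \<le> cmod (h 0) \<Longrightarrow> (\<And>z. z \<in> ball 0 r2 \<Longrightarrow> cmod (g z - h z) \<le> \<delta>) \<Longrightarrow>
      \<bar>weighted_zero_sum W g - weighted_zero_sum W h\<bar> \<le> e / 2"
    using weighted_zero_sum_uniformly_continuous[OF r c half_gt_zero[OF e] W, of "M + 1"] by metis
  obtain X0 where X0: "x0 \<in> X0" "open X0"
    "\<forall>x\<in>X0 \<inter> X. \<forall>z\<in>cball 0 r2. dist (case (x, z) of (x, z) \<Rightarrow> g x z) (case (x0, z) of (x, z) \<Rightarrow> g x z) \<le> min \<delta> (min 1 c)"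
    by (rule continuous_on_prod_compactE[OF cont compact_cball x0, of "min \<delta> (min 1 c)"]) (use \<delta> c in auto)
  have "\<forall>\<^sub>F x in at x0 within X. x \<in> X0 \<inter> X"
    using X0(1,2) by (auto simp: eventually_at_topological)
  then show "\<forall>\<^sub>F x in at x0 within X. dist (weighted_zero_sum W (g x)) (weighted_zero_sum W (g x0)) < e"
  proof eventually_elim
    case (elim x)
    have d: "cmod (g x z - g x0 z) \<le> \<delta>" "cmod (g x z - g x0 z) \<le> 1" "cmod (g x z - g x0 z) \<le> c" if "z \<in> cball 0 r2" for z
      using X0(3) elim that by (auto simp: dist_norm)
    have "\<bar>weighted_zero_sum W (g x) - weighted_zero_sum W (g x0)\<bar> \<le> e / 2"
    proof (rule close)
      show "cmod (g x z) \<le> M + 1" if "z \<in> ball 0 r2" for z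
        using d(2)[of z] M[of z] that norm_triangle_sub[of "g x z" "g x0 z"] by simp
      show "cmod (g x0 z) \<le> M + 1" if "z \<in> ball 0 r2" for z
        using M[of z] that by simp
      show "c \<le> cmod (g x 0)"
        using d(3)[of 0] r norm_triangle_ineq2[of "g x0 0" "g x 0"] by (simp add: c_def norm_minus_commute)
      show "c \<le> cmod (g x0 0)" by (simp add: c_def)
      show "cmod (g x z - g x0 z) \<le> \<delta>" if "z \<in> ball 0 r2" for z using d(1)[of z] that by simp
    qed (use hol x0 elim in auto)
    then show ?case using e by (simp add: dist_real_def)
  qed
qed

lemma continuous_on_circle_mean:
  fixes g :: "'x::topological_space \<Rightarrow> complex \<Rightarrow> complex"
  assumes cont: "continuous_on (X \<times> cball 0 r) (\<lambda>(x, z). g x z)" and r: "r \<ge> 0"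
  shows "continuous_on X (\<lambda>x. circle_mean r (g x))"
proof -
  have "continuous_on (X \<times> cbox 0 (2*pi)) (\<lambda>y. case (fst y, of_real r * cis (snd y)) of (x, z) \<Rightarrow> g x z)"
    by (rule continuous_on_compose2[OF cont]) (use r in \<open>auto intro!: continuous_intros simp: norm_mult\<close>)
  then have "continuous_on (X \<times> cbox 0 (2*pi)) (\<lambda>(x, \<theta>). cmod (g x (of_real r * cis \<theta>)))"
    by (simp add: case_prod_beta continuous_on_norm)
  then have "continuous_on X (\<lambda>x. integral (cbox 0 (2*pi)) (\<lambda>\<theta>. cmod (g x (of_real r * cis \<theta>))))"
    by (rule integral_continuous_on_param)
  then show ?thesis unfolding circle_mean_def by (auto intro!: continuous_intros)
qed

text \<open>The pointwise inequality that is integrated over vertical translates. If the circle means of \<open>g\<close> and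
\<open>h\<close> are moderate and the difference is small, uniform continuity applies. Otherwise the two sums are
estimated separately: they grow like the logarithm of the circle mean, hence their square is at most
linear in it, and Chebyshev's trick makes the exceptional translates contribute little. The bound
\<open>\<alpha> + \<beta> B \<le> e\<close> says that the right-hand side has average at most \<open>e + \<gamma> \<epsilon>\<close> as soon as the circle means
have average at most \<open>B\<close>.\<close>

lemma weighted_zero_sum_comparison:
  fixes W :: "complex \<Rightarrow> real"
  assumes r: "0 < r0" "r0 \<le> r1" "r1 < \<rho>" "\<rho> < 1"
    and W: "continuous_on (ball 0 1) W" "\<And>z. W z \<noteq> 0 \<Longrightarrow> cmod z \<le> r1" "\<And>z. W z \<ge> 0"
      "\<And>z. W z \<noteq> 0 \<Longrightarrow> z \<noteq> 0 \<Longrightarrow> W z \<le> K * ln (\<rho> / cmod z)" and K: "K \<ge> 0"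
    and c: "c > 0" and B: "B \<ge> 0" and e: "e > 0"
  obtains \<alpha> \<beta> \<gamma> where "\<beta> \<ge> 0" "\<gamma> \<ge> 0" "\<alpha> + \<beta> * B \<le> e"
    "\<And>g h \<epsilon>. g holomorphic_on ball 0 1 \<Longrightarrow> h holomorphic_on ball 0 1 \<Longrightarrow> c \<le> cmod (g 0) \<Longrightarrow> c \<le> cmod (h 0) \<Longrightarrow>
      (\<And>z. cmod z \<le> r0 \<Longrightarrow> cmod (g z - h z) \<le> \<epsilon>) \<Longrightarrow>
      \<bar>weighted_zero_sum W g - weighted_zero_sum W h\<bar> \<le> \<alpha> + \<beta> * (circle_mean \<rho> g + circle_mean \<rho> h) + \<gamma> * \<epsilon>"
proof -
  define r2 where "r2 = (r1 + \<rho>) / 2"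
  have \<rho>0: "0 < \<rho>" using r by linarith
  have r2: "r1 < r2" "r2 < \<rho>" "0 < r2" "r0 \<le> r2" using r by (auto simp: r2_def)
  define q where "q = 1 - r2 / \<rho>"
  have q: "q > 0" using r r2 by (simp add: q_def)
  define K1 where "K1 = 8 * K\<^sup>2 / c"
  have K1: "K1 \<ge> 0" using c by (simp add: K1_def)
  \<comment> \<open>Three contributions, each at most \<open>e / 3\<close>: the uniform continuity error, large circle means (\<open>M1\<close>), large differences (\<open>J\<close>).\<close>
  define e1 where "e1 = e / (3 * (1 + K1 * B))"
  have KB: "1 + K1 * B > 0" using K1 B by (simp add: add_pos_nonneg)
  have e1: "e1 > 0" "e1 + e1 * K1 * B = e / 3"
  proof -
    show "e1 > 0" using e KB by (simp add: e1_def)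
    have "e1 * (1 + K1 * B) = e / 3" using KB by (simp add: e1_def del: distrib_left_numeral)
    then show "e1 + e1 * K1 * B = e / 3" by (simp add: algebra_simps)
  qed
  define M1 where "M1 = 3 * (B + 1) / (e * e1)"
  have M1: "M1 > 0" "B / (e1 * M1) \<le> e / 3"
    using B e e1(1) by (simp_all add: M1_def field_simps add_pos_nonneg)
  have Wr2: "continuous_on (ball 0 r2) W"
    using W(1) by (rule continuous_on_subset) (use r r2 in auto)
  obtain \<delta> where \<delta>: "\<delta> > 0" and close: "\<And>g h. g holomorphic_on ball 0 r2 \<Longrightarrow> h holomorphic_on ball 0 r2 \<Longrightarrow>
      (\<And>z. z \<in> ball 0 r2 \<Longrightarrow> cmod (g z) \<le> M1 / q) \<Longrightarrow> (\<And>z. z \<in> ball 0 r2 \<Longrightarrow> cmod (h z) \<le> M1 / q) \<Longrightarrow>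
      c \<le> cmod (g 0) \<Longrightarrow> c \<le> cmod (h 0) \<Longrightarrow> (\<And>z. z \<in> ball 0 r2 \<Longrightarrow> cmod (g z - h z) \<le> \<delta>) \<Longrightarrow>
      \<bar>weighted_zero_sum W g - weighted_zero_sum W h\<bar> \<le> e1"
    using weighted_zero_sum_uniformly_continuous[OF order_less_le_trans[OF r(1,2)] r2(1) c e1(1) Wr2 W(2), of "M1 / q"] by metis
  have "(\<lambda>J. (r2/\<rho>) ^ J) \<longlonglongrightarrow> 0"
    using r r2 by (intro LIMSEQ_realpow_zero) auto
  then have "\<forall>\<^sub>F J in sequentially. (r2/\<rho>) ^ J < e * e1 * \<delta> / (3 * (B + 1)) * q"
    using e e1 \<delta> q B by (intro order_tendstoD(2)) auto
  then obtain J where J: "(r2/\<rho>) ^ J < e * e1 * \<delta> / (3 * (B + 1)) * q"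
    using eventually_sequentially by auto
  define \<eta> where "\<eta> = (r2/\<rho>) ^ J / q"
  have \<eta>: "\<eta> \<ge> 0" using r r2 q by (simp add: \<eta>_def)
  have \<eta>B: "\<eta> * B / (e1 * \<delta>) \<le> e / 3"
  proof -
    have "\<eta> \<le> e * e1 * \<delta> / (3 * (B + 1))" using J q by (simp only: \<eta>_def pos_divide_le_eq less_imp_le)
    then have "\<eta> * B \<le> e * e1 * \<delta> / (3 * (B + 1)) * (B + 1)" using B \<eta> e e1 \<delta> by (intro mult_mono) auto
    also have "\<dots> = e / 3 * (e1 * \<delta>)" using B by (simp add: field_simps)
    finally show ?thesis using e1 \<delta> by (simp add: divide_le_eq)
  qed
  define S where "S = (\<Sum>j<J. (r2/r0) ^ j)"
  have S: "S \<ge> 0" unfolding S_def using r r2 by (intro sum_nonneg) auto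
  define \<beta> where "\<beta> = e1 * K1 + 1 / (e1 * M1) + \<eta> / (e1 * \<delta>)"
  define \<gamma> where "\<gamma> = S / (e1 * \<delta>)"
  show ?thesis
  proof (rule that[of \<beta> \<gamma> e1])
    show "\<beta> \<ge> 0" "\<gamma> \<ge> 0" using e1 K1 M1 \<eta> \<delta> S by (auto simp: \<beta>_def \<gamma>_def)
    have "e1 + \<beta> * B = (e1 + e1 * K1 * B) + B / (e1 * M1) + \<eta> * B / (e1 * \<delta>)"
      by (simp add: \<beta>_def algebra_simps)
    then show "e1 + \<beta> * B \<le> e" using e1 M1 \<eta>B by simp
    fix g h \<epsilon>
    assume gh: "g holomorphic_on ball 0 1" "h holomorphic_on ball 0 1" "c \<le> cmod (g 0)" "c \<le> cmod (h 0)"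
      and small: "\<And>z. cmod z \<le> r0 \<Longrightarrow> cmod (g z - h z) \<le> \<epsilon>"
    let ?A = "circle_mean \<rho>" and ?\<Phi> = "weighted_zero_sum W"
    define b where "b = ?A g + ?A h"
    have cont: "continuous_on (cball 0 \<rho>) f" and holr: "f holomorphic_on ball 0 \<rho>"
      and holr2: "f holomorphic_on ball 0 r2" if "f holomorphic_on ball 0 1" for f
      using that r r2 by (auto intro!: holomorphic_on_imp_continuous_on elim!: holomorphic_on_subset)
    have A: "?A f \<ge> 0" if "f holomorphic_on ball 0 1" for f
      using cont[OF that] r by (intro circle_mean_nonneg) auto
    have \<epsilon>: "\<epsilon> \<ge> 0" using small[of 0] r by (simp add: order_trans[OF norm_ge_zero])
    have sq: "(?\<Phi> f)\<^sup>2 \<le> 4 * K\<^sup>2 / c * ?A f \<and> ?\<Phi> f \<ge> 0" if f: "f holomorphic_on ball 0 1" "c \<le> cmod (f 0)" for f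
    proof -
      have f0: "f 0 \<noteq> 0" "cmod (f 0) > 0" using f c by auto
      have fA: "cmod (f 0) \<le> ?A f" using mean_value_le_circle_mean[OF cont[OF f(1)] holr[OF f(1)]] r by simp
      note \<Phi> = weighted_zero_sum_le[OF f(1) f0(1) r(3) \<rho>0 r(4) W(2-4) K]
      have A0: "?A f > 0" using fA f0(2) by linarith
      then have x0: "?A f / c > 0" using c by simp
      have "ln (?A f / cmod (f 0)) \<le> ln (?A f / c)"
        using A0 f0 c f(2) by (subst ln_le_cancel_iff) (auto intro!: divide_left_mono mult_pos_pos)
      also have "\<dots> = 2 * ln (sqrt (?A f / c))"
        using x0 by (simp add: ln_sqrt)
      also have "\<dots> \<le> 2 * sqrt (?A f / c)"
        using ln_le_minus_one[of "sqrt (?A f / c)"] x0 by simp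
      finally have "K * ln (?A f / cmod (f 0)) \<le> K * (2 * sqrt (?A f / c))"
        using K by (rule mult_left_mono)
      then have "?\<Phi> f \<le> K * (2 * sqrt (?A f / c))" using \<Phi>(2) by (rule order_trans[rotated])
      moreover have "?\<Phi> f \<ge> 0" by (rule \<Phi>(1))
      ultimately have "(?\<Phi> f)\<^sup>2 \<le> (K * (2 * sqrt (?A f / c)))\<^sup>2" by (intro power_mono)
      also have "\<dots> = 4 * K\<^sup>2 / c * ?A f" using x0 by (simp add: power_mult_distrib)
      finally show ?thesis using \<open>?\<Phi> f \<ge> 0\<close> by simp
    qed
    define \<psi> where "\<psi> = ?\<Phi> g + ?\<Phi> h"
    have abs_le: "\<bar>?\<Phi> g - ?\<Phi> h\<bar> \<le> \<psi>" using sq[OF gh(1,3)] sq[OF gh(2,4)] by (auto simp: \<psi>_def)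
    have "\<psi>\<^sup>2 \<le> 2 * ((?\<Phi> g)\<^sup>2 + (?\<Phi> h)\<^sup>2)"
      using zero_le_power2[of "?\<Phi> g - ?\<Phi> h"] by (simp add: \<psi>_def power2_eq_square algebra_simps)
    also have "\<dots> \<le> 2 * (4 * K\<^sup>2 / c * ?A g + 4 * K\<^sup>2 / c * ?A h)"
      using sq[OF gh(1,3)] sq[OF gh(2,4)] by simp
    also have "\<dots> = K1 * b" by (simp add: K1_def b_def algebra_simps add_divide_distrib)
    finally have \<psi>2: "\<psi>\<^sup>2 \<le> K1 * b" .
    \<comment> \<open>Young: on the exceptional set \<open>\<psi>\<close> is traded for its square and a multiple of the indicator function.\<close>
    have "2 * (e1 * \<psi>) \<le> e1 * (e1 * \<psi>\<^sup>2) + 1"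
      using zero_le_power2[of "e1 * \<psi> - 1"] by (simp add: power2_eq_square algebra_simps)
    moreover have "0 \<le> e1 * \<psi>" using e1(1) abs_le by simp
    ultimately have "e1 * \<psi> \<le> e1 * (e1 * \<psi>\<^sup>2 + 1 / e1)" using e1(1) by (simp add: distrib_left)
    then have "\<psi> \<le> e1 * \<psi>\<^sup>2 + 1 / e1" using e1(1) by simp
    also have "\<dots> \<le> e1 * (K1 * b) + 1 / e1" using \<psi>2 e1 by simp
    finally have \<psi>: "\<psi> \<le> e1 * K1 * b + 1 / e1" by simp
    define x where "x = \<epsilon> * S + b * \<eta>"
    have b0: "b \<ge> 0" using A gh by (simp add: b_def)
    have x0: "x \<ge> 0" using \<epsilon> S b0 \<eta> by (simp add: x_def)
    have diff: "cmod (g z - h z) \<le> x" if "cmod z \<le> r2" for z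
    proof -
      have "cmod (g z - h z) \<le> \<epsilon> * (\<Sum>j<J. (r2/r0) ^ j) + ?A (\<lambda>z. g z - h z) * ((r2/\<rho>) ^ J / (1 - r2/\<rho>))"
        by (rule two_constants_circle_mean[where g = "\<lambda>z. g z - h z"])
          (use r r2 that small gh in \<open>auto intro!: continuous_intros holomorphic_intros cont holr\<close>)
      also have "\<dots> \<le> \<epsilon> * S + b * \<eta>"
        unfolding S_def[symmetric] b_def \<eta>_def q_def
        by (intro add_left_mono mult_right_mono circle_mean_diff_le cont gh) (use r r2 in auto)
      finally show ?thesis by (simp add: x_def)
    qed
    have le: "\<bar>?\<Phi> g - ?\<Phi> h\<bar> \<le> e1 + e1 * K1 * b + (1 / e1) * (b / M1 + x / \<delta>)"
    proof (cases "b \<le> M1 \<and> x \<le> \<delta>")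
      case True
      have sup: "cmod (f z) \<le> M1 / q" if "f holomorphic_on ball 0 1" "?A f \<le> b" "z \<in> ball 0 r2" for f z
      proof -
        have "cmod (f z) \<le> ?A f / (1 - r2/\<rho>)"
          by (rule norm_le_circle_mean[OF cont holr]) (use that r2 in auto)
        also have "\<dots> \<le> M1 / q" unfolding q_def[symmetric] using that True q by (intro divide_right_mono) auto
        finally show ?thesis .
      qed
      have "\<bar>?\<Phi> g - ?\<Phi> h\<bar> \<le> e1"
        by (rule close[OF holr2[OF gh(1)] holr2[OF gh(2)] sup[OF gh(1)] sup[OF gh(2)] gh(3,4) order_trans[OF diff]])
          (use True A[OF gh(1)] A[OF gh(2)] in \<open>auto simp: b_def\<close>)
      then show ?thesis using e1 K1 b0 x0 M1 \<delta> by (simp add: add_increasing2)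
    next
      case False
      have "1 \<le> b / M1 + x / \<delta>"
      proof (cases "b \<le> M1")
        case True
        then have "1 \<le> x / \<delta>" using False \<delta> by simp
        then show ?thesis using b0 M1 by (simp add: add_increasing)
      next
        case False
        then have "1 \<le> b / M1" using M1 by simp
        then show ?thesis using x0 \<delta> by (simp add: add_increasing2)
      qed
      then have "(1 / e1) * 1 \<le> (1 / e1) * (b / M1 + x / \<delta>)" using e1 by (intro mult_left_mono) auto
      then show ?thesis using abs_le \<psi> e1 by linarith
    qed
    also have "\<dots> = e1 + \<beta> * b + \<gamma> * \<epsilon>"
      by (simp add: \<beta>_def \<gamma>_def x_def algebra_simps add_divide_distrib)
    finally show "\<bar>?\<Phi> g - ?\<Phi> h\<bar> \<le> e1 + \<beta> * (?A g + ?A h) + \<gamma> * \<epsilon>" by (simp add: b_def)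
  qed
qed

section \<open>From the half-plane to the disc\<close>

definition cayley :: "real \<Rightarrow> complex \<Rightarrow> complex" where
  "cayley d z = of_real d * (1 + z) / (1 - z)"

definition inv_cayley :: "real \<Rightarrow> complex \<Rightarrow> complex" where
  "inv_cayley d s = (s - of_real d) / (s + of_real d)"

lemma Re_cayley: "Re (cayley d z) = d * (1 - (cmod z)\<^sup>2) / (cmod (1 - z))\<^sup>2"
proof -
  have "Re (cayley d z) = d * Re ((1 + z) * cnj (1 - z)) / (cmod (1 - z))\<^sup>2"
    unfolding cayley_def by (subst complex_div_cnj) (simp add: Re_divide_of_real algebra_simps)
  also have "Re ((1 + z) * cnj (1 - z)) = 1 - (cmod z)\<^sup>2"
    using cmod_power2[of z] by (simp add: power2_eq_square algebra_simps)
  finally show ?thesis .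
qed

lemma Re_cayley_pos:
  assumes "d > 0" "cmod z < 1" shows "Re (cayley d z) > 0"
proof -
  have "(cmod z)\<^sup>2 < 1" using power_strict_mono[of "cmod z" 1 2] assms by simp
  moreover have "1 - z \<noteq> 0" using assms by auto
  ultimately show ?thesis unfolding Re_cayley using assms by simp
qed

lemma cayley_in_half_plane: "d > 0 \<Longrightarrow> cmod z < 1 \<Longrightarrow> cayley d z + \<i> * of_real t \<in> half_plane 0"
  using Re_cayley_pos by (simp add: half_plane_def)

lemma norm_less_1_of_Re_cayley:
  assumes "d > 0" "Re (cayley d z) > 0" shows "cmod z < 1"
proof (rule ccontr)
  assume "\<not> cmod z < 1"
  then have "1 \<le> (cmod z)\<^sup>2" by (simp add: one_le_power)
  then have "Re (cayley d z) \<le> 0"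
    unfolding Re_cayley using assms by (intro divide_nonpos_nonneg mult_nonneg_nonpos) auto
  then show False using assms by simp
qed

text \<open>The distance to the unit circle is comparable to the distance to the imaginary axis, with constants
that do not deteriorate near the axis. This is what makes the limit \<open>\<sigma>\<^sub>0 \<down> 0\<close> finite.\<close>

lemma one_minus_norm_square_cayley:
  assumes "d > 0" "cmod z < 1"
  shows "1 - (cmod z)\<^sup>2 = 4 * d * Re (cayley d z) / (cmod (cayley d z + of_real d))\<^sup>2"
proof -
  have nz: "1 - z \<noteq> 0" using assms by auto
  then have "cayley d z + of_real d = of_real (2 * d) / (1 - z)"
    by (simp add: cayley_def field_simps)
  then have "(cmod (cayley d z + of_real d))\<^sup>2 = 4 * d\<^sup>2 / (cmod (1 - z))\<^sup>2"
    using assms by (simp add: norm_divide power_divide power_mult_distrib norm_mult)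
  then show ?thesis using assms nz unfolding Re_cayley by (simp add: field_simps power2_eq_square)
qed

lemma cayley_inv_cayley:
  assumes "d > 0" "Re s > 0" shows "cayley d (inv_cayley d s) = s" "cmod (inv_cayley d s) < 1"
proof -
  have nz: "s + of_real d \<noteq> 0" using assms by (auto simp: complex_eq_iff)
  have "1 + inv_cayley d s = 2 * s / (s + of_real d)" "1 - inv_cayley d s = 2 * of_real d / (s + of_real d)"
    using nz by (simp_all add: inv_cayley_def field_simps)
  then show eq: "cayley d (inv_cayley d s) = s" using assms nz by (simp add: cayley_def)
  show "cmod (inv_cayley d s) < 1"
    by (rule norm_less_1_of_Re_cayley[OF assms(1)]) (use eq assms in simp)
qed

lemma inv_cayley_cayley:
  assumes "d > 0" "cmod z < 1" shows "inv_cayley d (cayley d z) = z"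
proof -
  have nz: "1 - z \<noteq> 0" using assms by auto
  then have "cayley d z + of_real d = 2 * of_real d / (1 - z)" "cayley d z - of_real d = 2 * of_real d * z / (1 - z)"
    by (simp_all add: cayley_def field_simps)
  then show ?thesis using assms nz by (simp add: inv_cayley_def)
qed

lemma cayley_0 [simp]: "cayley d 0 = of_real d"
  by (simp add: cayley_def)

lemma holomorphic_cayley: "cayley d holomorphic_on ball 0 1"
  unfolding cayley_def by (intro holomorphic_intros) auto

lemma continuous_on_cayley: "A \<subseteq> ball 0 1 \<Longrightarrow> continuous_on A (cayley d)"
  using holomorphic_on_imp_continuous_on[OF holomorphic_cayley] continuous_on_subset by blast

lemma norm_cayley_le:
  assumes "d > 0" "cmod z \<le> r" "r < 1" shows "cmod (cayley d z) \<le> 2 * d / (1 - r)"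
proof -
  have "cmod (1 + z) \<le> 2" using norm_triangle_ineq[of 1 z] assms by simp
  moreover have "1 - r \<le> cmod (1 - z)" using norm_triangle_ineq2[of 1 z] assms by simp
  ultimately show ?thesis unfolding cayley_def norm_mult norm_divide using assms
    by (intro frac_le) (auto intro: mult_nonneg_nonneg)
qed

lemma Re_cayley_ge_2:
  assumes "d \<ge> 3" "cmod z \<le> 1/5" shows "Re (cayley d z) \<ge> 2"
proof -
  \<comment> \<open>The numbers fit exactly: \<open>3 (1 - 1/25) / (6/5)\<^sup>2 = 2\<close>.\<close>
  have a: "cmod (1 - z) \<le> 6/5" using norm_triangle_ineq4[of 1 z] assms by simp
  have nz: "1 - z \<noteq> 0" using assms by auto
  have "(cmod (1 - z))\<^sup>2 \<le> (6/5)\<^sup>2" using a by (intro power_mono) auto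
  moreover have "(cmod z)\<^sup>2 \<le> (1/5)\<^sup>2" using assms by (intro power_mono) auto
  moreover have "3 * (1 - (cmod z)\<^sup>2) \<le> d * (1 - (cmod z)\<^sup>2)"
    using assms calculation by (intro mult_right_mono) (auto simp: power2_eq_square)
  ultimately show ?thesis unfolding Re_cayley using nz by (simp add: le_divide_eq power2_eq_square)
qed

definition pulled_back :: "(complex \<Rightarrow> complex) \<Rightarrow> real \<Rightarrow> complex \<Rightarrow> real \<Rightarrow> complex \<Rightarrow> complex" where
  "pulled_back F d \<zeta> t z = F (cayley d z + \<i> * of_real t) - \<zeta>"

lemma holomorphic_pulled_back:
  assumes "F holomorphic_on half_plane 0" "d > 0"
  shows "pulled_back F d \<zeta> t holomorphic_on ball 0 1"
proof -
  have "(\<lambda>z. cayley d z + \<i> * of_real t) holomorphic_on ball 0 1"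
    by (intro holomorphic_intros holomorphic_cayley)
  then have "(F \<circ> (\<lambda>z. cayley d z + \<i> * of_real t)) holomorphic_on ball 0 1"
    by (rule holomorphic_on_compose_gen[OF _ assms(1)]) (use assms cayley_in_half_plane in auto)
  then show ?thesis unfolding pulled_back_def o_def by (intro holomorphic_intros)
qed

lemma continuous_on_pulled_back:
  assumes "F holomorphic_on half_plane 0" "d > 0" "r < 1"
  shows "continuous_on (X \<times> cball 0 r) (\<lambda>(t, z). pulled_back F d \<zeta> t z)"
proof -
  have c: "continuous_on (X \<times> cball 0 r) (\<lambda>y. cayley d (snd y))"
    by (rule continuous_on_compose2[OF continuous_on_cayley[OF subset_refl]]) (use assms in \<open>auto intro!: continuous_intros\<close>)
  have "continuous_on (X \<times> cball 0 r) (\<lambda>y. F (cayley d (snd y) + \<i> * of_real (fst y)))"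
    by (rule continuous_on_compose2[OF holomorphic_on_imp_continuous_on[OF assms(1)]])
      (use assms cayley_in_half_plane in \<open>auto intro!: continuous_intros c\<close>)
  then show ?thesis unfolding pulled_back_def case_prod_beta by (intro continuous_intros)
qed

lemma open_half_plane: "open (half_plane \<kappa>)"
  unfolding half_plane_def by (rule open_halfspace_Re_gt)

lemma connected_half_plane: "connected (half_plane \<kappa>)"
  unfolding half_plane_def by (intro convex_connected convex_halfspace_Re_gt)

text \<open>The Cayley transform is conformal, hence preserves multiplicities.\<close>

lemma zorder_pulled_back:
  assumes F: "F holomorphic_on half_plane 0" and d: "d > 0" and z: "cmod z < 1"
    and nz: "c \<in> half_plane 0" "F c \<noteq> \<zeta>"
  shows "zorder (pulled_back F d \<zeta> t) z = zorder (\<lambda>w. F w - \<zeta>) (cayley d z + \<i> * of_real t)"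
proof -
  define G where "G = (\<lambda>w. F w - \<zeta>)"
  define k where "k z = cayley d z + \<i> * of_real t" for z
  have kz: "k z \<in> half_plane 0" unfolding k_def by (rule cayley_in_half_plane[OF d z])
  have Gh: "G holomorphic_on half_plane 0" unfolding G_def by (intro holomorphic_intros F)
  have Ga: "G analytic_on {k z}" using Gh kz open_half_plane analytic_at by blast
  have ev: "\<forall>\<^sub>F w in at (k z). G w \<noteq> 0"
    by (rule eventually_nonzero_at[OF Gh open_half_plane connected_half_plane kz nz(1)]) (use nz in \<open>simp add: G_def\<close>)
  have kh: "k holomorphic_on ball 0 1" unfolding k_def by (intro holomorphic_intros holomorphic_cayley)
  have ka: "k analytic_on {z}" using kh z analytic_at[of k z] by (auto intro!: exI[of _ "ball 0 1"])
  have inj: "k w \<noteq> k z" if "w \<noteq> z" "cmod w < 1" for w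
    using that z inv_cayley_cayley[OF d] unfolding k_def by (metis add_right_cancel)
  have evk: "\<forall>\<^sub>F w in at z. k w \<noteq> k z"
    using eventually_at_in_open'[of "ball 0 1" z] z by (auto simp: eventually_at_filter elim!: eventually_mono dest: inj)
  have nzz: "1 - z \<noteq> 0" using z by auto
  have "(k has_field_derivative (2 * of_real d / (1 - z)\<^sup>2)) (at z)"
    unfolding k_def cayley_def using nzz
    by (auto intro!: derivative_eq_intros simp: field_simps power2_eq_square)
  then have dk: "deriv k z \<noteq> 0" using d nzz by (simp add: DERIV_imp_deriv)
  have "zorder (G \<circ> k) z = zorder G (k z) * zorder (\<lambda>x. k x - k z) z"
    by (rule zorder_compose'[OF isolated_singularity_at_analytic[OF Ga] not_essential_analytic[OF Ga] ka ev evk])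
  also have "zorder (\<lambda>x. k x - k z) z = 1"
  proof (rule zorder_zero_eqI'[where n = 1, simplified])
    show "(\<lambda>x. k x - k z) analytic_on {z}" using ka by (intro analytic_intros)
    have "deriv (\<lambda>x. k x - k z) z = deriv k z"
      using ka by (subst deriv_diff) (auto intro: analytic_on_imp_differentiable_at)
    then show "deriv (\<lambda>x. k x - k z) z \<noteq> 0" using dk by simp
  qed simp
  finally show ?thesis by (simp add: G_def k_def o_def pulled_back_def[abs_def])
qed

section \<open>Counting zeros through windows of height two\<close>

definition tent :: "real \<Rightarrow> real" where
  "tent y = max 0 (1 - \<bar>y\<bar>)"

text \<open>The middle factor makes the support compact; it equals one for \<open>Re s \<le> d\<close>, where all zeros under
consideration lie. The last factor is a window that slides along the vertical line.\<close>

definition strip_weight :: "real \<Rightarrow> real \<Rightarrow> complex \<Rightarrow> real" where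
  "strip_weight \<sigma> d s = max 0 (Re s - \<sigma>) * max 0 (min 1 (d + 1 - Re s)) * tent (Im s)"

definition disc_weight :: "real \<Rightarrow> real \<Rightarrow> complex \<Rightarrow> real" where
  "disc_weight \<sigma> d z = strip_weight \<sigma> d (cayley d z)"

lemma strip_weight_nonneg: "strip_weight \<sigma> d s \<ge> 0"
  by (simp add: strip_weight_def tent_def)

lemma strip_weight_nonzero:
  "strip_weight \<sigma> d s \<noteq> 0 \<Longrightarrow> \<sigma> < Re s \<and> Re s < d + 1 \<and> \<bar>Im s\<bar> < 1"
  by (auto simp: strip_weight_def tent_def max_def min_def split: if_splits)

lemma strip_weight_le:
  assumes "\<sigma> > 0" "Re s > 0" shows "strip_weight \<sigma> d s \<le> Re s"
proof -
  have "strip_weight \<sigma> d s \<le> Re s * 1 * 1"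
    unfolding strip_weight_def using assms by (intro mult_mono) (auto simp: tent_def)
  then show ?thesis by simp
qed

lemma continuous_on_disc_weight: "continuous_on (ball 0 1) (disc_weight \<sigma> d)"
  unfolding disc_weight_def strip_weight_def tent_def
  by (intro continuous_intros continuous_on_cayley subset_refl)

text \<open>The square \<open>(2 d + 1)\<^sup>2 + 1\<close> bounds the squared modulus of \<open>s + d\<close> on the support of the weight. What matters is
that the constant does not involve \<open>\<sigma>\<close>.\<close>

definition jensen_constant :: "real \<Rightarrow> real" where
  "jensen_constant d = ((2 * d + 1)\<^sup>2 + 1) / d"

lemma disc_weight_bound:
  assumes \<sigma>: "\<sigma> > 0" and d: "d > 0" and W: "disc_weight \<sigma> d z \<noteq> 0"
  shows "cmod z < 1" "Re (cayley d z) \<le> jensen_constant d / 4 * (1 - (cmod z)\<^sup>2)"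
proof -
  define s where "s = cayley d z"
  have s: "\<sigma> < Re s" "Re s < d + 1" "\<bar>Im s\<bar> < 1"
    using strip_weight_nonzero[of \<sigma> d s] W by (auto simp: disc_weight_def s_def)
  show z: "cmod z < 1" using s \<sigma> norm_less_1_of_Re_cayley[OF d, of z] by (auto simp: s_def)
  have "(Re s + d)\<^sup>2 \<le> (2 * d + 1)\<^sup>2" using s \<sigma> d by (intro power_mono) auto
  moreover have "(Im s)\<^sup>2 \<le> 1" using s(3) by (simp add: abs_square_le_1)
  ultimately have le: "(cmod (s + of_real d))\<^sup>2 \<le> (2 * d + 1)\<^sup>2 + 1" by (simp add: cmod_power2)
  have nz: "cmod (s + of_real d) > 0" using s \<sigma> d by (auto simp: complex_eq_iff)
  have "4 * d * Re s / ((2 * d + 1)\<^sup>2 + 1) \<le> 1 - (cmod z)\<^sup>2"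
    unfolding one_minus_norm_square_cayley[OF d z] s_def[symmetric]
    using le nz s \<sigma> d by (intro divide_left_mono) (auto intro!: mult_pos_pos add_nonneg_pos)
  then have "Re s * (4 * d) \<le> ((2 * d + 1)\<^sup>2 + 1) * (1 - (cmod z)\<^sup>2)"
    by (subst (asm) pos_divide_le_eq) (auto intro: add_nonneg_pos simp: mult_ac)
  then have "Re s \<le> ((2 * d + 1)\<^sup>2 + 1) * (1 - (cmod z)\<^sup>2) / (4 * d)"
    using d by (simp add: pos_le_divide_eq)
  then show "Re (cayley d z) \<le> jensen_constant d / 4 * (1 - (cmod z)\<^sup>2)"
    by (simp add: s_def[symmetric] jensen_constant_def)
qed

text \<open>Only the radii depend on \<open>\<sigma>\<close>: taking \<open>\<rho>\<close> very close to one costs at most half of the lower bound for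
\<open>ln (1 / cmod z)\<close>.\<close>

lemma disc_weight_radii:
  assumes \<sigma>: "\<sigma> > 0" and d: "d > 0"
  obtains r1 \<rho> where "1/5 \<le> r1" "r1 < \<rho>" "\<rho> < 1"
    "\<And>z. disc_weight \<sigma> d z \<noteq> 0 \<Longrightarrow> cmod z \<le> r1"
    "\<And>z. disc_weight \<sigma> d z \<noteq> 0 \<Longrightarrow> z \<noteq> 0 \<Longrightarrow> disc_weight \<sigma> d z \<le> jensen_constant d * ln (\<rho> / cmod z)"
proof -
  define K where "K = jensen_constant d"
  have K: "K > 0" using d by (auto simp: K_def jensen_constant_def intro!: divide_pos_pos add_nonneg_pos)
  \<comment> \<open>The lower bound \<open>1/4\<close> keeps \<open>r1\<close> above the radius \<open>1/5\<close> of the disc on which series are compared.\<close>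
  define q where "q = max (1/4) (1 - 4 * \<sigma> / K)"
  have q: "1/4 \<le> q" "q < 1" using \<sigma> K by (auto simp: q_def)
  define r1 where "r1 = sqrt q"
  define \<rho> where "\<rho> = exp (- (1 - q) / 4)"
  have r1: "r1 > 0" "r1\<^sup>2 = q" using q by (auto simp: r1_def)
  have ln_le: "ln x \<le> (x\<^sup>2 - 1) / 2" if "x > 0" for x :: real
    using ln_le_minus_one[of "x\<^sup>2"] that by (simp add: ln_realpow)
  have sq: "(cmod z)\<^sup>2 \<le> q" if "disc_weight \<sigma> d z \<noteq> 0" for z
  proof -
    have "\<sigma> \<le> K / 4 * (1 - (cmod z)\<^sup>2)"
      using disc_weight_bound(2)[OF \<sigma> d that] strip_weight_nonzero[of \<sigma> d "cayley d z"] that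
      by (auto simp: disc_weight_def K_def)
    then have "(cmod z)\<^sup>2 \<le> 1 - 4 * \<sigma> / K" using K by (simp add: field_simps)
    then show ?thesis by (simp add: q_def)
  qed
  show ?thesis
  proof (rule that[of r1 \<rho>])
    have "(1/5)\<^sup>2 \<le> q" using q by (simp add: power2_eq_square)
    then show "1/5 \<le> r1" unfolding r1_def by (intro real_le_rsqrt)
    have "ln r1 < - (1 - q) / 4" using ln_le[OF r1(1)] r1 q by simp
    then show "r1 < \<rho>" unfolding \<rho>_def using r1 by (metis exp_less_cancel_iff exp_ln)
    show "\<rho> < 1" using q by (simp add: \<rho>_def)
    show "cmod z \<le> r1" if "disc_weight \<sigma> d z \<noteq> 0" for z
      unfolding r1_def using sq[OF that] by (intro real_le_rsqrt)
    show "disc_weight \<sigma> d z \<le> jensen_constant d * ln (\<rho> / cmod z)" if W: "disc_weight \<sigma> d z \<noteq> 0" and z: "z \<noteq> 0" for z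
    proof -
      note b = disc_weight_bound[OF \<sigma> d W]
      have "disc_weight \<sigma> d z \<le> Re (cayley d z)"
        unfolding disc_weight_def by (rule strip_weight_le[OF \<sigma> Re_cayley_pos[OF d b(1)]])
      also have "\<dots> \<le> K * ((1 - (cmod z)\<^sup>2) / 4)" using b(2) by (simp add: K_def)
      also have "\<dots> \<le> K * ln (\<rho> / cmod z)"
      proof (intro mult_left_mono)
        have "ln (\<rho> / cmod z) = - (1 - q) / 4 - ln (cmod z)" using z by (simp add: ln_div \<rho>_def)
        moreover have "ln (cmod z) \<le> ((cmod z)\<^sup>2 - 1) / 2" using ln_le[of "cmod z"] z by simp
        ultimately show "(1 - (cmod z)\<^sup>2) / 4 \<le> ln (\<rho> / cmod z)"
          using sq[OF W] by argo
      qed (use K in simp)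
      finally show ?thesis by (simp add: K_def)
    qed
  qed
qed

text \<open>The Cayley transform matches the zeros in the disc with those in the half-plane.\<close>

lemma weighted_zero_sum_pulled_back:
  assumes F: "F holomorphic_on half_plane 0" and d: "d > 0" and \<sigma>: "\<sigma> > 0"
    and nz: "c \<in> half_plane 0" "F c \<noteq> \<zeta>"
  shows "weighted_zero_sum (disc_weight \<sigma> d) (pulled_back F d \<zeta> t) =
    (\<Sum>s | strip_weight \<sigma> d (s - \<i> * of_real t) \<noteq> 0 \<and> F s - \<zeta> = 0.
        of_int (zorder (\<lambda>w. F w - \<zeta>) s) * strip_weight \<sigma> d (s - \<i> * of_real t))"
  unfolding weighted_zero_sum_def
proof (rule sum.reindex_bij_witness[where i = "\<lambda>s. inv_cayley d (s - \<i> * of_real t)" and j = "\<lambda>z. cayley d z + \<i> * of_real t"])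
  fix z assume z: "z \<in> {z. disc_weight \<sigma> d z \<noteq> 0 \<and> pulled_back F d \<zeta> t z = 0}"
  then have z1: "cmod z < 1" using disc_weight_bound(1)[OF \<sigma> d] by auto
  show "inv_cayley d (cayley d z + \<i> * of_real t - \<i> * of_real t) = z" using inv_cayley_cayley[OF d z1] by simp
  show "cayley d z + \<i> * of_real t \<in> {s. strip_weight \<sigma> d (s - \<i> * of_real t) \<noteq> 0 \<and> F s - \<zeta> = 0}"
    using z by (simp add: disc_weight_def pulled_back_def)
  show "of_int (zorder (\<lambda>w. F w - \<zeta>) (cayley d z + \<i> * of_real t)) * strip_weight \<sigma> d (cayley d z + \<i> * of_real t - \<i> * of_real t)
      = of_int (zorder (pulled_back F d \<zeta> t) z) * disc_weight \<sigma> d z"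
    using zorder_pulled_back[OF F d z1 nz] by (simp add: disc_weight_def)
next
  fix s assume s: "s \<in> {s. strip_weight \<sigma> d (s - \<i> * of_real t) \<noteq> 0 \<and> F s - \<zeta> = 0}"
  then have "Re (s - \<i> * of_real t) > 0" using strip_weight_nonzero[of \<sigma> d "s - \<i> * of_real t"] \<sigma> by auto
  note ci = cayley_inv_cayley[OF d this]
  show "cayley d (inv_cayley d (s - \<i> * of_real t)) + \<i> * of_real t = s" using ci by simp
  show "inv_cayley d (s - \<i> * of_real t) \<in> {z. disc_weight \<sigma> d z \<noteq> 0 \<and> pulled_back F d \<zeta> t z = 0}"
    using s ci by (simp add: disc_weight_def pulled_back_def)
qed

lemma continuous_on_tent: "continuous_on A f \<Longrightarrow> continuous_on A (\<lambda>x. tent (f x))"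
  unfolding tent_def by (intro continuous_intros)

lemma tent_has_integral: "((\<lambda>t. tent (y - t)) has_integral 1) {y - 1..y + 1}"
proof -
  have 1: "((\<lambda>t. 1 - y + t) has_integral ((1 - y) * y + y\<^sup>2 / 2 - ((1 - y) * (y - 1) + (y - 1)\<^sup>2 / 2))) {y - 1..y}"
    by (rule fundamental_theorem_of_calculus)
      (auto intro!: derivative_eq_intros simp: has_real_derivative_iff_has_vector_derivative[symmetric])
  have 2: "((\<lambda>t. 1 + y - t) has_integral ((1 + y) * (y + 1) - (y + 1)\<^sup>2 / 2 - ((1 + y) * y - y\<^sup>2 / 2))) {y..y + 1}"
    by (rule fundamental_theorem_of_calculus)
      (auto intro!: derivative_eq_intros simp: has_real_derivative_iff_has_vector_derivative[symmetric])
  have "((\<lambda>t. tent (y - t)) has_integral (1/2)) {y - 1..y}"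
    using has_integral_eq[OF _ 1, of "\<lambda>t. tent (y - t)"] by (auto simp: tent_def power2_eq_square algebra_simps add_divide_distrib diff_divide_distrib)
  moreover have "((\<lambda>t. tent (y - t)) has_integral (1/2)) {y..y + 1}"
    using has_integral_eq[OF _ 2, of "\<lambda>t. tent (y - t)"] by (auto simp: tent_def power2_eq_square algebra_simps add_divide_distrib diff_divide_distrib)
  ultimately have "((\<lambda>t. tent (y - t)) has_integral (1/2 + 1/2)) {y - 1..y + 1}"
    by (intro has_integral_combine[of _ y]) auto
  then show ?thesis by simp
qed

lemma integrable_tent: "(\<lambda>t. tent (y - t)) integrable_on {a..b}"
  by (intro integrable_continuous_interval continuous_on_tent continuous_intros)

lemma tent_nonneg: "tent y \<ge> 0"
  by (simp add: tent_def)

lemma integral_tent_eq_1: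
  assumes "\<bar>y\<bar> \<le> T - 1" shows "integral {-T..T} (\<lambda>t. tent (y - t)) = 1"
  by (rule integral_unique, rule has_integral_on_superset[OF tent_has_integral[of y]])
    (use assms in \<open>auto simp: tent_def\<close>)

lemma integral_tent_le_1: "integral {-T..T} (\<lambda>t. tent (y - t)) \<le> 1"
proof -
  have "integral {-T..T} (\<lambda>t. tent (y - t)) \<le> integral {-(\<bar>T\<bar> + \<bar>y\<bar> + 1)..\<bar>T\<bar> + \<bar>y\<bar> + 1} (\<lambda>t. tent (y - t))"
    by (intro integral_subset_le integrable_tent) (auto simp: tent_nonneg)
  also have "\<dots> = 1" by (rule integral_tent_eq_1) simp
  finally show ?thesis .
qed

lemma finite_counting_zeros:
  assumes F: "F holomorphic_on half_plane 0" and far: "\<And>s. Re s \<ge> d \<Longrightarrow> F s \<noteq> \<zeta>" and \<sigma>: "\<sigma> > 0"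
  shows "finite (counting_zeros F \<zeta> \<sigma> T)"
proof (cases "counting_zeros F \<zeta> \<sigma> T = {}")
  case False
  then obtain s0 where s0: "s0 \<in> half_plane 0" "F s0 - \<zeta> = 0" by (auto simp: counting_zeros_def)
  have c: "of_real (max d 1) \<in> half_plane 0" "F (of_real (max d 1)) - \<zeta> \<noteq> 0"
    using far[of "of_real (max d 1)"] by (auto simp: half_plane_def)
  have nc: "\<not> (\<lambda>w. F w - \<zeta>) constant_on half_plane 0"
    using s0 c unfolding constant_on_def by metis
  have hol: "(\<lambda>w. F w - \<zeta>) holomorphic_on half_plane 0" by (intro holomorphic_intros F)
  let ?K = "cbox (Complex \<sigma> (- T)) (Complex d T)"
  have "finite {z \<in> ?K. F z - \<zeta> = 0}"
    by (rule holomorphic_compact_finite_zeros[OF hol open_half_plane connected_half_plane compact_cbox _ nc])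
      (use \<sigma> in \<open>auto simp: in_cbox_complex_iff half_plane_def\<close>)
  moreover have "counting_zeros F \<zeta> \<sigma> T \<subseteq> {z \<in> ?K. F z - \<zeta> = 0}"
  proof
    fix s assume s: "s \<in> counting_zeros F \<zeta> \<sigma> T"
    then have "Re s < d" using far[of s] by (force simp: counting_zeros_def)
    then show "s \<in> {z \<in> ?K. F z - \<zeta> = 0}" using s by (auto simp: counting_zeros_def in_cbox_complex_iff)
  qed
  ultimately show ?thesis by (rule finite_subset[rotated])
qed simp

lemma zorder_nonneg_half_plane:
  assumes F: "F holomorphic_on half_plane 0" and nz: "c \<in> half_plane 0" "F c \<noteq> \<zeta>" and s: "s \<in> half_plane 0"
  shows "zorder (\<lambda>w. F w - \<zeta>) s \<ge> 0"
proof -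
  have hol: "(\<lambda>w. F w - \<zeta>) holomorphic_on half_plane 0" by (intro holomorphic_intros F)
  have ex: "\<exists>w\<in>half_plane 0. F w - \<zeta> \<noteq> 0" using nz by auto
  show ?thesis
    using conjunct1[OF zorder_exist_zero[OF hol open_half_plane connected_half_plane s ex]]
    by (simp split: if_splits)
qed

text \<open>Integrating over the position of the window gives each zero its weight \<open>Re s - \<sigma>\<close> times the time
during which the window sees it.\<close>

lemma integral_weighted_zero_sum:
  assumes F: "F holomorphic_on half_plane 0" and d: "d > 0" and \<sigma>: "\<sigma> > 0"
    and far: "\<And>s. Re s \<ge> d \<Longrightarrow> F s \<noteq> \<zeta>" and U: "U \<ge> T + 1"
  shows "integral {-T..T} (\<lambda>t. weighted_zero_sum (disc_weight \<sigma> d) (pulled_back F d \<zeta> t)) =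
    (\<Sum>s\<in>counting_zeros F \<zeta> \<sigma> U. of_int (zorder (\<lambda>w. F w - \<zeta>) s) * (Re s - \<sigma>) * integral {-T..T} (\<lambda>t. tent (Im s - t)))"
proof -
  let ?Z = "counting_zeros F \<zeta> \<sigma> U" and ?o = "\<lambda>s. of_int (zorder (\<lambda>w. F w - \<zeta>) s) :: real"
  have fin: "finite ?Z" by (rule finite_counting_zeros[OF F far \<sigma>])
  have nz: "of_real d \<in> half_plane 0" "F (of_real d) \<noteq> \<zeta>" using d far[of "of_real d"] by (auto simp: half_plane_def)
  have "weighted_zero_sum (disc_weight \<sigma> d) (pulled_back F d \<zeta> t) = (\<Sum>s\<in>?Z. ?o s * (Re s - \<sigma>) * tent (Im s - t))"
    if t: "t \<in> {-T..T}" for t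
  proof -
    have "weighted_zero_sum (disc_weight \<sigma> d) (pulled_back F d \<zeta> t) = (\<Sum>s\<in>?Z. ?o s * strip_weight \<sigma> d (s - \<i> * of_real t))"
      unfolding weighted_zero_sum_pulled_back[OF F d \<sigma> nz]
    proof (rule sum.mono_neutral_left[OF fin])
      show "{s. strip_weight \<sigma> d (s - \<i> * of_real t) \<noteq> 0 \<and> F s - \<zeta> = 0} \<subseteq> ?Z"
      proof
        fix s assume s: "s \<in> {s. strip_weight \<sigma> d (s - \<i> * of_real t) \<noteq> 0 \<and> F s - \<zeta> = 0}"
        then have "\<sigma> < Re s" "\<bar>Im s - t\<bar> < 1" using strip_weight_nonzero[of \<sigma> d "s - \<i> * of_real t"] by auto
        then show "s \<in> ?Z" using s t U \<sigma> by (auto simp: counting_zeros_def half_plane_def)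
      qed
    qed (auto simp: counting_zeros_def)
    also have "\<dots> = (\<Sum>s\<in>?Z. ?o s * (Re s - \<sigma>) * tent (Im s - t))"
    proof (rule sum.cong)
      fix s assume s: "s \<in> ?Z"
      then have "Re s < d" "\<sigma> < Re s" using far[of s] by (force simp: counting_zeros_def)+
      then show "?o s * strip_weight \<sigma> d (s - \<i> * of_real t) = ?o s * (Re s - \<sigma>) * tent (Im s - t)"
        by (simp add: strip_weight_def)
    qed simp
    finally show ?thesis .
  qed
  then have "integral {-T..T} (\<lambda>t. weighted_zero_sum (disc_weight \<sigma> d) (pulled_back F d \<zeta> t))
      = integral {-T..T} (\<lambda>t. \<Sum>s\<in>?Z. ?o s * (Re s - \<sigma>) * tent (Im s - t))"
    by (intro integral_cong) auto
  also have "\<dots> = (\<Sum>s\<in>?Z. integral {-T..T} (\<lambda>t. ?o s * (Re s - \<sigma>) * tent (Im s - t)))"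
    by (intro integral_sum fin integrable_on_mult_right integrable_tent)
  also have "\<dots> = (\<Sum>s\<in>?Z. ?o s * (Re s - \<sigma>) * integral {-T..T} (\<lambda>t. tent (Im s - t)))"
    by (intro sum.cong refl integral_mult_right)
  finally show ?thesis .
qed

text \<open>The window has integral one, so the integral over \<open>{-T..T}\<close> lies between the sums over zeros of
height below \<open>T - 1\<close> and below \<open>T + 1\<close>. The boundary layers disappear in the limit by monotonicity
alone, without any bound on the number of zeros in them.\<close>

lemma zero_average_tendsto:
  assumes F: "F holomorphic_on half_plane 0" and d: "d > 0" and \<sigma>: "\<sigma> > 0"
    and far: "\<And>s. Re s \<ge> d \<Longrightarrow> F s \<noteq> \<zeta>"
    and lim: "((\<lambda>T. 1 / (2 * T) * integral {-T..T} (\<lambda>t. weighted_zero_sum (disc_weight \<sigma> d) (pulled_back F d \<zeta> t))) \<longlongrightarrow> L) at_top"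
  shows "((\<lambda>T. zero_average F \<zeta> \<sigma> T) \<longlongrightarrow> 2 * pi * L) at_top"
proof -
  define u where "u T = 1 / (2 * T) * integral {-T..T} (\<lambda>t. weighted_zero_sum (disc_weight \<sigma> d) (pulled_back F d \<zeta> t))" for T
  let ?o = "\<lambda>s. of_int (zorder (\<lambda>w. F w - \<zeta>) s) :: real" and ?Z = "counting_zeros F \<zeta> \<sigma>"
  have nz: "of_real d \<in> half_plane 0" "F (of_real d) \<noteq> \<zeta>" using d far[of "of_real d"] by (auto simp: half_plane_def)
  have term0: "?o s * (Re s - \<sigma>) \<ge> 0" if "s \<in> ?Z T" for s T
    using that zorder_nonneg_half_plane[OF F nz, of s] by (auto simp: counting_zeros_def)
  have int: "integral {-T..T} (\<lambda>t. weighted_zero_sum (disc_weight \<sigma> d) (pulled_back F d \<zeta> t)) = 2 * T * u T" if "T > 0" for T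
    using that by (simp add: u_def)
  have upper: "zero_average F \<zeta> \<sigma> T \<le> 2 * pi * ((T + 1) / T * u (T + 1))" if T: "T > 0" for T
  proof -
    have "(\<Sum>s\<in>?Z T. ?o s * (Re s - \<sigma>)) = (\<Sum>s\<in>?Z T. ?o s * (Re s - \<sigma>) * integral {-(T+1)..T+1} (\<lambda>t. tent (Im s - t)))"
    proof (rule sum.cong)
      fix s assume "s \<in> ?Z T"
      then show "?o s * (Re s - \<sigma>) = ?o s * (Re s - \<sigma>) * integral {-(T+1)..T+1} (\<lambda>t. tent (Im s - t))"
        by (subst integral_tent_eq_1) (auto simp: counting_zeros_def)
    qed simp
    also have "\<dots> \<le> (\<Sum>s\<in>?Z (T + 2). ?o s * (Re s - \<sigma>) * integral {-(T+1)..T+1} (\<lambda>t. tent (Im s - t)))"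
      by (intro sum_mono2 finite_counting_zeros[OF F far \<sigma>] mult_nonneg_nonneg[OF term0] integral_nonneg integrable_tent tent_nonneg)
        (auto simp: counting_zeros_def)
    also have "\<dots> = 2 * (T + 1) * u (T + 1)"
      using integral_weighted_zero_sum[OF F d \<sigma> far, of "T + 1" "T + 2"] int[of "T + 1"] T by simp
    finally have "pi / T * (\<Sum>s\<in>?Z T. ?o s * (Re s - \<sigma>)) \<le> pi / T * (2 * (T + 1) * u (T + 1))"
      using T by (intro mult_left_mono) auto
    moreover have "pi / T * (2 * (T + 1) * u (T + 1)) = 2 * pi * ((T + 1) / T * u (T + 1))"
      by (simp add: mult.assoc mult.left_commute)
    ultimately show ?thesis unfolding zero_average_def by linarith
  qed
  have lower: "2 * pi * ((T - 1) / T * u (T - 1)) \<le> zero_average F \<zeta> \<sigma> T" if T: "T > 1" for T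
  proof -
    have "2 * (T - 1) * u (T - 1) = (\<Sum>s\<in>?Z T. ?o s * (Re s - \<sigma>) * integral {-(T-1)..T-1} (\<lambda>t. tent (Im s - t)))"
      using integral_weighted_zero_sum[OF F d \<sigma> far, of "T - 1" T] int[of "T - 1"] T by simp
    also have "\<dots> \<le> (\<Sum>s\<in>?Z T. ?o s * (Re s - \<sigma>) * 1)"
      by (intro sum_mono mult_left_mono[OF integral_tent_le_1] term0)
    finally have "pi / T * (2 * (T - 1) * u (T - 1)) \<le> pi / T * (\<Sum>s\<in>?Z T. ?o s * (Re s - \<sigma>) * 1)"
      using T by (intro mult_left_mono) auto
    moreover have "pi / T * (2 * (T - 1) * u (T - 1)) = 2 * pi * ((T - 1) / T * u (T - 1))"
      by (simp add: mult.assoc mult.left_commute)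
    ultimately show ?thesis unfolding zero_average_def by (simp only: mult_1_right)
  qed
  have u: "(u \<longlongrightarrow> L) at_top" using lim by (simp add: u_def[abs_def])
  have u1: "((\<lambda>T. u (T + 1)) \<longlongrightarrow> L) at_top" "((\<lambda>T. u (T - 1)) \<longlongrightarrow> L) at_top"
    by (rule filterlim_compose[OF u], real_asymp)+
  have r: "((\<lambda>T::real. (T + 1) / T) \<longlongrightarrow> 1) at_top" "((\<lambda>T::real. (T - 1) / T) \<longlongrightarrow> 1) at_top"
    by real_asymp+
  show ?thesis
  proof (rule tendsto_sandwich)
    show "\<forall>\<^sub>F T in at_top. 2 * pi * ((T - 1) / T * u (T - 1)) \<le> zero_average F \<zeta> \<sigma> T"
      using eventually_gt_at_top[of 1] by eventually_elim (rule lower)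
    show "\<forall>\<^sub>F T in at_top. zero_average F \<zeta> \<sigma> T \<le> 2 * pi * ((T + 1) / T * u (T + 1))"
      using eventually_gt_at_top[of 0] by eventually_elim (rule upper)
    show "((\<lambda>T. 2 * pi * ((T - 1) / T * u (T - 1))) \<longlongrightarrow> 2 * pi * L) at_top"
      using tendsto_mult[OF tendsto_const[of "2 * pi"] tendsto_mult[OF r(2) u1(2)]] by simp
    show "((\<lambda>T. 2 * pi * ((T + 1) / T * u (T + 1))) \<longlongrightarrow> 2 * pi * L) at_top"
      using tendsto_mult[OF tendsto_const[of "2 * pi"] tendsto_mult[OF r(1) u1(1)]] by simp
  qed
qed

section \<open>Time averages of circle means\<close>

lemma continuous_on_circle_param:
  fixes g :: "real \<Rightarrow> complex \<Rightarrow> complex"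
  assumes "continuous_on (X \<times> cball 0 r) (\<lambda>(t, z). g t z)" "r \<ge> 0"
  shows "continuous_on (X \<times> Y) (\<lambda>(t, \<theta>). cmod (g t (of_real r * cis \<theta>)))"
proof -
  have "continuous_on (X \<times> Y) (\<lambda>y. case (fst y, of_real r * cis (snd y)) of (t, z) \<Rightarrow> g t z)"
    by (rule continuous_on_compose2[OF assms(1)]) (use assms(2) in \<open>auto intro!: continuous_intros simp: norm_mult\<close>)
  then show ?thesis by (simp add: case_prod_beta continuous_on_norm)
qed

lemma continuous_on_circle_param_integral:
  fixes g :: "real \<Rightarrow> complex \<Rightarrow> complex"
  assumes "continuous_on ({a..b} \<times> cball 0 r) (\<lambda>(t, z). g t z)" "r \<ge> 0"
  shows "continuous_on Y (\<lambda>\<theta>. integral {a..b} (\<lambda>t. cmod (g t (of_real r * cis \<theta>))))"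
proof -
  have "continuous_on (Y \<times> cbox a b) (\<lambda>y. case (snd y, of_real r * cis (fst y)) of (t, z) \<Rightarrow> g t z)"
    by (rule continuous_on_compose2[OF assms(1)]) (use assms(2) in \<open>auto intro!: continuous_intros simp: norm_mult\<close>)
  then have "continuous_on (Y \<times> cbox a b) (\<lambda>(\<theta>, t). cmod (g t (of_real r * cis \<theta>)))"
    by (simp add: case_prod_beta continuous_on_norm)
  from integral_continuous_on_param[OF this] show ?thesis by simp
qed

lemma integral_circle_mean:
  fixes g :: "real \<Rightarrow> complex \<Rightarrow> complex"
  assumes "continuous_on ({a..b} \<times> cball 0 r) (\<lambda>(t, z). g t z)" "r \<ge> 0"
  shows "integral {a..b} (\<lambda>t. circle_mean r (g t)) =
    1 / (2 * pi) * integral {0..2*pi} (\<lambda>\<theta>. integral {a..b} (\<lambda>t. cmod (g t (of_real r * cis \<theta>))))"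
proof -
  have "continuous_on (cbox (a, 0) (b, 2*pi)) (\<lambda>(t, \<theta>). cmod (g t (of_real r * cis \<theta>)))"
    using continuous_on_circle_param[OF assms, of "{0..2*pi}"] by (simp add: cbox_Pair_eq)
  from integral_swap_continuous[OF this] show ?thesis
    by (simp add: circle_mean_def)
qed

text \<open>The Carlson bound with exponent one. The constant is explicit because the estimates below depend on it.\<close>

definition carlson_function :: "(nat \<Rightarrow> complex) \<Rightarrow> (nat \<Rightarrow> complex) \<Rightarrow> (complex \<Rightarrow> complex) \<Rightarrow> real \<Rightarrow> bool" where
  "carlson_function a \<omega> F C \<longleftrightarrow> \<omega> \<in> torus_characters \<and> twisted_continuation a \<omega> F \<and>
     (\<forall>\<sigma>>0. \<forall>T\<ge>1. integral {-T..T} (\<lambda>t. cmod (F (Complex \<sigma> t))) \<le> 2 * T * C)"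

lemma continuous_on_vertical_line:
  assumes "F holomorphic_on half_plane 0" "\<sigma> > 0"
  shows "continuous_on A (\<lambda>t. F (Complex \<sigma> t))"
  unfolding Complex_eq
  by (rule continuous_on_compose2[OF holomorphic_on_imp_continuous_on[OF assms(1)]])
    (use assms(2) in \<open>auto intro!: continuous_intros simp: half_plane_def\<close>)

text \<open>By Fubini's theorem the average is a mean over the circle of averages along vertical lines. A point of
the circle with imaginary part at most \<open>T\<close> shifts the segment \<open>{-T..T}\<close> into \<open>{-2T..2T}\<close>, which costs
the factor two.\<close>

lemma carlson_average:
  assumes F: "F holomorphic_on half_plane 0" and d: "d > 0" and \<rho>: "0 \<le> \<rho>" "\<rho> < 1"
    and C: "\<And>\<sigma> T. \<sigma> > 0 \<Longrightarrow> T \<ge> 1 \<Longrightarrow> integral {-T..T} (\<lambda>t. cmod (F (Complex \<sigma> t))) \<le> 2 * T * C"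
    and T: "T \<ge> 1" "T \<ge> 2 * d / (1 - \<rho>)"
  shows "1 / (2 * T) * integral {-T..T} (\<lambda>t. circle_mean \<rho> (pulled_back F d \<zeta> t)) \<le> cmod \<zeta> + 2 * C"
proof -
  note cont = continuous_on_pulled_back[OF F d \<rho>(2)]
  have inner: "integral {-T..T} (\<lambda>t. cmod (pulled_back F d \<zeta> t (of_real \<rho> * cis \<theta>))) \<le> 2 * T * (cmod \<zeta> + 2 * C)" for \<theta>
  proof -
    define s where "s = cayley d (of_real \<rho> * cis \<theta>)"
    have s: "Re s > 0" "\<bar>Im s\<bar> \<le> T"
    proof -
      show "Re s > 0" unfolding s_def using \<rho> by (intro Re_cayley_pos d) (simp add: norm_mult)
      have "cmod s \<le> 2 * d / (1 - \<rho>)" unfolding s_def using \<rho> by (intro norm_cayley_le d) (auto simp: norm_mult)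
      then show "\<bar>Im s\<bar> \<le> T" using abs_Im_le_cmod[of s] T by linarith
    qed
    have line: "F (s + \<i> * of_real t) = F (Complex (Re s) (Im s + t))" for t
      by (simp add: complex_eq_iff arg_cong[of "s + \<i> * of_real t" "Complex (Re s) (Im s + t)" F])
    have cl: "continuous_on A (\<lambda>t. F (Complex (Re s) (Im s + t)))" for A
      by (rule continuous_on_compose2[OF continuous_on_vertical_line[OF F s(1), of UNIV]]) (auto intro!: continuous_intros)
    have "integral {-T..T} (\<lambda>t. cmod (pulled_back F d \<zeta> t (of_real \<rho> * cis \<theta>)))
        \<le> integral {-T..T} (\<lambda>t. cmod (F (Complex (Re s) (Im s + t))) + cmod \<zeta>)"
      unfolding pulled_back_def s_def[symmetric] line
      by (intro integral_le integrable_continuous_interval continuous_intros cl norm_triangle_ineq4)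
    also have "\<dots> = integral {-T..T} (\<lambda>t. cmod (F (Complex (Re s) (Im s + t)))) + 2 * T * cmod \<zeta>"
      using T by (subst integral_add) (auto intro!: integrable_continuous_interval continuous_intros cl)
    also have "integral {-T..T} (\<lambda>t. cmod (F (Complex (Re s) (Im s + t)))) = integral {-T + Im s..T + Im s} (\<lambda>t. cmod (F (Complex (Re s) t)))"
      using integral_shift_Icc_real[of "-T" T "\<lambda>t. cmod (F (Complex (Re s) t))" "Im s"] by (simp add: o_def)
    also have "\<dots> \<le> integral {-(2*T)..2*T} (\<lambda>t. cmod (F (Complex (Re s) t)))"
      using s by (intro integral_subset_le integrable_continuous_interval continuous_intros continuous_on_vertical_line F) auto
    also have "\<dots> \<le> 2 * (2 * T) * C" by (intro C s) (use T in auto)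
    finally show ?thesis by (simp add: algebra_simps)
  qed
  have "integral {-T..T} (\<lambda>t. circle_mean \<rho> (pulled_back F d \<zeta> t))
      = 1 / (2 * pi) * integral {0..2*pi} (\<lambda>\<theta>. integral {-T..T} (\<lambda>t. cmod (pulled_back F d \<zeta> t (of_real \<rho> * cis \<theta>))))"
    by (rule integral_circle_mean[OF cont \<rho>(1)])
  also have "\<dots> \<le> 1 / (2 * pi) * integral {0..2*pi} (\<lambda>_. 2 * T * (cmod \<zeta> + 2 * C))"
    by (intro mult_left_mono integral_le integrable_continuous_interval inner continuous_on_const
        continuous_on_circle_param_integral[OF cont \<rho>(1)]) auto
  also have "\<dots> = 2 * T * (cmod \<zeta> + 2 * C)" by simp
  finally show ?thesis using T by (simp add: divide_le_eq mult_ac)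
qed

lemma holomorphic_twisted_poly_half_plane:
  "dirichlet_polynomial P \<Longrightarrow> twisted_poly P \<omega> holomorphic_on A"
  using holomorphic_twisted_poly[OF _ holomorphic_on_id, of P \<omega> A] by (simp add: id_def)

lemma pulled_back_twisted_poly:
  "\<omega> \<in> torus_characters \<Longrightarrow> pulled_back (twisted_poly P \<omega>) d \<zeta> t = (\<lambda>z. twisted_poly P (flow t \<omega>) (cayley d z) - \<zeta>)"
  by (simp add: fun_eq_iff pulled_back_def twisted_poly_flow)

lemma holomorphic_twisted_poly_cayley:
  assumes "dirichlet_polynomial P"
  shows "(\<lambda>z. twisted_poly P \<omega> (cayley d z) - \<zeta>) holomorphic_on ball 0 1"
  by (intro holomorphic_intros holomorphic_twisted_poly assms holomorphic_cayley)

lemma continuous_on_twisted_poly_cayley: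
  assumes "dirichlet_polynomial P" "r < 1"
  shows "continuous_on (X \<times> cball 0 r) (\<lambda>(\<omega>, z). twisted_poly P \<omega> (cayley d z) - \<zeta>)"
proof -
  have c: "continuous_on (X \<times> cball 0 r) (\<lambda>y. cayley d (snd y))"
    by (rule continuous_on_compose2[OF continuous_on_cayley[OF subset_refl]]) (use assms in \<open>auto intro!: continuous_intros\<close>)
  show ?thesis unfolding case_prod_beta by (intro continuous_intros assms c)
qed

text \<open>The mean over the torus may be exchanged with the integral over the circle: time averages are bounded
and converge for each point of the circle, so dominated convergence applies.\<close>

lemma torus_mean_circle_mean_le:
  assumes P: "dirichlet_polynomial P" and d: "d > 0" and \<rho>: "0 \<le> \<rho>" "\<rho> < 1"
    and C: "\<And>s. Re s \<ge> 0 \<Longrightarrow> torus_mean (\<lambda>\<omega>. cmod (twisted_poly P \<omega> s)) \<le> C"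
  shows "continuous_on torus_characters (\<lambda>\<omega>. circle_mean \<rho> (\<lambda>z. twisted_poly P \<omega> (cayley d z) - \<zeta>))"
    and "torus_mean (\<lambda>\<omega>. circle_mean \<rho> (\<lambda>z. twisted_poly P \<omega> (cayley d z) - \<zeta>)) \<le> C + cmod \<zeta>"
proof -
  let ?A = "\<lambda>\<omega>. circle_mean \<rho> (\<lambda>z. twisted_poly P \<omega> (cayley d z) - \<zeta>)"
  show A: "continuous_on torus_characters ?A"
    by (rule continuous_on_circle_mean[OF continuous_on_twisted_poly_cayley[OF P \<rho>(2)] \<rho>(1)])
  define h where "h \<theta> \<omega> = cmod (twisted_poly P \<omega> (cayley d (of_real \<rho> * cis \<theta>)) - \<zeta>)" for \<theta> \<omega>
  define M where "M = (\<Sum>n | P n \<noteq> 0. cmod (P n)) + cmod \<zeta>"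
  have h: "continuous_on torus_characters (h \<theta>)" for \<theta>
    unfolding h_def by (intro continuous_intros P)
  have Re: "Re (cayley d (of_real \<rho> * cis \<theta>)) \<ge> 0" for \<theta>
    using \<rho> by (intro less_imp_le Re_cayley_pos d) (simp add: norm_mult)
  have hM: "h \<theta> \<omega> \<le> M" if "\<omega> \<in> torus_characters" for \<theta> \<omega>
    using norm_triangle_ineq4[of "twisted_poly P \<omega> (cayley d (of_real \<rho> * cis \<theta>))" \<zeta>] twisted_poly_norm_le[OF P that Re[of \<theta>]]
    by (simp add: h_def M_def)
  define f where "f n \<theta> = time_average (h \<theta>) unit_character (real (Suc n))" for n \<theta>
  have cont: "continuous_on ({-T..T} \<times> cball 0 \<rho>) (\<lambda>(t, z). pulled_back (twisted_poly P unit_character) d \<zeta> t z)" for T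
    by (rule continuous_on_pulled_back[OF holomorphic_twisted_poly_half_plane[OF P] d \<rho>(2)])
  have f_eq: "f n \<theta> = 1 / (2 * real (Suc n)) * integral {-real (Suc n)..real (Suc n)}
      (\<lambda>t. cmod (pulled_back (twisted_poly P unit_character) d \<zeta> t (of_real \<rho> * cis \<theta>)))" for n \<theta>
    by (simp add: f_def time_average_def h_def pulled_back_twisted_poly unit_character_in_torus)
  have f_int: "f n integrable_on {0..2*pi}" for n
    unfolding f_eq[abs_def]
    by (intro integrable_continuous_interval continuous_intros continuous_on_circle_param_integral[OF cont \<rho>(1)])
  have avg: "time_average ?A unit_character (real (Suc n)) = 1 / (2 * pi) * integral {0..2*pi} (f n)" for n
    unfolding time_average_def f_eq[abs_def]
    using integral_circle_mean[OF cont \<rho>(1), of "real (Suc n)"]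
    by (simp add: pulled_back_twisted_poly unit_character_in_torus)
  have bound: "norm (f n \<theta>) \<le> M" for n \<theta>
  proof -
    have "norm (f n \<theta>) \<le> time_average (\<lambda>_. M) unit_character (real (Suc n))"
      unfolding f_def by (intro time_average_norm_le h continuous_on_const unit_character_in_torus) (use hM in \<open>auto simp: h_def\<close>)
    then show ?thesis by (simp add: time_average_const)
  qed
  have seq: "filterlim (\<lambda>n. real (Suc n)) at_top sequentially"
    using filterlim_compose[OF filterlim_real_sequentially filterlim_Suc] by simp
  have conv: "(\<lambda>n. f n \<theta>) \<longlonglongrightarrow> torus_mean (h \<theta>)" for \<theta>
    unfolding f_def using filterlim_compose[OF time_average_tendsto[OF h unit_character_in_torus] seq] by simp
  have dom: "(\<lambda>\<theta>. torus_mean (h \<theta>)) integrable_on {0..2*pi}"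
    "(\<lambda>n. integral {0..2*pi} (f n)) \<longlonglongrightarrow> integral {0..2*pi} (\<lambda>\<theta>. torus_mean (h \<theta>))"
    by (rule dominated_convergence[where h = "\<lambda>_. M", OF f_int _ bound conv], rule integrable_const_ivl)+
  have "(\<lambda>n. time_average ?A unit_character (real (Suc n))) \<longlonglongrightarrow> torus_mean ?A"
    using filterlim_compose[OF time_average_tendsto[OF A unit_character_in_torus] seq] by simp
  moreover have "(\<lambda>n. time_average ?A unit_character (real (Suc n))) \<longlonglongrightarrow> 1 / (2 * pi) * integral {0..2*pi} (\<lambda>\<theta>. torus_mean (h \<theta>))"
    unfolding avg by (intro tendsto_intros dom)
  ultimately have "torus_mean ?A = 1 / (2 * pi) * integral {0..2*pi} (\<lambda>\<theta>. torus_mean (h \<theta>))"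
    by (rule LIMSEQ_unique)
  also have "\<dots> \<le> 1 / (2 * pi) * integral {0..2*pi} (\<lambda>_. C + cmod \<zeta>)"
  proof (intro mult_left_mono integral_le dom integrable_const_ivl)
    fix \<theta>
    let ?s = "cayley d (of_real \<rho> * cis \<theta>)"
    have "torus_mean (h \<theta>) \<le> torus_mean (\<lambda>\<omega>. cmod (twisted_poly P \<omega> ?s) + cmod \<zeta>)"
      by (rule torus_mean_mono[OF h]) (auto intro!: continuous_intros P norm_triangle_ineq4 simp: h_def)
    also have "\<dots> = torus_mean (\<lambda>\<omega>. cmod (twisted_poly P \<omega> ?s)) + cmod \<zeta>"
      by (subst torus_mean_add) (auto intro!: continuous_intros P simp: torus_mean_const)
    also have "\<dots> \<le> C + cmod \<zeta>" using C[OF Re[of \<theta>]] by simp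
    finally show "torus_mean (h \<theta>) \<le> C + cmod \<zeta>" .
  qed simp
  also have "\<dots> = C + cmod \<zeta>" by simp
  finally show "torus_mean ?A \<le> C + cmod \<zeta>" .
qed

section \<open>Dirichlet series far to the right\<close>

lemma summable_inverse_square_powr: "summable (\<lambda>n. real n powr - 2)"
  by (simp add: summable_real_powr_iff)

lemma norm_dirichlet_term_le:
  assumes "\<omega> \<in> torus_characters" "Re s \<ge> 2"
  shows "cmod (b * \<omega> n * of_nat n powr (- s)) \<le> cmod b * real n powr - 2"
proof (cases "n = 0")
  case False
  have "cmod (of_nat n powr (- s)) = real n powr (- Re s)" using False by (simp add: norm_powr_real_powr)
  also have "\<dots> \<le> real n powr - 2" using False assms(2) by (intro powr_mono) auto
  finally show ?thesis using False torus_norm[OF assms(1), of n] by (simp add: norm_mult mult_left_mono)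
qed simp

lemma twisted_poly_sums:
  assumes "dirichlet_polynomial P"
  shows "(\<lambda>n. P n * \<omega> n * of_nat n powr (- s)) sums twisted_poly P \<omega> s"
  unfolding twisted_poly_def by (rule sums_finite) (use dirichlet_polynomial_finite[OF assms] in auto)

lemma dirichlet_series_diff_le:
  assumes \<omega>: "\<omega> \<in> torus_characters" and s: "Re s \<ge> 2"
    and F: "(\<lambda>n. b n * \<omega> n * of_nat n powr (- s)) sums x" and G: "(\<lambda>n. c n * \<omega> n * of_nat n powr (- s)) sums y"
    and C: "\<And>n. cmod (b n - c n) \<le> C"
  shows "cmod (x - y) \<le> (\<Sum>n. cmod (b n - c n) * real n powr - 2)"
proof (rule norm_sums_le[OF sums_diff[OF F G] summable_sums])
  show "summable (\<lambda>n. cmod (b n - c n) * real n powr - 2)"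
    by (rule summable_comparison_test'[OF summable_mult[OF summable_inverse_square_powr, of C]])
      (use C in \<open>auto intro!: mult_right_mono\<close>)
  show "cmod (b n * \<omega> n * of_nat n powr - s - c n * \<omega> n * of_nat n powr - s) \<le> cmod (b n - c n) * real n powr - 2" for n
    using norm_dirichlet_term_le[OF \<omega> s, of "b n - c n" n] by (simp add: algebra_simps)
qed

text \<open>Beyond the constant term, \<open>n\<^sup>-\<^sup>d\<close> is at most \<open>2\<^sup>2\<^sup>-\<^sup>d n\<^sup>-\<^sup>2\<close>.\<close>

lemma dirichlet_series_near_constant:
  assumes \<omega>: "\<omega> \<in> torus_characters" and d: "d \<ge> 2" and s: "Re s \<ge> d"
    and F: "(\<lambda>n. b n * \<omega> n * of_nat n powr (- s)) sums x" and C: "\<And>n. cmod (b n) \<le> C"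
  shows "cmod (x - b 1) \<le> C * 2 powr (2 - d) * (\<Sum>n. real n powr - 2)"
proof -
  have one: "\<omega> 1 = 1"
    using torus_mult[OF \<omega>, of 1 1] torus_norm[OF \<omega>, of 1] by auto
  have C0: "C \<ge> 0" using C[of 0] by (rule order_trans[OF norm_ge_zero])
  have "(\<lambda>n. b n * \<omega> n * of_nat n powr (- s) - (if n = 1 then b 1 else 0)) sums (x - b 1)"
    by (intro sums_diff F sums_single)
  moreover have "(\<lambda>n. C * 2 powr (2 - d) * real n powr - 2) sums (C * 2 powr (2 - d) * (\<Sum>n. real n powr - 2))"
    by (intro sums_mult summable_sums summable_inverse_square_powr)
  ultimately show ?thesis
  proof (rule norm_sums_le)
    fix n :: nat
    consider "n = 0" | "n = 1" | "n \<ge> 2" by linarith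
    then show "cmod (b n * \<omega> n * of_nat n powr (- s) - (if n = 1 then b 1 else 0)) \<le> C * 2 powr (2 - d) * real n powr - 2"
    proof cases
      case 3
      have "cmod (of_nat n powr (- s)) = real n powr (- Re s)" using 3 by (simp add: norm_powr_real_powr)
      also have "\<dots> \<le> real n powr (- d)" using 3 s by (intro powr_mono) auto
      also have "\<dots> = real n powr (2 - d) * real n powr - 2" by (simp add: powr_add[symmetric])
      also have "\<dots> \<le> 2 powr (2 - d) * real n powr - 2"
        using 3 d by (intro mult_right_mono powr_mono2') auto
      finally have "cmod (b n) * cmod (of_nat n powr (- s)) \<le> C * (2 powr (2 - d) * real n powr - 2)"
        using C C0 by (intro mult_mono) auto
      then show ?thesis using 3 torus_norm[OF \<omega>, of n] by (simp add: norm_mult mult.assoc)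
    qed (use one C0 in auto)
  qed
qed

text \<open>The coefficients converge only one by one; Tannery's theorem supplies the uniformity.\<close>

lemma weighted_dist_tendsto_0:
  assumes lim: "\<And>n. (\<lambda>k. P k n) \<longlonglongrightarrow> a n" and C: "\<And>k n. cmod (a n - P k n) \<le> C"
  shows "(\<lambda>k. \<Sum>n. cmod (a n - P k n) * real n powr - 2) \<longlonglongrightarrow> 0"
proof -
  have "((\<lambda>k. \<Sum>n. cmod (a n - P k n) * real n powr - 2) \<longlongrightarrow> (\<Sum>n::nat. 0)) sequentially"
  proof (rule conjunct2[OF conjunct2[OF tannerys_theorem[where M = "\<lambda>n. C * real n powr - 2"]]])
    fix n
    have "(\<lambda>k. cmod (a n - P k n) * real n powr - 2) \<longlonglongrightarrow> cmod (a n - a n) * real n powr - 2"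
      by (intro tendsto_intros lim)
    then show "(\<lambda>k. cmod (a n - P k n) * real n powr - 2) \<longlonglongrightarrow> 0" by simp
  next
    show "\<forall>\<^sub>F (n, k) in at_top \<times>\<^sub>F sequentially. norm (cmod (a n - P k n) * real n powr - 2) \<le> C * real n powr - 2"
      by (rule always_eventually) (auto intro!: mult_right_mono C)
  qed (auto intro: summable_mult summable_inverse_square_powr)
  then show ?thesis by simp
qed

text \<open>Yields the abscissa beyond which the value \<open>\<zeta>\<close> is not taken, with a lower bound for the distance to it.\<close>

lemma dirichlet_series_far_from_value:
  assumes \<omega>: "\<omega> \<in> torus_characters" and d: "d \<ge> 2" and s: "Re s \<ge> d"
    and F: "(\<lambda>n. b n * \<omega> n * of_nat n powr (- s)) sums x" and C: "\<And>n. cmod (b n) \<le> C"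
    and far: "C * 2 powr (2 - d) * (\<Sum>n. real n powr - 2) \<le> cmod (b 1 - \<zeta>) / 4"
  shows "cmod (b 1 - \<zeta>) / 2 \<le> cmod (x - \<zeta>)"
proof -
  have "cmod (x - b 1) \<le> C * 2 powr (2 - d) * (\<Sum>n. real n powr - 2)"
    by (rule dirichlet_series_near_constant[OF \<omega> d s F C])
  moreover have "cmod (b 1 - \<zeta>) \<le> cmod (x - \<zeta>) + cmod (x - b 1)"
    using norm_triangle_ineq4[of "x - \<zeta>" "x - b 1"] by simp
  ultimately show ?thesis using far norm_ge_zero[of "b 1 - \<zeta>"] by linarith
qed

section \<open>Existence of the mean counting function\<close>

text \<open>For the approximating polynomials the weighted zero sum is a continuous function on the torus evaluated
along the flow, so its averages converge to a limit that does not depend on the character. The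
comparison inequality transfers this to every function with bounded vertical means.\<close>

theorem disc_average_limit:
  assumes P: "\<And>k. dirichlet_polynomial (P k)" and lim: "\<And>n. (\<lambda>k. P k n) \<longlonglongrightarrow> a n"
    and Cm: "\<And>k s. Re s \<ge> 0 \<Longrightarrow> torus_mean (\<lambda>\<omega>. cmod (twisted_poly (P k) \<omega> s)) \<le> C"
    and Cc: "\<And>k n. cmod (P k n) \<le> C"
    and d: "d \<ge> 3" and far: "C * 2 powr (2 - d) * (\<Sum>n. real n powr - 2) \<le> cmod (a 1 - \<zeta>) / 4"
    and \<zeta>: "\<zeta> \<noteq> a 1" and \<sigma>: "\<sigma> > 0"
  shows "\<exists>L. \<forall>(\<omega>, F)\<in>{(\<omega>, F). \<exists>C. carlson_function a \<omega> F C}.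
    ((\<lambda>T. 1 / (2 * T) * integral {-T..T} (\<lambda>t. weighted_zero_sum (disc_weight \<sigma> d) (pulled_back F d \<zeta> t))) \<longlongrightarrow> L) at_top"
proof -
  let ?W = "disc_weight \<sigma> d"
  have d0: "d > 0" "d \<ge> 2" using d by auto
  obtain r1 \<rho> where r: "1/5 \<le> r1" "r1 < \<rho>" "\<rho> < 1" and W1: "\<And>z. ?W z \<noteq> 0 \<Longrightarrow> cmod z \<le> r1"
    and W2: "\<And>z. ?W z \<noteq> 0 \<Longrightarrow> z \<noteq> 0 \<Longrightarrow> ?W z \<le> jensen_constant d * ln (\<rho> / cmod z)"
    using disc_weight_radii[OF \<sigma> d0(1)] by blast
  have r': "0 < r1" "0 \<le> \<rho>" using r by auto
  have W0: "?W z \<ge> 0" for z by (simp add: disc_weight_def strip_weight_nonneg)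
  have K: "jensen_constant d \<ge> 0" using d0 by (simp add: jensen_constant_def)
  have Wc: "continuous_on (ball 0 1) ?W" by (rule continuous_on_disc_weight)
  have Wc\<rho>: "continuous_on (ball 0 \<rho>) ?W" by (rule continuous_on_subset[OF Wc]) (use r in auto)
  define c where "c = cmod (a 1 - \<zeta>) / 2"
  have c: "c > 0" using \<zeta> by (simp add: c_def)
  have Ca: "cmod (a n) \<le> C" for n
    by (rule tendsto_upperbound[OF tendsto_norm[OF lim]]) (use Cc in auto)
  have diffC: "cmod (a n - P k n) \<le> 2 * C" for n k
    using norm_triangle_ineq4[of "a n" "P k n"] Ca[of n] Cc[of k n] by simp
  have "(\<lambda>k. cmod (P k 1 - a 1)) \<longlonglongrightarrow> cmod (a 1 - a 1)" by (intro tendsto_intros lim)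
  then have "\<forall>\<^sub>F k in sequentially. cmod (P k 1 - a 1) < c / 2"
    using c by (intro order_tendstoD(2)) auto
  then obtain K0 where K0: "\<And>k. k \<ge> K0 \<Longrightarrow> cmod (P k 1 - a 1) < c / 2"
    by (auto simp: eventually_sequentially)
  \<comment> \<open>Early polynomials may take the value \<open>\<zeta>\<close> at the centre of the disc and are dropped.\<close>
  define Q where "Q k = P (k + K0)" for k
  have Q: "dirichlet_polynomial (Q k)" and diffCQ: "cmod (a n - Q k n) \<le> 2 * C" for k n
    by (simp_all add: Q_def P diffC)
  have Qc: "c \<le> cmod (twisted_poly (Q k) \<omega> s - \<zeta>)" if "\<omega> \<in> torus_characters" "Re s \<ge> d" for k \<omega> s
  proof -
    have "cmod (twisted_poly (Q k) \<omega> s - Q k 1) \<le> C * 2 powr (2 - d) * (\<Sum>n. real n powr - 2)"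
      by (rule dirichlet_series_near_constant[OF that(1) d0(2) that(2) twisted_poly_sums[OF Q]]) (simp add: Q_def Cc)
    moreover have "cmod (Q k 1 - a 1) < c / 2" using K0[of "k + K0"] by (simp add: Q_def)
    moreover have "cmod (a 1 - \<zeta>) \<le> cmod (twisted_poly (Q k) \<omega> s - \<zeta>) + cmod (twisted_poly (Q k) \<omega> s - Q k 1) + cmod (Q k 1 - a 1)"
      using norm_triangle_ineq4[of "twisted_poly (Q k) \<omega> s - \<zeta>" "(twisted_poly (Q k) \<omega> s - Q k 1) + (Q k 1 - a 1)"]
        norm_triangle_ineq[of "twisted_poly (Q k) \<omega> s - Q k 1" "Q k 1 - a 1"] by simp
    ultimately show ?thesis using far norm_ge_zero[of "a 1 - \<zeta>"] unfolding c_def by linarith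
  qed
  define h where "h k \<omega> = weighted_zero_sum ?W (\<lambda>z. twisted_poly (Q k) \<omega> (cayley d z) - \<zeta>)" for k \<omega>
  define A where "A k \<omega> = circle_mean \<rho> (\<lambda>z. twisted_poly (Q k) \<omega> (cayley d z) - \<zeta>)" for k \<omega>
  have h: "continuous_on torus_characters (h k)" for k
    unfolding h_def
  proof (rule continuous_on_weighted_zero_sum[OF r'(1) r(2) Wc\<rho> W1 continuous_on_twisted_poly_cayley[OF Q r(3)]])
    show "(\<lambda>z. twisted_poly (Q k) \<omega> (cayley d z) - \<zeta>) holomorphic_on ball 0 \<rho>" for \<omega>
      by (rule holomorphic_on_subset[OF holomorphic_twisted_poly_cayley[OF Q]]) (use r in auto)
    show "twisted_poly (Q k) \<omega> (cayley d 0) - \<zeta> \<noteq> 0" if "\<omega> \<in> torus_characters" for \<omega>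
      using Qc[OF that, of "of_real d" k] c by auto
  qed
  have CmQ: "torus_mean (\<lambda>\<omega>. cmod (twisted_poly (Q k) \<omega> s)) \<le> C" if "Re s \<ge> 0" for k s
    using Cm[OF that] by (simp add: Q_def)
  have A: "continuous_on torus_characters (A k)" "torus_mean (A k) \<le> C + cmod \<zeta>" for k
    unfolding A_def[abs_def]
    by (rule torus_mean_circle_mean_le[OF Q d0(1) r'(2) r(3) CmQ], assumption)+
  define \<epsilon> where "\<epsilon> k = (\<Sum>n. cmod (a n - Q k n) * real n powr - 2)" for k
  have \<epsilon>: "\<epsilon> \<longlonglongrightarrow> 0"
    unfolding \<epsilon>_def Q_def by (rule weighted_dist_tendsto_0[OF LIMSEQ_ignore_initial_segment[OF lim] diffC])
  define \<phi> where "\<phi> F t = weighted_zero_sum ?W (pulled_back F d \<zeta> t)" for F t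
  have "\<exists>L. \<forall>i\<in>{(\<omega>, F). \<exists>C. carlson_function a \<omega> F C}.
      ((\<lambda>T. 1 / (2 * T) * integral {-T..T} (\<phi> (snd i))) \<longlongrightarrow> L) at_top"
  proof (rule common_limit_by_approximation[where v = "\<lambda>k i. time_average (h k) (fst i)" and m = "\<lambda>k. torus_mean (h k)"])
    fix i k assume "i \<in> {(\<omega>, F). \<exists>C. carlson_function a \<omega> F C}"
    then show "(time_average (h k) (fst i) \<longlongrightarrow> torus_mean (h k)) at_top"
      by (intro time_average_tendsto h) (auto simp: carlson_function_def)
  next
    fix i and e :: real assume "i \<in> {(\<omega>, F). \<exists>C. carlson_function a \<omega> F C}" and e: "e > 0"
    then obtain \<omega> F CF where i: "i = (\<omega>, F)" and carl: "carlson_function a \<omega> F CF" by auto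
    have \<omega>: "\<omega> \<in> torus_characters" and F: "F holomorphic_on half_plane 0"
      and Fs: "\<And>s. Re s \<ge> 2 \<Longrightarrow> (\<lambda>n. a n * \<omega> n * of_nat n powr (- s)) sums F s"
      and CF: "\<And>\<sigma> T. \<sigma> > 0 \<Longrightarrow> T \<ge> 1 \<Longrightarrow> integral {-T..T} (\<lambda>t. cmod (F (Complex \<sigma> t))) \<le> 2 * T * CF"
      using carl by (auto simp: carlson_function_def twisted_continuation_def half_plane_def)
    have Fc: "c \<le> cmod (F s - \<zeta>)" if "Re s \<ge> d" for s
      unfolding c_def by (rule dirichlet_series_far_from_value[OF \<omega> d0(2) that Fs Ca far]) (use that d0 in simp)
    have C0: "C \<ge> 0" using Ca[of 0] by (rule order_trans[OF norm_ge_zero])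
    have CF0: "CF \<ge> 0"
    proof -
      have "0 \<le> integral {-1..1} (\<lambda>t. cmod (F (Complex 1 t)))"
        by (intro integral_nonneg integrable_continuous_interval continuous_intros continuous_on_vertical_line F) auto
      then show ?thesis using CF[of 1 1] by simp
    qed
    define B where "B = (cmod \<zeta> + 2 * CF) + (C + cmod \<zeta> + 1)"
    have B: "B \<ge> 0" using C0 CF0 by (simp add: B_def)
    have fifth: "0 < (1/5 :: real)" by simp
    obtain \<alpha> \<beta> \<gamma> where \<beta>: "\<beta> \<ge> 0" and \<gamma>: "\<gamma> \<ge> 0" and \<alpha>\<beta>: "\<alpha> + \<beta> * B \<le> e / 2"
      and compare: "\<And>g h \<epsilon>. g holomorphic_on ball 0 1 \<Longrightarrow> h holomorphic_on ball 0 1 \<Longrightarrow> c \<le> cmod (g 0) \<Longrightarrow> c \<le> cmod (h 0) \<Longrightarrow>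
        (\<And>z. cmod z \<le> 1/5 \<Longrightarrow> cmod (g z - h z) \<le> \<epsilon>) \<Longrightarrow>
        \<bar>weighted_zero_sum ?W g - weighted_zero_sum ?W h\<bar> \<le> \<alpha> + \<beta> * (circle_mean \<rho> g + circle_mean \<rho> h) + \<gamma> * \<epsilon>"
      by (rule weighted_zero_sum_comparison[OF fifth r Wc W1 W0 W2 K c B half_gt_zero[OF e]]) (assumption | blast)+
    have "(\<lambda>k. \<gamma> * \<epsilon> k) \<longlonglongrightarrow> \<gamma> * 0" by (intro tendsto_intros \<epsilon>)
    then have "\<forall>\<^sub>F k in sequentially. \<gamma> * \<epsilon> k < e / 2" using e by (intro order_tendstoD(2)) auto
    then show "\<forall>\<^sub>F k in sequentially. \<forall>\<^sub>F T in at_top.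
        norm (1 / (2 * T) * integral {-T..T} (\<phi> (snd i)) - time_average (h k) (fst i) T) \<le> e"
    proof eventually_elim
      case (elim k)
      have "\<forall>\<^sub>F T in at_top. time_average (A k) \<omega> T < C + cmod \<zeta> + 1"
        by (rule order_tendstoD(2)[OF time_average_tendsto[OF A(1) \<omega>]]) (use A(2)[of k] in linarith)
      moreover have "\<forall>\<^sub>F T in at_top. T \<ge> max 1 (2 * d / (1 - \<rho>))" by (rule eventually_ge_at_top)
      ultimately show ?case
      proof eventually_elim
        case T: (elim T)
        then have T0: "T > 0" by auto
        let ?aF = "\<lambda>t. circle_mean \<rho> (pulled_back F d \<zeta> t)"
        have aF: "1 / (2 * T) * integral {-T..T} ?aF \<le> cmod \<zeta> + 2 * CF"
          by (rule carlson_average[OF F d0(1) r'(2) r(3) CF]) (use T in auto)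
        have pt: "\<bar>\<phi> F t - h k (flow t \<omega>)\<bar> \<le> \<alpha> + \<beta> * (?aF t + A k (flow t \<omega>)) + \<gamma> * \<epsilon> k" for t
          unfolding \<phi>_def h_def A_def
        proof (rule compare)
          show "pulled_back F d \<zeta> t holomorphic_on ball 0 1" by (rule holomorphic_pulled_back[OF F d0(1)])
          show "(\<lambda>z. twisted_poly (Q k) (flow t \<omega>) (cayley d z) - \<zeta>) holomorphic_on ball 0 1"
            by (rule holomorphic_twisted_poly_cayley[OF Q])
          show "c \<le> cmod (pulled_back F d \<zeta> t 0)" unfolding pulled_back_def by (rule Fc) simp
          show "c \<le> cmod (twisted_poly (Q k) (flow t \<omega>) (cayley d 0) - \<zeta>)"
            by (rule Qc[OF flow_in_torus[OF \<omega>]]) simp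
          \<comment> \<open>The disc of radius \<open>1/5\<close> corresponds to points with real part at least two, where both series converge absolutely.\<close>
          fix z :: complex assume z: "cmod z \<le> 1/5"
          have Re2: "Re (cayley d z + \<i> * of_real t) \<ge> 2" using Re_cayley_ge_2[OF d z] by simp
          have "cmod (F (cayley d z + \<i> * of_real t) - twisted_poly (Q k) \<omega> (cayley d z + \<i> * of_real t)) \<le> \<epsilon> k"
            unfolding \<epsilon>_def
            by (rule dirichlet_series_diff_le[OF \<omega> Re2 Fs[OF Re2] twisted_poly_sums[OF Q] diffCQ])
          then show "cmod (pulled_back F d \<zeta> t z - (twisted_poly (Q k) (flow t \<omega>) (cayley d z) - \<zeta>)) \<le> \<epsilon> k"
            by (simp add: pulled_back_def twisted_poly_flow[OF \<omega>])
        qed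
        have int1: "\<phi> F integrable_on {-T..T}"
          unfolding \<phi>_def[abs_def]
        proof (intro integrable_continuous_interval continuous_on_weighted_zero_sum[OF r'(1) r(2) Wc\<rho> W1 continuous_on_pulled_back[OF F d0(1) r(3)]])
          show "pulled_back F d \<zeta> t holomorphic_on ball 0 \<rho>" for t
            by (rule holomorphic_on_subset[OF holomorphic_pulled_back[OF F d0(1)]]) (use r in auto)
          show "pulled_back F d \<zeta> t 0 \<noteq> 0" for t
            using Fc[of "of_real d + \<i> * of_real t"] c by (auto simp: pulled_back_def)
        qed
        have int2: "(\<lambda>t. h k (flow t \<omega>)) integrable_on {-T..T}" by (rule integrable_along_flow[OF h \<omega>])
        have int3: "?aF integrable_on {-T..T}"
          by (intro integrable_continuous_interval continuous_on_circle_mean[OF continuous_on_pulled_back[OF F d0(1) r(3)] r'(2)])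
        have int4: "(\<lambda>t. A k (flow t \<omega>)) integrable_on {-T..T}" by (rule integrable_along_flow[OF A(1) \<omega>])
        have "norm (integral {-T..T} (\<phi> F) - integral {-T..T} (\<lambda>t. h k (flow t \<omega>)))
            = norm (integral {-T..T} (\<lambda>t. \<phi> F t - h k (flow t \<omega>)))"
          by (simp add: integral_diff[OF int1 int2])
        also have "\<dots> \<le> integral {-T..T} (\<lambda>t. (\<alpha> + \<gamma> * \<epsilon> k) + \<beta> * (?aF t + A k (flow t \<omega>)))"
          by (intro integral_norm_bound_integral integrable_diff int1 int2 integrable_add integrable_on_mult_right int3 int4 integrable_const_ivl)
            (use pt in \<open>simp add: algebra_simps\<close>)
        also have "\<dots> = 2 * T * (\<alpha> + \<gamma> * \<epsilon> k) + \<beta> * (integral {-T..T} ?aF + integral {-T..T} (\<lambda>t. A k (flow t \<omega>)))"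
          using T0 by (simp add: integral_add[OF integrable_const_ivl integrable_on_mult_right[OF integrable_add[OF int3 int4]]]
              integral_add[OF int3 int4])
        finally have "norm (integral {-T..T} (\<phi> F) - integral {-T..T} (\<lambda>t. h k (flow t \<omega>))) \<le> \<dots>" .
        then have "1 / (2 * T) * norm (integral {-T..T} (\<phi> F) - integral {-T..T} (\<lambda>t. h k (flow t \<omega>)))
           \<le> 1 / (2 * T) * (2 * T * (\<alpha> + \<gamma> * \<epsilon> k) + \<beta> * (integral {-T..T} ?aF + integral {-T..T} (\<lambda>t. A k (flow t \<omega>))))"
          using T0 by (intro mult_left_mono) auto
        also have "\<dots> = (\<alpha> + \<gamma> * \<epsilon> k) + \<beta> * (1 / (2 * T) * integral {-T..T} ?aF + time_average (A k) \<omega> T)"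
          using T0 by (simp add: time_average_def field_simps)
        also have "\<dots> \<le> (\<alpha> + \<gamma> * \<epsilon> k) + \<beta> * B"
          using aF T \<beta> unfolding B_def by (intro add_left_mono mult_left_mono add_mono) auto
        also have "\<dots> \<le> e" using \<alpha>\<beta> elim by linarith
        finally have "1 / (2 * T) * norm (integral {-T..T} (\<phi> F) - integral {-T..T} (\<lambda>t. h k (flow t \<omega>))) \<le> e" .
        moreover have "norm (1 / (2 * T) * integral {-T..T} (\<phi> F) - time_average (h k) \<omega> T)
            = norm (1 / (2 * T) * (integral {-T..T} (\<phi> F) - integral {-T..T} (\<lambda>t. h k (flow t \<omega>))))"
          by (simp add: time_average_def right_diff_distrib diff_divide_distrib)
        ultimately show ?case using T0 by (simp add: i abs_mult)
      qed
    qed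
  qed simp
  then show ?thesis by (simp add: \<phi>_def[abs_def] case_prod_beta)
qed

text \<open>Jensen's inequality in the disc, averaged over vertical translates. The bound does not involve
\<open>\<sigma>\<close>: the constant in Jensen's inequality does not, and the circle means are averages over vertical
lines, all of which obey the same bound.\<close>

lemma carlson_zero_density_bound:
  assumes carl: "carlson_function a \<omega> F C" and d: "d > 0" and \<sigma>: "\<sigma> > 0"
    and c: "c > 0" "\<And>s. Re s \<ge> d \<Longrightarrow> c \<le> cmod (F s - \<zeta>)"
    and L: "((\<lambda>T. 1 / (2 * T) * integral {-T..T} (\<lambda>t. weighted_zero_sum (disc_weight \<sigma> d) (pulled_back F d \<zeta> t))) \<longlongrightarrow> L) at_top"
  shows "L \<le> jensen_constant d / c * (cmod \<zeta> + 2 * C)"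
proof -
  let ?W = "disc_weight \<sigma> d"
  let ?K = "jensen_constant d"
  have F: "F holomorphic_on half_plane 0"
    and C: "\<And>\<sigma> T. \<sigma> > 0 \<Longrightarrow> T \<ge> 1 \<Longrightarrow> integral {-T..T} (\<lambda>t. cmod (F (Complex \<sigma> t))) \<le> 2 * T * C"
    using carl by (auto simp: carlson_function_def twisted_continuation_def)
  obtain r1 \<rho> where r: "1/5 \<le> r1" "r1 < \<rho>" "\<rho> < 1" and W1: "\<And>z. ?W z \<noteq> 0 \<Longrightarrow> cmod z \<le> r1"
    and W2: "\<And>z. ?W z \<noteq> 0 \<Longrightarrow> z \<noteq> 0 \<Longrightarrow> ?W z \<le> ?K * ln (\<rho> / cmod z)"
    using disc_weight_radii[OF \<sigma> d] by blast
  have \<rho>: "0 < \<rho>" "0 \<le> \<rho>" using r by auto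
  have r1: "0 < r1" using r by auto
  have W0: "?W z \<ge> 0" for z by (simp add: disc_weight_def strip_weight_nonneg)
  have K: "?K \<ge> 0" using d by (simp add: jensen_constant_def)
  note hol = holomorphic_pulled_back[OF F d]
  have g0: "c \<le> cmod (pulled_back F d \<zeta> t 0)" for t
    unfolding pulled_back_def by (rule c(2)) simp
  have g0': "pulled_back F d \<zeta> t 0 \<noteq> 0" for t using g0[of t] c(1) by auto
  have le: "weighted_zero_sum ?W (pulled_back F d \<zeta> t) \<le> ?K / c * circle_mean \<rho> (pulled_back F d \<zeta> t)" for t
  proof -
    let ?g = "pulled_back F d \<zeta> t"
    have A: "cmod (?g 0) \<le> circle_mean \<rho> ?g"
      using hol[of \<zeta> t] \<rho> r by (intro mean_value_le_circle_mean)
        (auto elim!: holomorphic_on_subset intro!: holomorphic_on_imp_continuous_on)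
    have pos: "cmod (?g 0) > 0" "circle_mean \<rho> ?g > 0" using g0'[of t] less_le_trans[OF _ A] by auto
    have "weighted_zero_sum ?W ?g \<le> ?K * ln (circle_mean \<rho> ?g / cmod (?g 0))"
      by (rule weighted_zero_sum_le(2)[OF hol g0' r(2) \<rho>(1) r(3) W1 W0 W2 K])
    also have "\<dots> \<le> ?K * (circle_mean \<rho> ?g / c)"
    proof (rule mult_left_mono[OF _ K])
      have "ln (circle_mean \<rho> ?g / cmod (?g 0)) \<le> circle_mean \<rho> ?g / cmod (?g 0)"
        using pos ln_le_minus_one[of "circle_mean \<rho> ?g / cmod (?g 0)"] by simp
      also have "\<dots> \<le> circle_mean \<rho> ?g / c"
        using pos c(1) g0[of t] by (intro divide_left_mono) auto
      finally show "ln (circle_mean \<rho> ?g / cmod (?g 0)) \<le> circle_mean \<rho> ?g / c" .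
    qed
    finally show ?thesis by simp
  qed
  have int1: "(\<lambda>t. weighted_zero_sum ?W (pulled_back F d \<zeta> t)) integrable_on {-T..T}" for T
  proof (intro integrable_continuous_interval continuous_on_weighted_zero_sum[OF r1 r(2) _ W1 continuous_on_pulled_back[OF F d r(3)]])
    show "continuous_on (ball 0 \<rho>) ?W"
      by (rule continuous_on_subset[OF continuous_on_disc_weight]) (use r in auto)
    show "pulled_back F d \<zeta> t holomorphic_on ball 0 \<rho>" for t
      by (rule holomorphic_on_subset[OF hol]) (use r in auto)
  qed (use g0' in auto)
  have int2: "(\<lambda>t. circle_mean \<rho> (pulled_back F d \<zeta> t)) integrable_on {-T..T}" for T
    by (intro integrable_continuous_interval continuous_on_circle_mean[OF continuous_on_pulled_back[OF F d r(3)] \<rho>(2)])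
  show ?thesis
  proof (rule tendsto_upperbound[OF L])
    show "\<forall>\<^sub>F T in at_top. 1 / (2 * T) * integral {-T..T} (\<lambda>t. weighted_zero_sum ?W (pulled_back F d \<zeta> t))
        \<le> ?K / c * (cmod \<zeta> + 2 * C)"
      using eventually_ge_at_top[of "max 1 (2 * d / (1 - \<rho>))"]
    proof eventually_elim
      case (elim T)
      have "1 / (2 * T) * integral {-T..T} (\<lambda>t. weighted_zero_sum ?W (pulled_back F d \<zeta> t))
          \<le> 1 / (2 * T) * integral {-T..T} (\<lambda>t. ?K / c * circle_mean \<rho> (pulled_back F d \<zeta> t))"
        using elim by (intro mult_left_mono integral_le int1 integrable_on_mult_right int2 le) auto
      also have "\<dots> = ?K / c * (1 / (2 * T) * integral {-T..T} (\<lambda>t. circle_mean \<rho> (pulled_back F d \<zeta> t)))"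
        by simp
      also have "\<dots> \<le> ?K / c * (cmod \<zeta> + 2 * C)"
        using elim K c(1) by (intro mult_left_mono carlson_average[OF F d \<rho>(2) r(3) C]) auto
      finally show ?case .
    qed
  qed simp
qed

lemma zero_average_antimono:
  assumes F: "F holomorphic_on half_plane 0" and d: "d > 0" and far: "\<And>s. Re s \<ge> d \<Longrightarrow> F s \<noteq> \<zeta>"
    and \<sigma>: "0 < \<sigma>" "\<sigma> \<le> \<sigma>'" and T: "T > 0"
  shows "zero_average F \<zeta> \<sigma>' T \<le> zero_average F \<zeta> \<sigma> T"
proof -
  let ?o = "\<lambda>s. of_int (zorder (\<lambda>w. F w - \<zeta>) s) :: real"
  have nz: "of_real d \<in> half_plane 0" "F (of_real d) \<noteq> \<zeta>" using d far[of "of_real d"] by (auto simp: half_plane_def)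
  have o: "?o s \<ge> 0" if "s \<in> half_plane 0" for s using zorder_nonneg_half_plane[OF F nz that] by simp
  have "(\<Sum>s\<in>counting_zeros F \<zeta> \<sigma>' T. ?o s * (Re s - \<sigma>')) \<le> (\<Sum>s\<in>counting_zeros F \<zeta> \<sigma>' T. ?o s * (Re s - \<sigma>))"
    by (intro sum_mono mult_left_mono o) (use \<sigma> in \<open>auto simp: counting_zeros_def\<close>)
  also have "\<dots> \<le> (\<Sum>s\<in>counting_zeros F \<zeta> \<sigma> T. ?o s * (Re s - \<sigma>))"
    by (intro sum_mono2 finite_counting_zeros[OF F far \<sigma>(1)] mult_nonneg_nonneg o)
      (use \<sigma> in \<open>auto simp: counting_zeros_def\<close>)
  finally show ?thesis unfolding zero_average_def using T by (intro mult_left_mono) auto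
qed

lemma antimono_bounded_tendsto_at_right_0:
  fixes g :: "real \<Rightarrow> real"
  assumes anti: "\<And>x y. 0 < x \<Longrightarrow> x \<le> y \<Longrightarrow> g y \<le> g x" and bdd: "\<And>x. 0 < x \<Longrightarrow> g x \<le> B"
  shows "\<exists>m. (g \<longlongrightarrow> m) (at_right 0)"
proof -
  let ?m = "SUP x\<in>{0<..}. g x"
  have bdd': "bdd_above (g ` {0<..})" using bdd by (auto intro!: bdd_aboveI)
  have "(g \<longlongrightarrow> ?m) (at_right 0)"
  proof (rule order_tendstoI)
    fix l assume "l < ?m"
    then obtain y where y: "y > 0" "l < g y" using less_cSUP_iff[OF _ bdd'] by auto
    have "\<forall>\<^sub>F x in at_right 0. 0 < x \<and> x < y"
      using y(1) by (auto simp: eventually_at_right[of 0 1] intro!: exI[of _ y])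
    then show "\<forall>\<^sub>F x in at_right 0. l < g x"
      by eventually_elim (use anti y in \<open>force intro: less_le_trans\<close>)
  next
    fix u assume u: "?m < u"
    show "\<forall>\<^sub>F x in at_right 0. g x < u"
      using eventually_at_right_less[of "0::real"]
    proof eventually_elim
      case (elim x)
      have "g x \<le> ?m" using elim by (intro cSUP_upper bdd') auto
      then show ?case using u by simp
    qed
  qed
  then show ?thesis ..
qed

lemma twisted_continuation_unique:
  assumes F: "twisted_continuation a \<omega> F" and G: "twisted_continuation a \<omega> G" and s: "s \<in> half_plane 0"
  shows "F s = G s"
proof (rule analytic_continuation_open[where f = F and g = G and s = "half_plane (1/2)" and s' = "half_plane 0", OF open_half_plane open_half_plane _ connected_half_plane])
  show "half_plane (1/2) \<noteq> {}" by (auto simp: half_plane_def intro!: exI[of _ 1])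
  show "half_plane (1/2) \<subseteq> half_plane 0" by (auto simp: half_plane_def)
  show "F holomorphic_on half_plane 0" "G holomorphic_on half_plane 0"
    using F G by (auto simp: twisted_continuation_def)
  show "F z = G z" if "z \<in> half_plane (1/2)" for z
    using sums_unique2[of "\<lambda>n. a n * \<omega> n * of_nat n powr (- z)"] F G that
    by (simp add: twisted_continuation_def)
qed (rule s)

text \<open>The bound is given for some continuation of the series and concerns every other one by uniqueness;
\<open>x \<le> 1 + x\<^sup>p\<close> reduces the exponent to one.\<close>

lemma carlson_set_imp_carlson_function:
  assumes p: "1 \<le> p" and \<omega>: "\<omega> \<in> carlson_set p a" and F: "twisted_continuation a \<omega> F"
  shows "\<exists>C. carlson_function a \<omega> F C"
proof -
  obtain G C where \<omega>t: "\<omega> \<in> torus_characters" and G: "twisted_continuation a \<omega> G"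
    and C: "\<forall>\<sigma>>0. \<forall>T\<ge>1. vertical_mean p G \<sigma> T \<le> C"
    using \<omega> by (auto simp: carlson_set_def)
  have Fh: "F holomorphic_on half_plane 0" using F by (simp add: twisted_continuation_def)
  have "integral {-T..T} (\<lambda>t. cmod (F (Complex \<sigma> t))) \<le> 2 * T * (1 + C)" if \<sigma>: "\<sigma> > 0" and T: "T \<ge> 1" for \<sigma> T
  proof -
    have eq: "G (Complex \<sigma> t) = F (Complex \<sigma> t)" for t
      by (rule twisted_continuation_unique[OF G F]) (use \<sigma> in \<open>simp add: half_plane_def\<close>)
    have cont: "continuous_on {-T..T} (\<lambda>t. cmod (F (Complex \<sigma> t)) powr p)"
      using p by (intro continuous_on_powr' continuous_intros continuous_on_vertical_line[OF Fh \<sigma>]) auto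
    have le: "x \<le> 1 + x powr p" if "x \<ge> 0" for x :: real
    proof (cases "x \<le> 1")
      case False
      then have "x powr 1 \<le> x powr p" using p by (intro powr_mono) auto
      then show ?thesis using False by simp
    qed (simp add: add_increasing2)
    have "integral {-T..T} (\<lambda>t. cmod (F (Complex \<sigma> t))) \<le> integral {-T..T} (\<lambda>t. 1 + cmod (F (Complex \<sigma> t)) powr p)"
      by (intro integral_le integrable_continuous_interval continuous_intros continuous_on_vertical_line[OF Fh \<sigma>] cont le) auto
    also have "\<dots> = 2 * T + integral {-T..T} (\<lambda>t. cmod (F (Complex \<sigma> t)) powr p)"
      using T by (subst integral_add) (auto intro!: integrable_continuous_interval cont)
    also have "\<dots> \<le> 2 * T + 2 * T * C"
      using C[rule_format, OF \<sigma> T] T by (simp add: vertical_mean_def eq divide_le_eq mult_ac)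
    finally show ?thesis by (simp add: algebra_simps)
  qed
  then show ?thesis using \<omega>t F by (auto simp: carlson_function_def)
qed

lemma far_abscissa:
  fixes C S e :: real
  assumes "e > 0"
  obtains d where "d \<ge> 3" "C * 2 powr (2 - d) * S \<le> e"
proof -
  have "((\<lambda>d::real. 2 powr (2 - d)) \<longlongrightarrow> (0::real)) at_top" by real_asymp
  then have "((\<lambda>d. C * 2 powr (2 - d) * S) \<longlongrightarrow> C * 0 * S) at_top" by (intro tendsto_intros)
  then have "\<forall>\<^sub>F d in at_top. C * 2 powr (2 - d) * S < e" using assms by (intro order_tendstoD(2)) auto
  then have "\<forall>\<^sub>F d in at_top. d \<ge> 3 \<and> C * 2 powr (2 - d) * S < e"
    using eventually_ge_at_top[of 3] by eventually_elim auto
  then obtain d where "d \<ge> 3" "C * 2 powr (2 - d) * S < e"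
    using eventually_happens'[OF trivial_limit_at_top_linorder] by blast
  then show ?thesis using that by force
qed

text \<open>The inner limit is decreasing in \<open>\<sigma>\<^sub>0\<close> and bounded, hence converges as \<open>\<sigma>\<^sub>0\<close> decreases to zero. It is
the same for all characters, and so is its limit.\<close>

lemma mean_counting_exists:
  assumes p: "1 \<le> p" and a: "a \<in> Hp_space p" and \<zeta>: "\<zeta> \<noteq> a 1"
  shows "\<exists>m. \<forall>\<omega> F C. carlson_function a \<omega> F C \<longrightarrow> has_mean_counting F \<zeta> m"
proof -
  obtain P C where P: "\<And>k. dirichlet_polynomial (P k)" and lim: "\<And>n. (\<lambda>k. P k n) \<longlonglongrightarrow> a n"
    and Cm: "\<And>k s. Re s \<ge> 0 \<Longrightarrow> torus_mean (\<lambda>\<omega>. cmod (twisted_poly (P k) \<omega> s)) \<le> C"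
    and Cc: "\<And>k n. cmod (P k n) \<le> C"
    using Hp_space_bounded_approximation[OF p a] by blast
  have Ca: "cmod (a n) \<le> C" for n
    by (rule tendsto_upperbound[OF tendsto_norm[OF lim]]) (use Cc in auto)
  define c where "c = cmod (a 1 - \<zeta>) / 2"
  have c: "c > 0" using \<zeta> by (simp add: c_def)
  obtain d where d: "d \<ge> 3" and far: "C * 2 powr (2 - d) * (\<Sum>n. real n powr - 2) \<le> cmod (a 1 - \<zeta>) / 4"
    using far_abscissa[of "cmod (a 1 - \<zeta>) / 4" C "\<Sum>n. real n powr - 2"] \<zeta> by auto
  have d0: "d > 0" "d \<ge> 2" using d by auto
  have Fc: "c \<le> cmod (F s - \<zeta>)" if "carlson_function a \<omega> F CF" "Re s \<ge> d" for \<omega> F CF s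
  proof -
    have F: "\<omega> \<in> torus_characters" "(\<lambda>n. a n * \<omega> n * of_nat n powr (- s)) sums F s"
      using that d by (auto simp: carlson_function_def twisted_continuation_def half_plane_def)
    show ?thesis
      unfolding c_def by (rule dirichlet_series_far_from_value[OF F(1) d0(2) that(2) F(2) Ca far])
  qed
  have far': "F s \<noteq> \<zeta>" if "carlson_function a \<omega> F CF" "Re s \<ge> d" for \<omega> F CF s
    using Fc[OF that] c by auto
  have Fh: "F holomorphic_on half_plane 0" if "carlson_function a \<omega> F CF" for \<omega> F CF
    using that by (simp add: carlson_function_def twisted_continuation_def)
  define conv where "conv F \<sigma> L \<longleftrightarrow>
    ((\<lambda>T. 1 / (2 * T) * integral {-T..T} (\<lambda>t. weighted_zero_sum (disc_weight \<sigma> d) (pulled_back F d \<zeta> t))) \<longlongrightarrow> L) at_top"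
    for F \<sigma> L
  have "\<exists>L. \<sigma> > 0 \<longrightarrow> (\<forall>\<omega> F CF. carlson_function a \<omega> F CF \<longrightarrow> conv F \<sigma> L)" for \<sigma>
  proof (cases "\<sigma> > 0")
    case True
    obtain L where "\<forall>(\<omega>, F)\<in>{(\<omega>, F). \<exists>C. carlson_function a \<omega> F C}. conv F \<sigma> L"
      using disc_average_limit[OF P lim Cm Cc d far \<zeta> True] unfolding conv_def by blast
    then show ?thesis by blast
  qed simp
  then obtain L where L: "\<And>\<sigma> \<omega> F CF. \<sigma> > 0 \<Longrightarrow> carlson_function a \<omega> F CF \<Longrightarrow> conv F \<sigma> (L \<sigma>)"
    by metis
  note L = L[unfolded conv_def]
  define g where "g \<sigma> = 2 * pi * L \<sigma>" for \<sigma>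
  have g: "((\<lambda>T. zero_average F \<zeta> \<sigma> T) \<longlongrightarrow> g \<sigma>) at_top" if "\<sigma> > 0" "carlson_function a \<omega> F CF" for \<sigma> \<omega> F CF
    unfolding g_def by (rule zero_average_tendsto[OF Fh[OF that(2)] d0(1) that(1) far'[OF that(2)] L[OF that]])
  show ?thesis
  proof (cases "\<exists>\<omega> F CF. carlson_function a \<omega> F CF")
    case True
    then obtain \<omega>0 F0 C0 where carl: "carlson_function a \<omega>0 F0 C0" by blast
    have "\<exists>m. (g \<longlongrightarrow> m) (at_right 0)"
    proof (rule antimono_bounded_tendsto_at_right_0)
      fix x y :: real assume xy: "0 < x" "x \<le> y"
      show "g y \<le> g x"
      proof (rule tendsto_le[OF _ g[OF xy(1) carl] g[OF less_le_trans[OF xy] carl]])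
        show "\<forall>\<^sub>F T in at_top. zero_average F0 \<zeta> y T \<le> zero_average F0 \<zeta> x T"
          using eventually_gt_at_top[of 0]
          by eventually_elim (rule zero_average_antimono[OF Fh[OF carl] d0(1) far'[OF carl] xy])
      qed simp
    next
      fix x :: real assume x: "0 < x"
      show "g x \<le> 2 * pi * (jensen_constant d / c * (cmod \<zeta> + 2 * C0))"
        unfolding g_def
        by (intro mult_left_mono carlson_zero_density_bound[OF carl d0(1) x c Fc[OF carl] L[OF x carl]]) auto
    qed
    then obtain m where m: "(g \<longlongrightarrow> m) (at_right 0)" ..
    have "has_mean_counting F \<zeta> m" if "carlson_function a \<omega> F CF" for \<omega> F CF
      unfolding has_mean_counting_def
    proof (intro conjI exI[of _ g] allI impI m)
      show "finite (counting_zeros F \<zeta> \<sigma> T)" if "\<sigma> > 0" for \<sigma> T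
        by (rule finite_counting_zeros[OF Fh[OF \<open>carlson_function a \<omega> F CF\<close>] far'[OF \<open>carlson_function a \<omega> F CF\<close>] that])
    qed (rule g[OF _ that])
    then show ?thesis by blast
  qed blast
qed

theorem theorem6p4:
  fixes p :: real and a :: "nat \<Rightarrow> complex"
  assumes "1 \<le> p" and "a \<in> Hp_space p"
  shows "\<exists>M :: complex \<Rightarrow> real. \<forall>\<omega>\<in>carlson_set p a. \<forall>F. twisted_continuation a \<omega> F \<longrightarrow>
           (\<forall>\<zeta>. \<zeta> \<noteq> a 1 \<longrightarrow> has_mean_counting F \<zeta> (M \<zeta>))"
proof -
  have "\<forall>\<zeta>. \<exists>m. \<zeta> \<noteq> a 1 \<longrightarrow> (\<forall>\<omega> F C. carlson_function a \<omega> F C \<longrightarrow> has_mean_counting F \<zeta> m)"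
    using mean_counting_exists[OF assms] by blast
  then obtain M where M: "\<And>\<zeta> \<omega> F C. \<zeta> \<noteq> a 1 \<Longrightarrow> carlson_function a \<omega> F C \<Longrightarrow> has_mean_counting F \<zeta> (M \<zeta>)"
    by metis
  show ?thesis
    using M carlson_set_imp_carlson_function[OF assms(1)] by blast
qed

end
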